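(* Let $A$ be a unital separable C*-algebra, $H$ a separable Hilbert space, $G$ a group, and $\tau : G \to \mathrm{Aut}(A)$ an action of $G$ on $A$ by *-automorphisms. Let $\phi \in \mathrm{UCP}^G_A(H)$, let $\phi = V^*\rho V$ be its minimal Stinespring dilation on the Hilbert space $K$ with associated unitary representation $U_\phi$ of $G$ on $K$, and let $(X,\sigma,e)$ be the Paschke dilation of $\phi$, with associated representations $\tilde\sigma$ of $A$ and $\tilde W_\phi$ of $G$ on the self-dual Hilbert $B(H)$-module $X'$. Then the following statements are equivalent: (1) $\phi \in \mathrm{ext}(\mathrm{UCP}^G_A(H))$, i.e. $\phi$ is an extreme point of $\mathrm{UCP}^G_A(H)$; (2) for every $0<t<1$, if $\phi_0 \in [0,\phi] \cap t\,\mathrm{UCP}^G_A(H)$, then $\phi_0 = t\phi$; (3) the subspace $[VH]$ is a faithful subspace of $K$ for the von Neumann algebra $\{\rho(A)\cup U_\phi(G)\}'$; (4) if any $T \in (\tilde\sigma(A)\cup\tilde W_\phi(G))'$ satisfies $\langle T\hat e,\hat e\rangle = 0$, then $T=0$.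
   Context: $\mathrm{UCP}^G_A(H)$ is the convex set of unital completely positive maps $\phi:A\to B(H)$ with $\phi(\tau_g(a))=\phi(a)$ for all $g\in G$, $a\in A$. For a completely positive $\phi: A\to B(H)$, $[0,\phi]$ is the set of completely positive $\theta:A\to B(H)$ such that $\phi-\theta$ is completely positive. $t\,\mathrm{UCP}^G_A(H)=\{t\psi:\psi\in\mathrm{UCP}^G_A(H)\}$. Minimal Stinespring dilation: a Hilbert space $K$, an isometry $V: H\to K$ and a unital *-representation $\rho: A\to B(K)$ with $\phi(a)=V^*\rho(a)V$ and $\overline{\mathrm{span}}\,\rho(A)VH = K$. For $\phi$ $G$-invariant, $U_\phi: G\to B(K)$ is the unitary representation determined by $U_\phi(g)V = V$ and $U_\phi(g)\rho(a)U_\phi(g)^* = \rho(\tau_g(a))$. $[VH]$ is the closed linear span of $VH$. A closed subspace $K_0\subseteq K$ with orthogonal projection $P$ is faithful for a von Neumann algebra $M\subseteq B(K)$ if for $T\in M$, $PT|_{K_0}=0$ implies $T=0$. Paschke dilation (with $B=B(H)$): Hilbert $B$-modules are right $B$-modules, complete, with $B$-valued inner product linear in the first variable, $\langle x b,y\rangle=\langle x,y\rangle b$; $\mathcal{P}(X)$ is the C*-algebra of adjointable operators on $X$. The Paschke dilation of $\phi$ is $(X,\sigma,e)$ with $X$ a Hilbert $B$-module, $\sigma:A\to\mathcal{P}(X)$ a *-representation, $e\in X$, $\phi(a)=\langle\sigma(a)e,e\rangle$ for all $a\in A$ and $\mathrm{span}\{\sigma(a)(eb):a\in A,b\in B\}$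 dense in $X$ (unique up to isomorphism). For $\phi$ $G$-invariant, $W_\phi:G\to\mathcal{P}(X)$ is the unitary representation with $W_\phi(g)e=e$ and $W_\phi(g)\sigma(a)W_\phi(g)^*=\sigma(\tau_g(a))$. $X'$ is the set of bounded $B$-module maps $X\to B$; for $x\in X$, $\hat x\in X'$ is $\hat x(y)=\langle y,x\rangle$. Since $B$ is a von Neumann algebra, the inner product of $X$ (embedded by $x\mapsto\hat x$) extends to $X'$, making it a self-dual Hilbert $B$-module with $\langle\hat x,\eta\rangle=\eta(x)$ for $x\in X$, $\eta\in X'$, and each $T\in\mathcal{P}(X)$ extends uniquely to $\tilde T\in\mathcal{P}(X')$, with $\tilde T\hat x=\widehat{Tx}$ (Paschke). Set $\tilde\sigma(a)=\widetilde{\sigma(a)}$, $\tilde W_\phi(g)=\widetilde{W_\phi(g)}$. The commutant $(\tilde\sigma(A)\cup\tilde W_\phi(G))'$ is taken in $\mathcal{P}(X')$. *)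

theory Defs
  imports
    "HOL-Analysis.Analysis"
    "HOL-Algebra.Group_Action"
    "HOL-Library.Function_Algebras"
begin

section \<open>Complex vector spaces, Hilbert spaces and C*-algebras\<close>

class complex_vector = real_vector +
  fixes scaleC :: "complex \<Rightarrow> 'a \<Rightarrow> 'a"  (infixr \<open>*\<^sub>C\<close> 75)
  assumes scaleC_add_right: "c *\<^sub>C (x + y) = c *\<^sub>C x + c *\<^sub>C y"
    and scaleC_add_left: "(c + d) *\<^sub>C x = c *\<^sub>C x + d *\<^sub>C x"
    and scaleC_scaleC: "c *\<^sub>C d *\<^sub>C x = (c * d) *\<^sub>C x"
    and scaleC_one: "1 *\<^sub>C x = x"
    and scaleR_eq_scaleC: "r *\<^sub>R x = complex_of_real r *\<^sub>C x"

global_interpretation complex_vector: vector_space "scaleC :: complex \<Rightarrow> 'a \<Rightarrow> 'a :: complex_vector"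
  defines cspan = complex_vector.span
    and csubspace = complex_vector.subspace
  by unfold_locales (simp_all add: scaleC_add_right scaleC_add_left scaleC_scaleC scaleC_one)

definition clinear :: "('a::complex_vector \<Rightarrow> 'b::complex_vector) \<Rightarrow> bool"
  where "clinear f \<longleftrightarrow> Vector_Spaces.linear scaleC scaleC f"

lemma clinear_iff:
  "clinear f \<longleftrightarrow> (\<forall>x y. f (x + y) = f x + f y) \<and> (\<forall>c x. f (c *\<^sub>C x) = c *\<^sub>C f x)"
  by (auto simp: clinear_def Vector_Spaces.linear_def module_hom_def module_hom_axioms_def
      complex_vector.vector_space_axioms complex_vector.module_axioms)

text \<open>The inner product is linear in the first variable.\<close>

class complex_hilbert = complex_vector + real_inner + banach +
  fixes cinner :: "'a \<Rightarrow> 'a \<Rightarrow> complex"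
  assumes cinner_commute: "cinner x y = cnj (cinner y x)"
    and cinner_add_left: "cinner (x + y) z = cinner x z + cinner y z"
    and cinner_scaleC_left: "cinner (c *\<^sub>C x) y = c * cinner x y"
    and inner_eq_Re_cinner: "inner x y = Re (cinner x y)"

text \<open>
  Unital complex C*-algebras.  The class \<^class>\<open>ring_1\<close> is avoided on purpose: it would exclude
  the zero algebra, and with it the operators on the zero Hilbert space.
\<close>

class cstar_algebra = complex_vector + real_normed_algebra + banach + monoid_mult +
  fixes star :: "'a \<Rightarrow> 'a"
  assumes scaleC_mult_left: "(c *\<^sub>C x) * y = c *\<^sub>C (x * y)"
    and scaleC_mult_right: "x * (c *\<^sub>C y) = c *\<^sub>C (x * y)"
    and norm_scaleC: "norm (c *\<^sub>C x) = cmod c * norm x"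
    and star_star: "star (star x) = x"
    and star_add: "star (x + y) = star x + star y"
    and star_scaleC: "star (c *\<^sub>C x) = cnj c *\<^sub>C star x"
    and star_mult: "star (x * y) = star y * star x"
    and norm_star_mult_self: "norm (star x * x) = (norm x)\<^sup>2"

definition cstar_positive :: "'a::cstar_algebra \<Rightarrow> bool"
  where "cstar_positive a \<longleftrightarrow> (\<exists>b. a = star b * b)"

definition unital_star_hom :: "('a::cstar_algebra \<Rightarrow> 'b::cstar_algebra) \<Rightarrow> bool"
  where "unital_star_hom f \<longleftrightarrow>
    clinear f \<and> (\<forall>x y. f (x * y) = f x * f y) \<and> (\<forall>x. f (star x) = star (f x)) \<and> f 1 = 1"

section \<open>The C*-algebra of bounded operators on a Hilbert space\<close>

lemma complete_closed_subspace_projection: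
  fixes S :: "'a::{real_inner,complete_space} set"
  assumes "subspace S" "closed S"
  shows "\<exists>y\<in>S. \<forall>z\<in>S. inner (x - y) z = 0"
proof -
  define d where "d = (INF y\<in>S. (norm (x - y))\<^sup>2)"
  have S0: "0 \<in> S" by (rule subspace_0[OF assms(1)])
  have bdd: "bdd_below ((\<lambda>y. (norm (x - y))\<^sup>2) ` S)" by (rule bdd_belowI[of _ 0]) auto
  have d_le: "d \<le> (norm (x - y))\<^sup>2" if "y \<in> S" for y
    unfolding d_def by (rule cINF_lower[OF bdd that])
  have "\<exists>y\<in>S. (norm (x - y))\<^sup>2 < d + 1 / Suc n" for n
  proof -
    have "d < d + 1 / real (Suc n)" by simp
    then show ?thesis
      using cINF_less_iff[OF _ bdd, of "d + 1 / real (Suc n)"] S0 unfolding d_def by auto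
  qed
  then obtain y where yS: "\<And>n. y n \<in> S" and y: "\<And>n. (norm (x - y n))\<^sup>2 < d + 1 / Suc n" by metis
  have par: "(norm (y m - y n))\<^sup>2 \<le> 2 * (1 / Suc m + 1 / Suc n)" for m n
  proof -
    define u where "u = x - y m"
    define v where "v = x - y n"
    have mid: "(1/2) *\<^sub>R (y m + y n) \<in> S"
      using assms(1) yS by (intro subspace_scale subspace_add)
    have e: "x - (1/2) *\<^sub>R (y m + y n) = (1/2) *\<^sub>R (u + v)"
      unfolding u_def v_def by (simp add: algebra_simps flip: scaleR_add_left)
    have "d \<le> (norm ((1/2) *\<^sub>R (u + v)))\<^sup>2" using d_le[OF mid] unfolding e .
    then have 1: "4 * d \<le> (norm (u + v))\<^sup>2" by (simp add: power_mult_distrib power2_eq_square)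
    have 2: "(norm (u + v))\<^sup>2 + (norm (v - u))\<^sup>2 = 2 * (norm u)\<^sup>2 + 2 * (norm v)\<^sup>2"
      by (simp add: power2_norm_eq_inner inner_add_left inner_add_right inner_diff_left inner_diff_right)
    have "v - u = y m - y n" unfolding u_def v_def by simp
    then show ?thesis using 1 2 y[of m] y[of n] unfolding u_def v_def by (simp add: distrib_left)
  qed
  have "Cauchy y"
  proof (rule metric_CauchyI)
    fix e :: real assume e: "e > 0"
    obtain N where N: "inverse (real (Suc N)) < e\<^sup>2 / 4"
      using reals_Archimedean[of "e\<^sup>2 / 4"] e by auto
    have "dist (y m) (y n) < e" if "m \<ge> N" "n \<ge> N" for m n
    proof -
      have le: "1 / real (Suc k) \<le> inverse (real (Suc N))" if "k \<ge> N" for k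
        using that by (simp add: divide_simps)
      have "(norm (y m - y n))\<^sup>2 < e\<^sup>2"
        using par[of m n] le[OF that(1)] le[OF that(2)] N by simp
      then show ?thesis using e by (simp add: dist_norm power_less_imp_less_base)
    qed
    then show "\<exists>M. \<forall>m\<ge>M. \<forall>n\<ge>M. dist (y m) (y n) < e" by blast
  qed
  then obtain p where p: "y \<longlonglongrightarrow> p" using Cauchy_convergent convergent_def by blast
  have pS: "p \<in> S" using closed_sequentially[OF assms(2)] yS p by blast
  have "(\<lambda>n. (norm (x - y n))\<^sup>2) \<longlonglongrightarrow> (norm (x - p))\<^sup>2" by (intro tendsto_intros p)
  moreover have "(\<lambda>n. d + 1 / Suc n) \<longlonglongrightarrow> d + 0"
    using LIMSEQ_inverse_real_of_nat by (intro tendsto_intros) (simp add: inverse_eq_divide)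
  ultimately have pd: "(norm (x - p))\<^sup>2 \<le> d"
    using y by (intro LIMSEQ_le[of _ _ "\<lambda>n. d + 1 / Suc n"]) (auto intro: less_imp_le)
  have "inner (x - p) z = 0" if z: "z \<in> S" for z
  proof (cases "z = 0")
    case False
    define t where "t = inner (x - p) z / inner z z"
    have zz: "inner z z > 0" using False by simp
    have "p + t *\<^sub>R z \<in> S" using assms(1) pS z by (intro subspace_add subspace_scale)
    then have "(norm (x - p))\<^sup>2 \<le> (norm ((x - p) - t *\<^sub>R z))\<^sup>2"
      using order_trans[OF pd d_le] by (simp only: diff_diff_eq)
    also have "\<dots> = (norm (x - p))\<^sup>2 - 2 * t * inner (x - p) z + t\<^sup>2 * inner z z"
      by (simp only: power2_norm_eq_inner)
        (simp add: inner_diff_left inner_diff_right inner_commute algebra_simps power2_eq_square)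
    also have "\<dots> = (norm (x - p))\<^sup>2 - (inner (x - p) z)\<^sup>2 / inner z z"
      unfolding t_def using zz by (simp add: field_simps power2_eq_square)
    finally have "(inner (x - p) z)\<^sup>2 / inner z z \<le> 0" by simp
    then have "(inner (x - p) z)\<^sup>2 \<le> 0" using zz by (simp add: divide_le_0_iff)
    then show ?thesis by simp
  qed simp
  with pS show ?thesis by blast
qed

lemma bounded_linear_Riesz:
  fixes f :: "'a::{real_inner,complete_space} \<Rightarrow> real"
  assumes "bounded_linear f"
  shows "\<exists>z. \<forall>x. f x = inner x z"
proof (cases "\<forall>x. f x = 0")
  case True
  then show ?thesis by (intro exI[of _ 0]) simp
next
  case False
  then obtain x where x: "f x \<noteq> 0" by blast
  interpret f: bounded_linear f by fact
  let ?S = "{x. f x = 0}"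
  have "subspace ?S" by (auto simp: subspace_def f.add f.scaleR f.zero)
  moreover have "closed ?S"
    by (intro closed_Collect_eq f.continuous_on continuous_intros)
  ultimately obtain y where y: "f y = 0" and o: "\<And>z. f z = 0 \<Longrightarrow> inner (x - y) z = 0"
    using complete_closed_subspace_projection[of ?S x] by auto
  define w where "w = x - y"
  have fw: "f w \<noteq> 0" using x y by (simp add: w_def f.diff)
  then have ww: "inner w w \<noteq> 0" using f.zero by auto
  have "f v = inner v ((f w / inner w w) *\<^sub>R w)" for v
  proof -
    have "f (v - (f v / f w) *\<^sub>R w) = 0" using fw by (simp add: f.diff f.scaleR)
    from o[OF this] have "inner w v = f v / f w * inner w w"
      by (simp add: w_def[symmetric] inner_diff_right)
    then show ?thesis using fw ww by (simp add: inner_commute)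
  qed
  then show ?thesis by blast
qed

context complex_hilbert
begin

lemma cinner_add_right: "cinner x (y + z) = cinner x y + cinner x z"
  by (metis cinner_add_left cinner_commute complex_cnj_add)

lemma cinner_scaleC_right: "cinner x (c *\<^sub>C y) = cnj c * cinner x y"
  by (metis cinner_commute cinner_scaleC_left complex_cnj_mult)

lemma cinner_eq_inner: "cinner x y = Complex (inner x y) (inner x (\<i> *\<^sub>C y))"
  by (simp add: inner_eq_Re_cinner cinner_scaleC_right complex_eq_iff)

lemma cinner_self: "cinner x x = complex_of_real ((norm x)\<^sup>2)"
proof -
  have "Im (cinner x x) = 0" using cinner_commute[of x x] by (metis complex_cnj_cancel_iff
      complex_cnj_complex_of_real complex_is_Real_iff Reals_cnj_iff)
  moreover have "Re (cinner x x) = (norm x)\<^sup>2"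
    by (simp add: norm_eq_sqrt_inner flip: inner_eq_Re_cinner)
  ultimately show ?thesis by (simp add: complex_eq_iff)
qed

lemma cinner_extI: "(\<And>z. cinner z x = cinner z y) \<Longrightarrow> x = y"
proof -
  assume "\<And>z. cinner z x = cinner z y"
  then have "inner z x = inner z y" for z by (simp add: inner_eq_Re_cinner)
  then have "inner (x - y) (x - y) = 0" by (simp add: inner_diff_right)
  then show ?thesis by simp
qed

end

lemma norm_scaleC_hilbert: "norm (c *\<^sub>C x) = cmod c * norm (x::'a::complex_hilbert)"
proof -
  have "complex_of_real ((norm (c *\<^sub>C x))\<^sup>2) = (c * cnj c) * cinner x x"
    unfolding cinner_self[of "c *\<^sub>C x", symmetric]
    by (simp only: cinner_scaleC_left cinner_scaleC_right mult_ac)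
  also have "\<dots> = complex_of_real ((cmod c * norm x)\<^sup>2)"
    by (simp only: cinner_self complex_norm_square[symmetric] of_real_mult[symmetric] power_mult_distrib)
  finally have "(norm (c *\<^sub>C x))\<^sup>2 = (cmod c * norm x)\<^sup>2" by (simp only: of_real_eq_iff)
  then show ?thesis by (simp add: power2_eq_iff_nonneg)
qed

lemma bounded_linear_scaleC_hilbert:
  assumes "bounded_linear f"
  shows "bounded_linear (\<lambda>x. c *\<^sub>C (f x :: 'a::complex_hilbert))"
proof -
  have "bounded_linear ((*\<^sub>C) c :: 'a \<Rightarrow> 'a)"
    by (rule bounded_linear_intro[of _ "cmod c"])
      (simp_all add: scaleC_add_right scaleR_eq_scaleC scaleC_scaleC norm_scaleC_hilbert mult.commute)
  from bounded_linear_compose[OF this assms] show ?thesis by simp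
qed

text \<open>The Hilbert space adjoint; meaningful for bounded complex-linear maps.\<close>

definition cadjoint :: "('h::complex_hilbert \<Rightarrow> 'k::complex_hilbert) \<Rightarrow> 'k \<Rightarrow> 'h"
  where "cadjoint T = (THE S. \<forall>x y. cinner (T x) y = cinner x (S y))"

lemma cinner_cadjoint:
  fixes T :: "'h::complex_hilbert \<Rightarrow> 'k::complex_hilbert"
  assumes "bounded_linear T" "clinear T"
  shows "cinner (T x) y = cinner x (cadjoint T y)"
proof -
  interpret T: bounded_linear T by fact
  have "\<exists>z. \<forall>x. inner (T x) y = inner x z" for y
    by (rule bounded_linear_Riesz)
      (use bounded_linear_compose[OF bounded_linear_inner_left assms(1)] in \<open>simp add: o_def\<close>)
  then obtain S where S: "\<And>x y. inner (T x) y = inner x (S y)" by metis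
  have "cinner (T x) y = cinner x (S y)" for x y
  proof -
    have i: "inner z (\<i> *\<^sub>C w) = - inner (\<i> *\<^sub>C z) w" for z w :: "'c::complex_hilbert"
      by (simp add: inner_eq_Re_cinner cinner_scaleC_right cinner_scaleC_left)
    have "inner (T x) (\<i> *\<^sub>C y) = inner x (\<i> *\<^sub>C S y)"
      using S[of "\<i> *\<^sub>C x" y] assms(2) by (simp add: i clinear_iff)
    then show ?thesis by (simp add: cinner_eq_inner S)
  qed
  then have ex: "\<forall>x y. cinner (T x) y = cinner x (S y)" by blast
  have "\<forall>x y. cinner (T x) y = cinner x (cadjoint T y)"
    unfolding cadjoint_def
  proof (rule theI[of _ S], rule ex)
    fix S' assume "\<forall>x y. cinner (T x) y = cinner x (S' y)"
    then show "S' = S" using ex by (metis cinner_extI ext)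
  qed
  then show ?thesis by blast
qed

lemma cadjoint_unique:
  assumes "\<And>x y. cinner (T x) y = cinner x (S y)"
  shows "cadjoint T = S"
  unfolding cadjoint_def
proof (rule the_equality)
  fix S' assume S': "\<forall>x y. cinner (T x) y = cinner x (S' y)"
  show "S' = S" by (rule ext, rule cinner_extI) (metis S' assms)
qed (simp add: assms)

lemma cadjoint_bounded_clinear:
  fixes T :: "'h::complex_hilbert \<Rightarrow> 'k::complex_hilbert"
  assumes "bounded_linear T" "clinear T"
  shows "bounded_linear (cadjoint T)" "clinear (cadjoint T)"
proof -
  note a = cinner_cadjoint[OF assms, symmetric]
  show cl: "clinear (cadjoint T)"
    unfolding clinear_iff
    by (intro conjI allI cinner_extI) (simp_all add: a cinner_add_right cinner_scaleC_right)
  obtain K where K: "\<And>x. norm (T x) \<le> norm x * K" "0 \<le> K"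
    using bounded_linear.nonneg_bounded[OF assms(1)] by blast
  have "norm (cadjoint T y) \<le> norm y * K" for y
  proof (cases "cadjoint T y = 0")
    case False
    let ?z = "cadjoint T y"
    have "(norm ?z)\<^sup>2 = inner ?z ?z" by (simp add: power2_norm_eq_inner)
    also have "\<dots> = inner (T ?z) y" by (simp add: inner_eq_Re_cinner a)
    also have "\<dots> \<le> norm (T ?z) * norm y" by (rule norm_cauchy_schwarz)
    also have "\<dots> \<le> (norm ?z * K) * norm y" by (intro mult_right_mono K) simp
    finally have "norm ?z * norm ?z \<le> norm ?z * (norm y * K)"
      by (simp add: power2_eq_square mult_ac)
    then show ?thesis using False by simp
  qed (use K in simp)
  then show "bounded_linear (cadjoint T)"
    using cl by (intro bounded_linear_intro[of _ K]) (auto simp: clinear_iff scaleR_eq_scaleC)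
qed

typedef (overloaded) 'h bop =
  "{T :: 'h::complex_hilbert \<Rightarrow>\<^sub>L 'h. clinear (blinfun_apply T)}"
  morphisms blinfun_of_bop Bop
  by (rule exI[of _ 0]) (simp add: clinear_iff complex_vector.scale_zero_right)

setup_lifting type_definition_bop

lift_definition bop_apply :: "'h::complex_hilbert bop \<Rightarrow> 'h \<Rightarrow> 'h" is blinfun_apply .

lemma bop_eqI: "(\<And>x. bop_apply S x = bop_apply T x) \<Longrightarrow> S = T"
  by transfer (rule blinfun_eqI)

lemma bop_bounded_linear: "bounded_linear (bop_apply T)"
  by transfer (rule blinfun.bounded_linear_right)

lemma bop_clinear: "clinear (bop_apply T)"
  by transfer simp

instantiation bop :: (complex_hilbert) real_normed_vector
begin
lift_definition zero_bop :: "'a bop" is 0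
  by (simp add: clinear_iff complex_vector.scale_zero_right)
lift_definition plus_bop :: "'a bop \<Rightarrow> 'a bop \<Rightarrow> 'a bop" is "(+)"
  by (simp add: clinear_iff plus_blinfun.rep_eq scaleC_add_right)
lift_definition minus_bop :: "'a bop \<Rightarrow> 'a bop \<Rightarrow> 'a bop" is "(-)"
  by (simp add: clinear_iff minus_blinfun.rep_eq complex_vector.scale_right_diff_distrib)
lift_definition uminus_bop :: "'a bop \<Rightarrow> 'a bop" is "uminus"
  by (simp add: clinear_iff uminus_blinfun.rep_eq complex_vector.scale_minus_right)
lift_definition scaleR_bop :: "real \<Rightarrow> 'a bop \<Rightarrow> 'a bop" is "(*\<^sub>R)"
  by (simp add: clinear_iff scaleR_blinfun.rep_eq scaleR_add_right scaleR_eq_scaleC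
      scaleC_add_right scaleC_scaleC mult.commute)
lift_definition norm_bop :: "'a bop \<Rightarrow> real" is norm .
definition sgn_bop :: "'a bop \<Rightarrow> 'a bop" where "sgn_bop T = inverse (norm T) *\<^sub>R T"
definition dist_bop :: "'a bop \<Rightarrow> 'a bop \<Rightarrow> real" where "dist_bop S T = norm (S - T)"
definition uniformity_bop :: "('a bop \<times> 'a bop) filter"
  where "uniformity_bop = (INF e\<in>{0<..}. principal {(S, T). dist S T < e})"
definition open_bop :: "'a bop set \<Rightarrow> bool"
  where "open_bop S = (\<forall>x\<in>S. \<forall>\<^sub>F (x', y) in uniformity. x' = x \<longrightarrow> y \<in> S)"
instance
proof
  show "norm (r *\<^sub>R T) = \<bar>r\<bar> * norm T" for r and T :: "'a bop" by transfer simp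
  show "norm (S + T) \<le> norm S + norm T" for S T :: "'a bop" by transfer (rule norm_triangle_ineq)
qed (transfer; simp add: algebra_simps sgn_bop_def dist_bop_def uniformity_bop_def open_bop_def; fail |
    simp add: sgn_bop_def dist_bop_def uniformity_bop_def open_bop_def)+
end

lemma blinfun_of_bop_dist: "dist (blinfun_of_bop S) (blinfun_of_bop T) = dist S T"
  by (simp add: dist_norm norm_bop.rep_eq minus_bop.rep_eq)

instance bop :: (complex_hilbert) banach
proof
  fix X :: "nat \<Rightarrow> 'a bop"
  assume "Cauchy X"
  then have "Cauchy (\<lambda>n. blinfun_of_bop (X n))"
    by (simp add: Cauchy_def blinfun_of_bop_dist)
  then obtain L where L: "(\<lambda>n. blinfun_of_bop (X n)) \<longlonglongrightarrow> L"
    using Cauchy_convergent convergent_def by blast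
  have ev: "(\<lambda>n. bop_apply (X n) x) \<longlonglongrightarrow> blinfun_apply L x" for x
    unfolding bop_apply.rep_eq by (intro tendsto_intros L)
  have cont: "(\<lambda>n. c *\<^sub>C f n) \<longlonglongrightarrow> c *\<^sub>C l" if "f \<longlonglongrightarrow> l" for c f and l :: 'a
    by (rule bounded_linear.tendsto[OF bounded_linear_scaleC_hilbert[OF bounded_linear_ident] that])
  have "blinfun_apply L (c *\<^sub>C x) = c *\<^sub>C blinfun_apply L x" for c x
  proof (rule LIMSEQ_unique[OF ev])
    show "(\<lambda>n. bop_apply (X n) (c *\<^sub>C x)) \<longlonglongrightarrow> c *\<^sub>C blinfun_apply L x"
      using cont[OF ev, of c x] by (simp add: bop_clinear[unfolded clinear_iff])
  qed
  then have "clinear (blinfun_apply L)" by (simp add: clinear_iff blinfun.add_right)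
  then have "blinfun_of_bop (Bop L) = L" by (simp add: Bop_inverse)
  then have "X \<longlonglongrightarrow> Bop L"
    using L unfolding tendsto_iff by (metis (mono_tags, lifting) blinfun_of_bop_dist eventually_mono)
  then show "convergent X" by (auto simp: convergent_def)
qed

instantiation bop :: (complex_hilbert) cstar_algebra
begin
lift_definition one_bop :: "'a bop" is id_blinfun
  by (simp add: clinear_iff)
lift_definition times_bop :: "'a bop \<Rightarrow> 'a bop \<Rightarrow> 'a bop" is blinfun_compose
  by (simp add: clinear_iff)
lift_definition scaleC_bop :: "complex \<Rightarrow> 'a bop \<Rightarrow> 'a bop"
  is "\<lambda>c T. Blinfun (\<lambda>x. c *\<^sub>C blinfun_apply T x)"
proof -
  fix c and T :: "'a \<Rightarrow>\<^sub>L 'a" assume T: "clinear (blinfun_apply T)"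
  have "bounded_linear (\<lambda>x. c *\<^sub>C blinfun_apply T x)"
    by (intro bounded_linear_scaleC_hilbert blinfun.bounded_linear_right)
  then show "clinear (blinfun_apply (Blinfun (\<lambda>x. c *\<^sub>C blinfun_apply T x)))"
    using T by (simp add: bounded_linear_Blinfun_apply clinear_iff scaleC_add_right scaleC_scaleC mult.commute)
qed
lift_definition star_bop :: "'a bop \<Rightarrow> 'a bop" is "\<lambda>T. Blinfun (cadjoint (blinfun_apply T))"
  by (simp add: bounded_linear_Blinfun_apply cadjoint_bounded_clinear blinfun.bounded_linear_right)

lemma bop_apply_simps:
  "bop_apply (S + T) x = bop_apply S x + bop_apply T x"
  "bop_apply (r *\<^sub>R T) x = r *\<^sub>R bop_apply T x"
  "bop_apply 1 x = x"
  "bop_apply (S * T) x = bop_apply S (bop_apply T x)"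
  "bop_apply (c *\<^sub>C T) x = c *\<^sub>C bop_apply T x"
  "bop_apply (star T) x = cadjoint (bop_apply T) x"
proof -
  show "bop_apply (S + T) x = bop_apply S x + bop_apply T x" by transfer (simp add: plus_blinfun.rep_eq)
  show "bop_apply (r *\<^sub>R T) x = r *\<^sub>R bop_apply T x" by transfer (simp add: scaleR_blinfun.rep_eq)
  show "bop_apply 1 x = x" by transfer simp
  show "bop_apply (S * T) x = bop_apply S (bop_apply T x)" by transfer simp
  show "bop_apply (star T) x = cadjoint (bop_apply T) x"
    by transfer (simp add: bounded_linear_Blinfun_apply cadjoint_bounded_clinear blinfun.bounded_linear_right)
  have "bounded_linear (\<lambda>x. c *\<^sub>C blinfun_apply T x)" for T :: "'a \<Rightarrow>\<^sub>L 'a"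
    by (intro bounded_linear_scaleC_hilbert blinfun.bounded_linear_right)
  then show "bop_apply (c *\<^sub>C T) x = c *\<^sub>C bop_apply T x"
    by transfer (simp add: bounded_linear_Blinfun_apply)
qed

lemma bop_cinner_star: "cinner (bop_apply T x) y = cinner x (bop_apply (star T) y)"
  unfolding bop_apply_simps by (rule cinner_cadjoint[OF bop_bounded_linear bop_clinear])

lemma bop_cinner_star': "cinner (bop_apply (star T) x) y = cinner x (bop_apply T y)"
  by (metis bop_cinner_star cinner_commute)

lemma norm_bop_apply_le: "norm (bop_apply T x) \<le> norm T * norm x"
  by transfer (rule norm_blinfun)

lemma norm_bop_leI: "0 \<le> b \<Longrightarrow> (\<And>x. norm (bop_apply T x) \<le> b * norm x) \<Longrightarrow> norm T \<le> b"
  by transfer (rule norm_blinfun_bound)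

instance
proof
  fix S T R :: "'a bop" and c d :: complex and r :: real
  have add: "bop_apply S (x + y) = bop_apply S x + bop_apply S y"
    and scl: "bop_apply S (c *\<^sub>C x) = c *\<^sub>C bop_apply S x" for S :: "'a bop" and x y c
    using bop_clinear[of S] by (simp_all add: clinear_iff)
  show "c *\<^sub>C (S + T) = c *\<^sub>C S + c *\<^sub>C T"
    "(c + d) *\<^sub>C S = c *\<^sub>C S + d *\<^sub>C S" "c *\<^sub>C d *\<^sub>C S = (c * d) *\<^sub>C S" "1 *\<^sub>C S = S"
    "r *\<^sub>R S = complex_of_real r *\<^sub>C S"
    by (auto intro!: bop_eqI simp: bop_apply_simps scaleC_add_right scaleC_add_left scaleC_scaleC
        scaleC_one scaleR_eq_scaleC)
  show "S * T * R = S * (T * R)" "1 * S = S" "S * 1 = S" "(S + T) * R = S * R + T * R"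
    "S * (T + R) = S * T + S * R" "r *\<^sub>R S * T = r *\<^sub>R (S * T)" "S * r *\<^sub>R T = r *\<^sub>R (S * T)"
    "(c *\<^sub>C S) * T = c *\<^sub>C (S * T)" "S * (c *\<^sub>C T) = c *\<^sub>C (S * T)"
    by (auto intro!: bop_eqI simp: bop_apply_simps add scl scaleR_eq_scaleC)
  show mult: "norm (S * T) \<le> norm S * norm T" for S T :: "'a bop"
    by transfer (rule norm_blinfun_compose)
  show "norm (c *\<^sub>C S) = cmod c * norm S"
  proof (cases "c = 0")
    case True
    have "c *\<^sub>C S = 0" unfolding True
      by (rule bop_eqI, subst bop_apply_simps)
        (simp add: complex_vector.scale_zero_left bop_apply.rep_eq zero_bop.rep_eq)
    then show ?thesis using True by simp
  next
    case False
    have le: "norm (c *\<^sub>C S) \<le> cmod c * norm S" for c and S :: "'a bop"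
      by (rule norm_bop_leI)
        (simp_all add: bop_apply_simps norm_scaleC_hilbert mult.assoc mult_left_mono norm_bop_apply_le)
    have "S = inverse c *\<^sub>C c *\<^sub>C S"
      by (rule bop_eqI) (use False in \<open>simp add: bop_apply_simps scaleC_scaleC scaleC_one\<close>)
    then have "norm S \<le> cmod (inverse c) * norm (c *\<^sub>C S)" using le by metis
    then have "cmod c * norm S \<le> norm (c *\<^sub>C S)" using False
      by (simp only: norm_inverse) (simp add: field_simps)
    with le[of c S] show ?thesis by simp
  qed
  show ss: "star (star S) = S" for S :: "'a bop"
    by (intro bop_eqI cinner_extI) (simp add: bop_cinner_star' flip: bop_cinner_star)
  show "star (S + T) = star S + star T" "star (c *\<^sub>C S) = cnj c *\<^sub>C star S"
    "star (S * T) = star T * star S"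
    by (intro bop_eqI cinner_extI;
        simp add: bop_apply_simps(1,4,5) cinner_add_right cinner_add_left cinner_scaleC_left
          cinner_scaleC_right flip: bop_cinner_star)+
  have sq: "(norm S)\<^sup>2 \<le> norm (star S * S)" for S :: "'a bop"
  proof -
    have "norm (bop_apply S x) \<le> sqrt (norm (star S * S)) * norm x" for x
    proof -
      have "(norm (bop_apply S x))\<^sup>2 = inner (bop_apply S x) (bop_apply S x)"
        by (simp add: power2_norm_eq_inner)
      also have "\<dots> = inner x (bop_apply (star S * S) x)"
        unfolding inner_eq_Re_cinner bop_apply_simps(4) by (simp add: bop_cinner_star[of S x])
      also have "\<dots> \<le> norm x * norm (bop_apply (star S * S) x)" by (rule norm_cauchy_schwarz)
      also have "\<dots> \<le> norm x * (norm (star S * S) * norm x)"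
        by (intro mult_left_mono norm_bop_apply_le) simp
      also have "\<dots> = (sqrt (norm (star S * S)) * norm x)\<^sup>2"
        by (simp add: power_mult_distrib power2_eq_square mult_ac)
      finally show ?thesis by (rule power2_le_imp_le) simp
    qed
    then have "norm S \<le> sqrt (norm (star S * S))" by (intro norm_bop_leI) simp_all
    then show ?thesis by (metis norm_ge_zero power_mono real_sqrt_pow2)
  qed
  have star_le: "norm S \<le> norm (star S)" for S :: "'a bop"
  proof (cases "S = 0")
    case False
    have "norm S * norm S \<le> norm (star S) * norm S"
      using order_trans[OF sq mult] by (simp add: power2_eq_square)
    then show ?thesis using False by simp
  qed simp
  have "norm (star S) = norm S" using star_le[of S] star_le[of "star S"] ss by simp
  then have "norm (star S * S) \<le> (norm S)\<^sup>2" using mult[of "star S" S] by (simp add: power2_eq_square)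
  with sq[of S] show "norm (star S * S) = (norm S)\<^sup>2" by simp
qed

end

section \<open>Invariant unital completely positive maps\<close>

text \<open>Pointwise real vector space structure on functions, as needed for \<^const>\<open>extreme_point_of\<close>.\<close>

instantiation "fun" :: (type, real_vector) real_vector
begin
definition scaleR_fun :: "real \<Rightarrow> ('a \<Rightarrow> 'b) \<Rightarrow> 'a \<Rightarrow> 'b"
  where "scaleR_fun r f = (\<lambda>x. r *\<^sub>R f x)"
instance
  by standard (simp_all add: scaleR_fun_def fun_eq_iff algebra_simps)
end

text \<open>
  An \<open>n \<times> n\<close> matrix over a C*-algebra is a function of two indices, of which only the values at
  indices below \<open>n\<close> matter; it is positive in the C*-algebra of \<open>n \<times> n\<close> matrices if it is of the
  form \<open>b\<^sup>* b\<close>.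
\<close>

definition matrix_positive :: "nat \<Rightarrow> (nat \<Rightarrow> nat \<Rightarrow> 'a::cstar_algebra) \<Rightarrow> bool"
  where "matrix_positive n a \<longleftrightarrow>
    (\<exists>b. \<forall>i<n. \<forall>j<n. a i j = (\<Sum>k<n. star (b k i) * b k j))"

definition completely_positive :: "('a::cstar_algebra \<Rightarrow> 'b::cstar_algebra) \<Rightarrow> bool"
  where "completely_positive \<phi> \<longleftrightarrow>
    clinear \<phi> \<and>
    (\<forall>n a. matrix_positive n a \<longrightarrow> matrix_positive n (\<lambda>i j. \<phi> (a i j)))"

definition cstar_action :: "('g, 'm) monoid_scheme \<Rightarrow> ('g \<Rightarrow> 'a::cstar_algebra \<Rightarrow> 'a) \<Rightarrow> bool"
  where "cstar_action G \<tau> \<longleftrightarrow>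
    group_action G UNIV \<tau> \<and> (\<forall>g\<in>carrier G. unital_star_hom (\<tau> g))"

definition UCP ::
    "('g, 'm) monoid_scheme \<Rightarrow> ('g \<Rightarrow> 'a::cstar_algebra \<Rightarrow> 'a) \<Rightarrow> ('a \<Rightarrow> 'h::complex_hilbert bop) set"
  where "UCP G \<tau> =
    {\<phi>. completely_positive \<phi> \<and> \<phi> 1 = 1 \<and> (\<forall>g\<in>carrier G. \<forall>a. \<phi> (\<tau> g a) = \<phi> a)}"

definition cp_interval ::
    "('a::cstar_algebra \<Rightarrow> 'h::complex_hilbert bop) \<Rightarrow> ('a \<Rightarrow> 'h bop) set"
  where "cp_interval \<phi> = {\<theta>. completely_positive \<theta> \<and> completely_positive (\<phi> - \<theta>)}"

section \<open>The minimal Stinespring dilation\<close>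

definition minimal_stinespring ::
    "('a::cstar_algebra \<Rightarrow> 'h::complex_hilbert bop) \<Rightarrow> ('a \<Rightarrow> 'k::complex_hilbert bop) \<Rightarrow> ('h \<Rightarrow> 'k) \<Rightarrow> bool"
  where "minimal_stinespring \<phi> \<rho> V \<longleftrightarrow>
    unital_star_hom \<rho> \<and>
    clinear V \<and> (\<forall>h. norm (V h) = norm h) \<and>
    (\<forall>a h. bop_apply (\<phi> a) h = cadjoint V (bop_apply (\<rho> a) (V h))) \<and>
    closure (cspan {bop_apply (\<rho> a) (V h) | a h. True}) = UNIV"

definition unitary_rep :: "('g, 'm) monoid_scheme \<Rightarrow> ('g \<Rightarrow> 'k::complex_hilbert bop) \<Rightarrow> bool"
  where "unitary_rep G U \<longleftrightarrow>
    (\<forall>g\<in>carrier G. star (U g) * U g = 1 \<and> U g * star (U g) = 1) \<and>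
    (\<forall>g\<in>carrier G. \<forall>h\<in>carrier G. U (g \<otimes>\<^bsub>G\<^esub> h) = U g * U h)"

definition stinespring_unitary_rep ::
    "('g, 'm) monoid_scheme \<Rightarrow> ('g \<Rightarrow> 'a::cstar_algebra \<Rightarrow> 'a) \<Rightarrow>
     ('a \<Rightarrow> 'k::complex_hilbert bop) \<Rightarrow> ('h::complex_hilbert \<Rightarrow> 'k) \<Rightarrow> ('g \<Rightarrow> 'k bop) \<Rightarrow> bool"
  where "stinespring_unitary_rep G \<tau> \<rho> V U \<longleftrightarrow>
    unitary_rep G U \<and>
    (\<forall>g\<in>carrier G. \<forall>h. bop_apply (U g) (V h) = V h) \<and>
    (\<forall>g\<in>carrier G. \<forall>a. U g * \<rho> a * star (U g) = \<rho> (\<tau> g a))"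

definition bop_commutant :: "'k::complex_hilbert bop set \<Rightarrow> 'k bop set"
  where "bop_commutant \<S> = {T. \<forall>S\<in>\<S>. T * S = S * T}"

definition orth_proj :: "'k::complex_hilbert set \<Rightarrow> 'k \<Rightarrow> 'k"
  where "orth_proj K\<^sub>0 x = (THE y. y \<in> K\<^sub>0 \<and> (\<forall>z\<in>K\<^sub>0. cinner (x - y) z = 0))"

definition faithful_subspace :: "'k::complex_hilbert bop set \<Rightarrow> 'k set \<Rightarrow> bool"
  where "faithful_subspace M K\<^sub>0 \<longleftrightarrow>
    csubspace K\<^sub>0 \<and> closed K\<^sub>0 \<and>
    (\<forall>T\<in>M. (\<forall>x\<in>K\<^sub>0. orth_proj K\<^sub>0 (bop_apply T x) = 0) \<longrightarrow> T = 0)"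

section \<open>Hilbert C*-modules\<close>

text \<open>
  Modules have explicit carriers because the module of bounded module maps \<open>X \<rightarrow> B\<close> depends on
  \<open>X\<close>.  Maps out of a carrier are extensional, so that equality of such maps is equality on the
  carrier.
\<close>

record ('x, 'b) hmodule = "'x partial_object" +
  mzero :: 'x
  madd :: "'x \<Rightarrow> 'x \<Rightarrow> 'x"
  mscale :: "complex \<Rightarrow> 'x \<Rightarrow> 'x"
  mact :: "'x \<Rightarrow> 'b \<Rightarrow> 'x"
  mip :: "'x \<Rightarrow> 'x \<Rightarrow> 'b"

definition mnorm :: "('x, 'b::cstar_algebra) hmodule \<Rightarrow> 'x \<Rightarrow> real"
  where "mnorm X x = sqrt (norm (mip X x x))"

text \<open>The value outside the carrier is fixed because \<^locale>\<open>Metric_space\<close> wants a total symmetric function.\<close>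

definition mmetric :: "('x, 'b::cstar_algebra) hmodule \<Rightarrow> 'x \<Rightarrow> 'x \<Rightarrow> real"
  where "mmetric X x y =
    (if x \<in> carrier X \<and> y \<in> carrier X then mnorm X (madd X x (mscale X (- 1) y)) else 0)"

locale hilbert_module =
  fixes X :: "('x, 'b::cstar_algebra) hmodule"
  assumes zero_closed: "mzero X \<in> carrier X"
    and add_closed: "\<lbrakk>x \<in> carrier X; y \<in> carrier X\<rbrakk> \<Longrightarrow> madd X x y \<in> carrier X"
    and scale_closed: "x \<in> carrier X \<Longrightarrow> mscale X c x \<in> carrier X"
    and act_closed: "x \<in> carrier X \<Longrightarrow> mact X x b \<in> carrier X"
    and add_assoc: "\<lbrakk>x \<in> carrier X; y \<in> carrier X; z \<in> carrier X\<rbrakk> \<Longrightarrow>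
      madd X (madd X x y) z = madd X x (madd X y z)"
    and add_commute: "\<lbrakk>x \<in> carrier X; y \<in> carrier X\<rbrakk> \<Longrightarrow> madd X x y = madd X y x"
    and add_zero: "x \<in> carrier X \<Longrightarrow> madd X (mzero X) x = x"
    and add_neg: "x \<in> carrier X \<Longrightarrow> madd X x (mscale X (- 1) x) = mzero X"
    and scale_add_right: "\<lbrakk>x \<in> carrier X; y \<in> carrier X\<rbrakk> \<Longrightarrow>
      mscale X c (madd X x y) = madd X (mscale X c x) (mscale X c y)"
    and scale_add_left: "x \<in> carrier X \<Longrightarrow> mscale X (c + d) x = madd X (mscale X c x) (mscale X d x)"
    and scale_scale: "x \<in> carrier X \<Longrightarrow> mscale X c (mscale X d x) = mscale X (c * d) x"
    and scale_one: "x \<in> carrier X \<Longrightarrow> mscale X 1 x = x"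
    and act_add_left: "\<lbrakk>x \<in> carrier X; y \<in> carrier X\<rbrakk> \<Longrightarrow>
      mact X (madd X x y) b = madd X (mact X x b) (mact X y b)"
    and act_add_right: "x \<in> carrier X \<Longrightarrow> mact X x (a + b) = madd X (mact X x a) (mact X x b)"
    and act_mult: "x \<in> carrier X \<Longrightarrow> mact X x (a * b) = mact X (mact X x a) b"
    and act_one: "x \<in> carrier X \<Longrightarrow> mact X x 1 = x"
    and act_scale_left: "x \<in> carrier X \<Longrightarrow> mact X (mscale X c x) b = mscale X c (mact X x b)"
    and act_scale_right: "x \<in> carrier X \<Longrightarrow> mact X x (c *\<^sub>C b) = mscale X c (mact X x b)"
    and ip_add_left: "\<lbrakk>x \<in> carrier X; y \<in> carrier X; z \<in> carrier X\<rbrakk> \<Longrightarrow>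
      mip X (madd X x y) z = mip X x z + mip X y z"
    and ip_scale_left: "\<lbrakk>x \<in> carrier X; y \<in> carrier X\<rbrakk> \<Longrightarrow> mip X (mscale X c x) y = c *\<^sub>C mip X x y"
    and ip_act_left: "\<lbrakk>x \<in> carrier X; y \<in> carrier X\<rbrakk> \<Longrightarrow> mip X (mact X x b) y = mip X x y * b"
    and ip_star: "\<lbrakk>x \<in> carrier X; y \<in> carrier X\<rbrakk> \<Longrightarrow> mip X y x = star (mip X x y)"
    and ip_positive: "x \<in> carrier X \<Longrightarrow> cstar_positive (mip X x x)"
    and ip_definite: "\<lbrakk>x \<in> carrier X; mip X x x = 0\<rbrakk> \<Longrightarrow> x = mzero X"
    and complete: "Metric_space.mcomplete (carrier X) (mmetric X)"

inductive_set mspan :: "('x, 'b) hmodule \<Rightarrow> 'x set \<Rightarrow> 'x set"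
  for X :: "('x, 'b) hmodule" and S :: "'x set"
  where
    mspan_zero: "mzero X \<in> mspan X S"
  | mspan_base: "x \<in> S \<Longrightarrow> x \<in> mspan X S"
  | mspan_add: "\<lbrakk>x \<in> mspan X S; y \<in> mspan X S\<rbrakk> \<Longrightarrow> madd X x y \<in> mspan X S"
  | mspan_scale: "x \<in> mspan X S \<Longrightarrow> mscale X c x \<in> mspan X S"

definition is_madjoint :: "('x, 'b) hmodule \<Rightarrow> ('x \<Rightarrow> 'x) \<Rightarrow> ('x \<Rightarrow> 'x) \<Rightarrow> bool"
  where "is_madjoint X T S \<longleftrightarrow>
    S \<in> carrier X \<rightarrow>\<^sub>E carrier X \<and>
    (\<forall>x\<in>carrier X. \<forall>y\<in>carrier X. mip X (T x) y = mip X x (S y))"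

definition adjointable :: "('x, 'b) hmodule \<Rightarrow> ('x \<Rightarrow> 'x) set"
  where "adjointable X = {T \<in> carrier X \<rightarrow>\<^sub>E carrier X. \<exists>S. is_madjoint X T S}"

definition madjoint :: "('x, 'b) hmodule \<Rightarrow> ('x \<Rightarrow> 'x) \<Rightarrow> 'x \<Rightarrow> 'x"
  where "madjoint X T = (THE S. is_madjoint X T S)"

definition module_star_rep ::
    "('x, 'b::cstar_algebra) hmodule \<Rightarrow> ('a::cstar_algebra \<Rightarrow> 'x \<Rightarrow> 'x) \<Rightarrow> bool"
  where "module_star_rep X \<sigma> \<longleftrightarrow>
    (\<forall>a. \<sigma> a \<in> adjointable X) \<and>
    (\<forall>a b. \<forall>x\<in>carrier X. \<sigma> (a + b) x = madd X (\<sigma> a x) (\<sigma> b x)) \<and>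
    (\<forall>c a. \<forall>x\<in>carrier X. \<sigma> (c *\<^sub>C a) x = mscale X c (\<sigma> a x)) \<and>
    (\<forall>a b. \<forall>x\<in>carrier X. \<sigma> (a * b) x = \<sigma> a (\<sigma> b x)) \<and>
    (\<forall>a. \<sigma> (star a) = madjoint X (\<sigma> a))"

definition module_unitary_rep ::
    "('g, 'm) monoid_scheme \<Rightarrow> ('x, 'b::cstar_algebra) hmodule \<Rightarrow> ('g \<Rightarrow> 'x \<Rightarrow> 'x) \<Rightarrow> bool"
  where "module_unitary_rep G X W \<longleftrightarrow>
    (\<forall>g\<in>carrier G. W g \<in> adjointable X \<and>
      (\<forall>x\<in>carrier X. madjoint X (W g) (W g x) = x \<and> W g (madjoint X (W g) x) = x)) \<and>
    (\<forall>g\<in>carrier G. \<forall>h\<in>carrier G. \<forall>x\<in>carrier X. W (g \<otimes>\<^bsub>G\<^esub> h) x = W g (W h x))"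

definition mcommutant :: "('x, 'b) hmodule \<Rightarrow> ('x \<Rightarrow> 'x) set \<Rightarrow> ('x \<Rightarrow> 'x) set"
  where "mcommutant X \<S> = {T \<in> adjointable X. \<forall>S\<in>\<S>. \<forall>x\<in>carrier X. T (S x) = S (T x)}"

section \<open>The Paschke dilation and the dual module\<close>

definition paschke_dilation ::
    "('a::cstar_algebra \<Rightarrow> 'b::cstar_algebra) \<Rightarrow> ('x, 'b) hmodule \<Rightarrow> ('a \<Rightarrow> 'x \<Rightarrow> 'x) \<Rightarrow> 'x \<Rightarrow> bool"
  where "paschke_dilation \<phi> X \<sigma> e \<longleftrightarrow>
    hilbert_module X \<and> module_star_rep X \<sigma> \<and> e \<in> carrier X \<and>
    (\<forall>a. \<phi> a = mip X (\<sigma> a e) e) \<and>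
    Abstract_Topology.closure_of (Metric_space.mtopology (carrier X) (mmetric X))
      (mspan X {\<sigma> a (mact X e b) | a b. True}) = carrier X"

definition paschke_unitary_rep ::
    "('g, 'm) monoid_scheme \<Rightarrow> ('g \<Rightarrow> 'a::cstar_algebra \<Rightarrow> 'a) \<Rightarrow>
     ('x, 'b::cstar_algebra) hmodule \<Rightarrow> ('a \<Rightarrow> 'x \<Rightarrow> 'x) \<Rightarrow> 'x \<Rightarrow> ('g \<Rightarrow> 'x \<Rightarrow> 'x) \<Rightarrow> bool"
  where "paschke_unitary_rep G \<tau> X \<sigma> e W \<longleftrightarrow>
    module_unitary_rep G X W \<and>
    (\<forall>g\<in>carrier G. W g e = e) \<and>
    (\<forall>g\<in>carrier G. \<forall>a. \<forall>x\<in>carrier X. W g (\<sigma> a (madjoint X (W g) x)) = \<sigma> (\<tau> g a) x)"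

definition bounded_module_maps :: "('x, 'b::cstar_algebra) hmodule \<Rightarrow> ('x \<Rightarrow> 'b) set"
  where "bounded_module_maps X =
    {\<eta> \<in> extensional (carrier X).
      (\<forall>x\<in>carrier X. \<forall>y\<in>carrier X. \<eta> (madd X x y) = \<eta> x + \<eta> y) \<and>
      (\<forall>c. \<forall>x\<in>carrier X. \<eta> (mscale X c x) = c *\<^sub>C \<eta> x) \<and>
      (\<forall>b. \<forall>x\<in>carrier X. \<eta> (mact X x b) = \<eta> x * b) \<and>
      (\<exists>C. \<forall>x\<in>carrier X. norm (\<eta> x) \<le> C * mnorm X x)}"

definition hat :: "('x, 'b) hmodule \<Rightarrow> 'x \<Rightarrow> 'x \<Rightarrow> 'b"
  where "hat X x = (\<lambda>y\<in>carrier X. mip X y x)"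

text \<open>
  The dual module with a candidate inner product \<open>ip\<close>.  Scalars and module action are twisted by
  the involution, which makes \<^const>\<open>hat\<close> a module map.
\<close>

definition dual_module ::
    "('x, 'b::cstar_algebra) hmodule \<Rightarrow> (('x \<Rightarrow> 'b) \<Rightarrow> ('x \<Rightarrow> 'b) \<Rightarrow> 'b) \<Rightarrow> ('x \<Rightarrow> 'b, 'b) hmodule"
  where "dual_module X ip =
    \<lparr>carrier = bounded_module_maps X,
     mzero = (\<lambda>x\<in>carrier X. 0),
     madd = (\<lambda>\<eta> \<zeta>. \<lambda>x\<in>carrier X. \<eta> x + \<zeta> x),
     mscale = (\<lambda>c \<eta>. \<lambda>x\<in>carrier X. cnj c *\<^sub>C \<eta> x),
     mact = (\<lambda>\<eta> b. \<lambda>x\<in>carrier X. star b * \<eta> x),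
     mip = ip\<rparr>"

definition self_dual :: "('x, 'b::cstar_algebra) hmodule \<Rightarrow> bool"
  where "self_dual X \<longleftrightarrow> hilbert_module X \<and> bounded_module_maps X = hat X ` carrier X"

text \<open>
  The extension of the inner product of \<open>X\<close> to the dual module.  It is determined by these
  conditions, and it exists when the coefficient algebra is a von Neumann algebra.
\<close>

definition dual_inner_product ::
    "('x, 'b::cstar_algebra) hmodule \<Rightarrow> (('x \<Rightarrow> 'b) \<Rightarrow> ('x \<Rightarrow> 'b) \<Rightarrow> 'b) \<Rightarrow> bool"
  where "dual_inner_product X ip \<longleftrightarrow>
    self_dual (dual_module X ip) \<and>
    (\<forall>x\<in>carrier X. \<forall>y\<in>carrier X. ip (hat X x) (hat X y) = mip X x y) \<and>
    (\<forall>x\<in>carrier X. \<forall>\<eta>\<in>bounded_module_maps X. ip (hat X x) \<eta> = \<eta> x)"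

text \<open>\<open>T'\<close> is the (unique) extension of the adjointable operator \<open>T\<close> from \<open>X\<close> to the dual module.\<close>

definition dual_extension ::
    "('x, 'b::cstar_algebra) hmodule \<Rightarrow> (('x \<Rightarrow> 'b) \<Rightarrow> ('x \<Rightarrow> 'b) \<Rightarrow> 'b) \<Rightarrow>
     ('x \<Rightarrow> 'x) \<Rightarrow> (('x \<Rightarrow> 'b) \<Rightarrow> ('x \<Rightarrow> 'b)) \<Rightarrow> bool"
  where "dual_extension X ip T T' \<longleftrightarrow>
    T' \<in> adjointable (dual_module X ip) \<and> (\<forall>x\<in>carrier X. T' (hat X x) = hat X (T x))"

end

theory Submission
  imports Defs
begin

text \<open>
  By a Radon-Nikodym argument, the invariant completely positive maps below \<open>\<phi>\<close> are the maps
  \<open>a \<mapsto> V\<^sup>* \<rho>(a) T V\<close> with \<open>T\<close> in the commutant \<open>M\<close> of \<open>\<rho>(A) \<union> U(G)\<close>, and the value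
  at \<open>1\<close> is a multiple of the identity precisely if \<open>V\<^sup>* (T - t) V = 0\<close> for some scalar \<open>t\<close>.
  Hence a faithful \<open>[V H]\<close> forces \<open>T = t\<close>.  Conversely a self-adjoint contraction \<open>T \<in> M\<close> with
  \<open>V\<^sup>* T V = 0\<close> splits \<open>\<phi>\<close> into the two maps \<open>a \<mapsto> V\<^sup>* (1 \<plusminus> T) \<rho>(a) V\<close>, so that
  extremality forces \<open>T = 0\<close>.

  For the Paschke side, fix a unit vector \<open>h0\<close> of \<open>H\<close>.  The rank one operators
  \<open>h \<otimes> h0\<^sup>*\<close> embed \<open>K\<close> into \<open>X\<close>, and this identifies \<open>X'\<close> with the bounded operators from
  \<open>H\<close> to \<open>K\<close>, its inner product with \<open>\<langle>S, R\<rangle> = R\<^sup>* S\<close>, and the commutant in \<open>P(X')\<close> with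
  \<open>M\<close> acting by composition.  As \<open>V\<close> is the operator that corresponds to the vector \<open>e\<close>, the
  condition on \<open>\<langle>T e, e\<rangle>\<close> becomes faithfulness of \<open>[V H]\<close>.
\<close>

section \<open>Hilbert spaces and bounded operators\<close>

text \<open>The equivalences are run as a circle, (1) to (3) to (2) to (1), with (4) matched to (3)
  alone. The main cost sits in (1) to (3): a matrix is positive by definition when it factors as a
  product of \<open>star b\<close> and \<open>b\<close>, whereas the maps built from
  \<open>1 + s T\<close> come only with a nonnegative quadratic form. Passing from the form to a
  factorisation is a Cholesky decomposition with operator entries. It requires square roots, taken
  from the binomial series of sqrt(1 - x) at the boundary of its disc of convergence, and a division
  by a pivot that may fail to be invertible, done in the manner of Douglas' lemma. The opposite
  passage, from a completely positive map to its form, is immediate, so the Radon-Nikodym operator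
  arises from Cauchy-Schwarz and Riesz representation. Between (3) and (4) the obstacle is that an
  adjointable operator is merely a map possessing an adjoint; boundedness of the operator induced on
  \<open>K\<close> comes from Baire's theorem. For \<open>H = 0\<close> there is no unit vector, but
  then \<open>K = 0\<close> and both (3) and (4) hold.\<close>

lemma cinner_zero_left [simp]: "cinner 0 (y::'a::complex_hilbert) = 0"
  using cinner_add_left[of 0 0 y] by simp

lemma cinner_zero_right [simp]: "cinner (y::'a::complex_hilbert) 0 = 0"
  using cinner_add_right[of y 0 0] by simp

lemma scaleC_minus1 [simp]: "(- 1) *\<^sub>C (x::'a::complex_vector) = - x"
  using scaleR_eq_scaleC[of "- 1" x] by simp

lemma cinner_minus_left [simp]: "cinner (- x) (y::'a::complex_hilbert) = - cinner x y"
  using cinner_scaleC_left[of "- 1" x y] by simp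

lemma cinner_minus_right [simp]: "cinner x (- (y::'a::complex_hilbert)) = - cinner x y"
  using cinner_scaleC_right[of x "- 1" y] by simp

lemma cinner_diff_left: "cinner (x - y) (z::'a::complex_hilbert) = cinner x z - cinner y z"
  using cinner_add_left[of x "- y" z] by simp

lemma cinner_diff_right: "cinner x (y - (z::'a::complex_hilbert)) = cinner x y - cinner x z"
  using cinner_add_right[of x y "- z"] by simp

lemma cinner_scaleR_left: "cinner (r *\<^sub>R x) (y::'a::complex_hilbert) = r *\<^sub>R cinner x y"
  by (simp add: scaleR_eq_scaleC cinner_scaleC_left scaleR_conv_of_real)

lemma cinner_scaleR_right: "cinner x (r *\<^sub>R (y::'a::complex_hilbert)) = r *\<^sub>R cinner x y"
  by (simp add: scaleR_eq_scaleC cinner_scaleC_right scaleR_conv_of_real)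

lemma cinner_sum_left: "cinner (\<Sum>i\<in>I. f i) (y::'a::complex_hilbert) = (\<Sum>i\<in>I. cinner (f i) y)"
  by (induction I rule: infinite_finite_induct) (simp_all add: cinner_add_left)

lemma cinner_sum_right: "cinner (y::'a::complex_hilbert) (\<Sum>i\<in>I. f i) = (\<Sum>i\<in>I. cinner y (f i))"
  by (induction I rule: infinite_finite_induct) (simp_all add: cinner_add_right)

lemma cinner_sum_list_left:
  "cinner (\<Sum>p\<leftarrow>xs. f p) (y::'a::complex_hilbert) = (\<Sum>p\<leftarrow>xs. cinner (f p) y)"
  by (induction xs) (simp_all add: cinner_add_left)

lemma cinner_sum_list_right:
  "cinner (y::'a::complex_hilbert) (\<Sum>p\<leftarrow>xs. f p) = (\<Sum>p\<leftarrow>xs. cinner y (f p))"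
  by (induction xs) (simp_all add: cinner_add_right)

lemma cinner_self_eq_0: "cinner x x = 0 \<longleftrightarrow> (x::'a::complex_hilbert) = 0"
  by (simp add: cinner_self)

text \<open>The hypothesis is what remains of a semidefinite Hermitian form on the line
  \<open>u + z v\<close>. Stating it for the polynomial in \<open>z\<close> lets one argument serve
  vectors, positive operators, formal tensors and module elements.\<close>

lemma semidefinite_cauchy_schwarz:
  fixes c :: complex
  assumes "0 \<le> b" and pos: "\<And>z. 0 \<le> a + 2 * Re (z * c) + (cmod z)\<^sup>2 * b"
  shows "(cmod c)\<^sup>2 \<le> a * b"
proof -
  \<comment> \<open>Taking \<open>z\<close> along \<open>- cnj c\<close> makes the linear term real
    and negative; for positive \<open>b\<close> the best choice is then
    \<open>t = 1 / b\<close>.\<close>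
  have *: "0 \<le> a - 2 * t * (cmod c)\<^sup>2 + t\<^sup>2 * (cmod c)\<^sup>2 * b" for t :: real
  proof -
    have "Re (- (of_real t * cnj c) * c) = - t * (cmod c)\<^sup>2"
      by (simp add: cmod_power2) (simp add: power2_eq_square algebra_simps)
    then show ?thesis
      using pos[of "- (of_real t * cnj c)"] by (simp add: norm_mult power_mult_distrib)
  qed
  show ?thesis
  proof (cases "b = 0")
    case True
    have "c = 0"
    proof (rule ccontr)
      assume "c \<noteq> 0"
      then have "0 < (cmod c)\<^sup>2" by simp
      \<comment> \<open>This value of \<open>t\<close> makes the right-hand side equal to
        -1.\<close>
      moreover have "0 \<le> a - 2 * ((a + 1) / (2 * (cmod c)\<^sup>2)) * (cmod c)\<^sup>2"
        using *[of "(a + 1) / (2 * (cmod c)\<^sup>2)"] True by simp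
      ultimately show False by (simp add: field_simps)
    qed
    then show ?thesis using True by simp
  next
    case False
    then have "0 < b" using assms(1) by simp
    then have "0 \<le> a - (cmod c)\<^sup>2 / b"
      using *[of "1 / b"] by (simp add: power2_eq_square)
    then show ?thesis using \<open>0 < b\<close> by (simp add: field_simps)
  qed
qed

lemma cinner_cauchy_schwarz: "cmod (cinner x (y::'a::complex_hilbert)) \<le> norm x * norm y"
proof -
  have "(cmod (cinner y x))\<^sup>2 \<le> (norm x)\<^sup>2 * (norm y)\<^sup>2"
  proof (rule semidefinite_cauchy_schwarz)
    fix z
    have "complex_of_real ((norm (x + z *\<^sub>C y))\<^sup>2)
        = cinner x x + z * cinner y x + cnj (z * cinner y x) + z * cnj z * cinner y y"
      by (subst cinner_self[symmetric])
        (simp add: cinner_add_left cinner_add_right cinner_scaleC_left cinner_scaleC_right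
          cinner_commute[of x y] algebra_simps)
    then have "complex_of_real ((norm (x + z *\<^sub>C y))\<^sup>2) = of_real ((norm x)\<^sup>2)
        + (z * cinner y x + cnj (z * cinner y x)) + of_real ((cmod z)\<^sup>2) * of_real ((norm y)\<^sup>2)"
      by (simp only: cinner_self complex_norm_square add.assoc)
    then have "(norm (x + z *\<^sub>C y))\<^sup>2 = (norm x)\<^sup>2 + 2 * Re (z * cinner y x) + (cmod z)\<^sup>2 * (norm y)\<^sup>2"
      unfolding complex_add_cnj by (metis of_real_add of_real_mult of_real_eq_iff)
    then show "0 \<le> (norm x)\<^sup>2 + 2 * Re (z * cinner y x) + (cmod z)\<^sup>2 * (norm y)\<^sup>2"
      by (metis zero_le_power2)
  qed simp
  then have "(cmod (cinner y x))\<^sup>2 \<le> (norm x * norm y)\<^sup>2" by (simp add: power_mult_distrib)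
  then have "cmod (cinner y x) \<le> norm x * norm y" by (rule power2_le_imp_le) simp
  then show ?thesis by (metis cinner_commute complex_mod_cnj)
qed

lemma bounded_bilinear_cinner:
  "bounded_bilinear (cinner :: 'a::complex_hilbert \<Rightarrow> 'a \<Rightarrow> complex)"
  by unfold_locales
    (auto simp: cinner_add_left cinner_add_right cinner_scaleR_left cinner_scaleR_right
      intro!: exI[of _ 1] cinner_cauchy_schwarz)

lemmas tendsto_cinner [tendsto_intros] = bounded_bilinear.tendsto[OF bounded_bilinear_cinner]
lemmas continuous_on_cinner [continuous_intros] =
  bounded_bilinear.continuous_on[OF bounded_bilinear_cinner]

lemma continuous_on_scaleC_hilbert [continuous_intros]:
  "continuous_on A f \<Longrightarrow> continuous_on A (\<lambda>x. c *\<^sub>C (f x :: 'a::complex_hilbert))"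
  by (rule bounded_linear.continuous_on[OF bounded_linear_scaleC_hilbert[OF bounded_linear_ident]])

lemma bop_apply_add: "bop_apply T (x + y) = bop_apply T x + bop_apply T y"
  and bop_apply_scaleC: "bop_apply T (c *\<^sub>C x) = c *\<^sub>C bop_apply T x"
  using bop_clinear[of T] by (simp_all add: clinear_iff)

lemma bop_apply_vec_zero [simp]: "bop_apply T 0 = 0"
  using bop_apply_add[of T 0 0] by simp

lemma bop_apply_minus: "bop_apply T (- x) = - bop_apply T x"
  using bop_apply_scaleC[of T "- 1" x] by simp

lemma bop_apply_diff: "bop_apply T (x - y) = bop_apply T x - bop_apply T y"
  using bop_apply_add[of T x "- y"] by (simp add: bop_apply_minus)

lemma bop_apply_sum: "bop_apply T (\<Sum>i\<in>I. f i) = (\<Sum>i\<in>I. bop_apply T (f i))"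
  by (induction I rule: infinite_finite_induct) (simp_all add: bop_apply_add)

lemma bop_zero_apply [simp]: "bop_apply 0 x = 0"
  by (simp add: bop_apply.rep_eq zero_bop.rep_eq)

lemma bop_minus_apply [simp]: "bop_apply (- T) x = - bop_apply T x"
  by (simp add: bop_apply.rep_eq uminus_bop.rep_eq uminus_blinfun.rep_eq)

lemma bop_diff_apply: "bop_apply (S - T) x = bop_apply S x - bop_apply T x"
  by (simp add: bop_apply.rep_eq minus_bop.rep_eq minus_blinfun.rep_eq)

lemma bop_sum_apply: "bop_apply (\<Sum>i\<in>I. f i) x = (\<Sum>i\<in>I. bop_apply (f i) x)"
  by (induction I rule: infinite_finite_induct) (simp_all add: bop_apply_simps)

lemmas bop_simps = bop_apply_simps(1-5) bop_diff_apply

lemma bop_cinner_eqI: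
  "(\<And>x y. cinner (bop_apply S x) y = cinner (bop_apply T x) y) \<Longrightarrow> S = T"
  by (rule bop_eqI, rule cinner_extI) (metis cinner_commute)

lemma bop_ex:
  fixes f :: "'h::complex_hilbert \<Rightarrow> 'h"
  assumes "clinear f" and "\<And>x. norm (f x) \<le> C * norm x"
  shows "\<exists>T. bop_apply T = f"
proof
  have "bounded_linear f"
    using assms by (intro bounded_linear_intro[of _ C])
      (auto simp: clinear_iff scaleR_eq_scaleC mult.commute)
  then show "bop_apply (Bop (Blinfun f)) = f"
    using assms(1) by (simp add: bop_apply.rep_eq Bop_inverse bounded_linear_Blinfun_apply)
qed

lemma star_zero [simp]: "star 0 = (0::'a::cstar_algebra)"
  using star_add[of 0 "0::'a"] by simp

lemma star_minus: "star (- x) = - star (x::'a::cstar_algebra)"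
  using star_scaleC[of "- 1" x] by simp

lemma star_diff: "star (x - y) = star x - star (y::'a::cstar_algebra)"
  using star_add[of x "- y"] by (simp add: star_minus)

lemma star_one [simp]: "star 1 = (1::'a::cstar_algebra)"
  by (metis star_mult star_star mult_1_right)

lemma star_scaleR: "star (r *\<^sub>R x) = r *\<^sub>R star (x::'a::cstar_algebra)"
  by (simp add: scaleR_eq_scaleC star_scaleC)

lemma star_sum: "star (\<Sum>i\<in>I. f i) = (\<Sum>i\<in>I. star (f i :: 'a::cstar_algebra))"
  by (induction I rule: infinite_finite_induct) (simp_all add: star_add)

lemma closure_scaleC:
  fixes x :: "'a::complex_hilbert"
  assumes "x \<in> closure A" and "\<And>a. a \<in> A \<Longrightarrow> c *\<^sub>C a \<in> A"
  shows "c *\<^sub>C x \<in> closure A"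
proof -
  have "(\<lambda>x. c *\<^sub>C x) ` closure A \<subseteq> closure A"
    by (rule image_closure_subset) (use assms(2) closure_subset in \<open>auto intro!: continuous_intros\<close>)
  then show ?thesis using assms(1) by blast
qed

lemma dense_cinner_eqI:
  fixes x y :: "'k::complex_hilbert"
  assumes "closure (cspan S) = UNIV" and "\<And>s. s \<in> S \<Longrightarrow> cinner s x = cinner s y"
  shows "x = y"
proof (rule cinner_extI)
  fix z
  have "cspan S \<subseteq> {s. cinner s x = cinner s y}"
  proof
    fix s assume "s \<in> cspan S"
    then show "s \<in> {s. cinner s x = cinner s y}"
      by (induction rule: complex_vector.span_induct_alt)
        (simp_all add: cinner_add_left cinner_scaleC_left assms(2))
  qed
  then have "closure (cspan S) \<subseteq> {s. cinner s x = cinner s y}"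
    by (rule closure_minimal) (intro closed_Collect_eq continuous_intros)
  then show "cinner z x = cinner z y" using assms(1) by auto
qed

lemma dense_bop_eqI:
  fixes A B :: "'k::complex_hilbert bop"
  assumes "closure (cspan S) = UNIV"
    and "\<And>v w. v \<in> S \<Longrightarrow> w \<in> S \<Longrightarrow> cinner (bop_apply A v) w = cinner (bop_apply B v) w"
  shows "A = B"
proof (rule bop_cinner_eqI)
  fix x y :: 'k
  have "bop_apply (star A) w = bop_apply (star B) w" if "w \<in> S" for w
    by (rule dense_cinner_eqI[OF assms(1)]) (simp add: assms(2) that flip: bop_cinner_star)
  then have "cinner w (bop_apply A x) = cinner w (bop_apply B x)" if "w \<in> S" for w
    using that by (simp flip: bop_cinner_star')
  then have "bop_apply A x = bop_apply B x" by (rule dense_cinner_eqI[OF assms(1)])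
  then show "cinner (bop_apply A x) y = cinner (bop_apply B x) y" by simp
qed

lemma subspace_closure:
  fixes S :: "'a::real_normed_vector set"
  assumes "subspace S"
  shows "subspace (closure S)"
  unfolding subspace_def
proof (intro conjI ballI allI)
  show "0 \<in> closure S" using subspace_0[OF assms] closure_subset by blast
next
  fix x y assume "x \<in> closure S" "y \<in> closure S"
  then obtain f g where "\<And>n. f n \<in> S" "f \<longlonglongrightarrow> x" "\<And>n. g n \<in> S" "g \<longlonglongrightarrow> y"
    unfolding closure_sequential by metis
  then show "x + y \<in> closure S"
    unfolding closure_sequential
    by (intro exI[of _ "\<lambda>n. f n + g n"]) (auto intro: tendsto_add subspace_add[OF assms])
next
  fix c x assume "x \<in> closure S"
  then obtain f where "\<And>n. f n \<in> S" "f \<longlonglongrightarrow> x"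
    unfolding closure_sequential by metis
  then show "c *\<^sub>R x \<in> closure S"
    unfolding closure_sequential
    by (intro exI[of _ "\<lambda>n. c *\<^sub>R f n"]) (auto intro: tendsto_scaleR subspace_scale[OF assms])
qed

text \<open>
  A functional on a subspace is given by its graph, so that no well-definedness has to be
  checked when it is prescribed on linear combinations.  The representing vector comes from
  projecting \<open>(0, 1)\<close> onto the closure of the graph.
\<close>

lemma riesz_graph:
  fixes S :: "('k::complex_hilbert \<times> complex) set"
  assumes "0 \<le> C" and zero: "(0, 0) \<in> S"
    and add: "\<And>u s v t. (u, s) \<in> S \<Longrightarrow> (v, t) \<in> S \<Longrightarrow> (u + v, s + t) \<in> S"
    and scale: "\<And>c v t. (v, t) \<in> S \<Longrightarrow> (c *\<^sub>C v, c * t) \<in> S"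
    and bound: "\<And>v t. (v, t) \<in> S \<Longrightarrow> cmod t \<le> C * norm v"
  obtains w where "w \<in> closure (fst ` S)" and "norm w \<le> C"
    and "\<And>v t. (v, t) \<in> S \<Longrightarrow> cinner v w = t"
proof -
  have "subspace S"
    unfolding subspace_def
  proof (intro conjI ballI allI)
    show "0 \<in> S" using zero by (simp add: zero_prod_def)
    show "x + y \<in> S" if "x \<in> S" "y \<in> S" for x y
      using add[of "fst x" "snd x" "fst y" "snd y"] that by (simp add: plus_prod_def)
    show "c *\<^sub>R x \<in> S" if "x \<in> S" for c x
      using scale[of "fst x" "snd x" "complex_of_real c"] that
      by (simp add: scaleR_prod_def scaleR_eq_scaleC scaleR_conv_of_real)
  qed
  then have G: "subspace (closure S)" "closed (closure S)" by (simp_all add: subspace_closure)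
  have "closure S \<subseteq> {p. cmod (snd p) \<le> C * norm (fst p)}"
    by (rule closure_minimal) (use bound in \<open>auto intro!: closed_Collect_le continuous_intros\<close>)
  then have cbound: "cmod t \<le> C * norm v" if "(v, t) \<in> closure S" for v t using that by auto
  obtain y t0 where yt: "(y, t0) \<in> closure S"
    and o: "\<And>v t. (v, t) \<in> closure S \<Longrightarrow> inner ((0, 1) - (y, t0)) (v, t) = 0"
    using complete_closed_subspace_projection[OF G, of "(0, 1)"] by fastforce
  have o': "inner y v = Re ((1 - t0) * cnj t)" if "(v, t) \<in> closure S" for v t
    using o[OF that] by (simp add: inner_complex_def inner_diff_left algebra_simps)
  \<comment> \<open>Otherwise \<open>y = 0\<close>, so that \<open>(0, 1)\<close> itself would be a
    limit of the graph, against the bound.\<close>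
  have t0: "t0 \<noteq> 1"
  proof
    assume 1: "t0 = 1"
    then have "inner y y = 0" using o'[OF yt] by simp
    then show False using cbound[OF yt] 1 by simp
  qed
  have cl: "cinner v y = cnj (1 - t0) * t" if vt: "(v, t) \<in> S" for v t
  proof -
    have 1: "inner y v = Re ((1 - t0) * cnj t)" using vt closure_subset by (intro o') blast
    have 2: "inner y (\<i> *\<^sub>C v) = Re ((1 - t0) * cnj (\<i> * t))"
      using scale[OF vt, of \<i>] closure_subset by (intro o') blast
    have "cinner y v = (1 - t0) * cnj t"
      unfolding cinner_eq_inner 1 2 by (simp add: complex_eq_iff)
    then show ?thesis by (subst cinner_commute) simp
  qed
  define w where "w = inverse (1 - t0) *\<^sub>C y"
  have w: "cinner v w = t" if "(v, t) \<in> S" for v t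
    using cl[OF that] t0 by (simp add: w_def cinner_scaleC_right field_simps)
  have "fst ` closure S \<subseteq> closure (fst ` S)"
    by (rule image_closure_subset) (auto intro!: continuous_intros closure_subset[THEN subsetD])
  then have "y \<in> closure (fst ` S)" using yt by force
  then have w_cl: "w \<in> closure (fst ` S)"
    unfolding w_def by (rule closure_scaleC) (use scale in \<open>force simp: image_iff\<close>)
  \<comment> \<open>The bound passes to the closure of the domain, which contains \<open>w\<close>,
    and may therefore be tested at \<open>w\<close> itself.\<close>
  have "closure (fst ` S) \<subseteq> {v. cmod (cinner v w) \<le> C * norm v}"
    by (rule closure_minimal)
      (use w bound in \<open>auto intro!: closed_Collect_le continuous_intros\<close>)
  then have "cmod (cinner w w) \<le> C * norm w" using w_cl by blast
  then have "norm w * norm w \<le> C * norm w" by (simp add: cinner_self power2_eq_square norm_mult)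
  then have "norm w \<le> C"
  proof (cases "w = 0")
    case True
    then show ?thesis using assms(1) by simp
  qed simp
  from that[OF w_cl this w] show thesis .
qed
text \<open>The index type only has to carry formal operations that \<open>v\<close> and
  \<open>t\<close> respect. Lists of elementary tensors under concatenation qualify, although
  different lists can name the same vector; the bound is what makes the functional
  consistent.\<close>

lemma riesz_family:
  fixes v :: "'i \<Rightarrow> 'k::complex_hilbert" and t :: "'i \<Rightarrow> complex"
    and z :: 'i and add :: "'i \<Rightarrow> 'i \<Rightarrow> 'i" and scale :: "complex \<Rightarrow> 'i \<Rightarrow> 'i"
  assumes "0 \<le> C"
    and zero: "v z = 0" "t z = 0"
    and add: "\<And>i j. v (add i j) = v i + v j" "\<And>i j. t (add i j) = t i + t j"
    and scale: "\<And>c i. v (scale c i) = c *\<^sub>C v i" "\<And>c i. t (scale c i) = c * t i"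
    and bound: "\<And>i. cmod (t i) \<le> C * norm (v i)"
  shows "\<exists>w. w \<in> closure (range v) \<and> norm w \<le> C \<and> (\<forall>i. cinner (v i) w = t i)"
proof -
  let ?S = "range (\<lambda>i. (v i, t i))"
  obtain w where w: "w \<in> closure (fst ` ?S)" "norm w \<le> C" "\<And>x y. (x, y) \<in> ?S \<Longrightarrow> cinner x w = y"
  proof (rule riesz_graph[OF assms(1)])
    show "(0, 0) \<in> ?S" by (rule range_eqI[of _ _ z]) (simp add: zero)
    show "(u + x, s + y) \<in> ?S" if us: "(u, s) \<in> ?S" and xy: "(x, y) \<in> ?S" for u s x y
    proof -
      obtain i j where "u = v i" "s = t i" "x = v j" "y = t j" using us xy by auto
      then show ?thesis by (intro range_eqI[of _ _ "add i j"]) (simp add: add)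
    qed
    show "(c *\<^sub>C x, c * y) \<in> ?S" if xy: "(x, y) \<in> ?S" for c x y
    proof -
      obtain i where "x = v i" "y = t i" using xy by auto
      then show ?thesis by (intro range_eqI[of _ _ "scale c i"]) (simp add: scale)
    qed
    show "cmod y \<le> C * norm x" if "(x, y) \<in> ?S" for x y
      using that bound by auto
  qed (rule that; assumption)
  have "fst ` ?S = range v" by (simp add: image_image)
  moreover have "cinner (v i) w = t i" for i by (rule w(3)) (rule rangeI)
  ultimately show ?thesis using w(1,2) by metis
qed

section \<open>Positive operators and positive operator matrices\<close>

lemma norm_star: "norm (star x) = norm (x::'a::cstar_algebra)"
proof -
  have *: "norm y \<le> norm (star y)" for y :: 'a
  proof (cases "y = 0")
    case False
    have "norm y * norm y \<le> norm (star y) * norm y"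
      using norm_mult_ineq[of "star y" y] by (simp add: norm_star_mult_self power2_eq_square)
    then show ?thesis using False by simp
  qed simp
  from *[of x] *[of "star x"] show ?thesis by (simp add: star_star)
qed

section \<open>Square roots of positive operators\<close>

lemma bounded_linear_star: "bounded_linear (star :: 'a::cstar_algebra \<Rightarrow> 'a)"
  by (rule bounded_linear_intro[of _ 1]) (simp_all add: star_add star_scaleR norm_star)

text \<open>The Taylor coefficients of sqrt(1 - x) at 0.\<close>

definition sqrt_coeff :: "nat \<Rightarrow> real"
  where "sqrt_coeff k = (1/2 gchoose k) * (- 1) ^ k"

lemma gbinomial_alternating_Suc:
  "real (Suc k) * ((a gchoose Suc k) * (- 1) ^ Suc k) = (real k - a) * ((a gchoose k) * (- 1) ^ k)"
proof -
  have *: "real (Suc k) * (a gchoose Suc k) = (a - real k) * (a gchoose k)"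
    using gbinomial_mult_1[of a k] by (simp add: algebra_simps)
  have "real (Suc k) * ((a gchoose Suc k) * (- 1) ^ Suc k)
      = (real (Suc k) * (a gchoose Suc k)) * (- 1) ^ Suc k" by (simp only: mult.assoc)
  also have "\<dots> = (real k - a) * ((a gchoose k) * (- 1) ^ k)"
    unfolding * by (simp add: algebra_simps)
  finally show ?thesis .
qed

lemma sqrt_coeff_nonpos: "sqrt_coeff (Suc k) \<le> 0"
proof (induction k)
  case 0
  show ?case by (simp add: sqrt_coeff_def)
next
  case (Suc k)
  have "real (Suc (Suc k)) * sqrt_coeff (Suc (Suc k)) \<le> 0"
    unfolding sqrt_coeff_def gbinomial_alternating_Suc
    by (rule mult_nonneg_nonpos[OF _ Suc[unfolded sqrt_coeff_def]]) simp
  then show ?case by (simp add: mult_le_0_iff)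
qed

text \<open>Alternating partial sums of the binomials of 1/2 collapse to a single signed binomial of
  -1/2, and the ratio recursion preserves its sign.\<close>

lemma sum_sqrt_coeff_nonneg: "0 \<le> (\<Sum>k\<le>m. sqrt_coeff k)"
proof -
  have "0 \<le> (- (1/2) gchoose m :: real) * (- 1) ^ m"
  proof (induction m)
    case (Suc m)
    have "0 \<le> real (Suc m) * ((- (1/2) gchoose Suc m :: real) * (- 1) ^ Suc m)"
      unfolding gbinomial_alternating_Suc by (rule mult_nonneg_nonneg[OF _ Suc]) simp
    then show ?case unfolding zero_le_mult_iff by auto
  qed simp
  then show ?thesis
    unfolding sqrt_coeff_def gbinomial_sum_lower_neg by (simp add: mult.commute)
qed

text \<open>All coefficients after the first are nonpositive, so the absolute partial sums equal 2
  minus the signed ones. Absolute summability at radius 1 is what later admits operators of norm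
  exactly 1.\<close>

lemma summable_abs_sqrt_coeff: "summable (\<lambda>k. \<bar>sqrt_coeff k\<bar>)"
proof (rule summableI_nonneg_bounded[of _ 2])
  fix n
  have *: "(\<Sum>k\<le>m. \<bar>sqrt_coeff k\<bar>) = 2 - (\<Sum>k\<le>m. sqrt_coeff k)" for m
    by (induction m) (simp_all add: abs_of_nonpos sqrt_coeff_nonpos, simp add: sqrt_coeff_def)
  have "(\<Sum>k<n. \<bar>sqrt_coeff k\<bar>) \<le> (\<Sum>k\<le>n. \<bar>sqrt_coeff k\<bar>)"
    by (intro sum_mono2) auto
  also have "\<dots> \<le> 2" using *[of n] sum_sqrt_coeff_nonneg[of n] by simp
  finally show "(\<Sum>k<n. \<bar>sqrt_coeff k\<bar>) \<le> 2" .
qed simp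

lemma norm_one_bop_le: "norm (1 :: 'h::complex_hilbert bop) \<le> 1"
  by (rule norm_bop_leI) (simp_all add: bop_apply_simps)

text \<open>\<open>S\<close> is the binomial series evaluated at \<open>X\<close>. By Vandermonde's
  identity its Cauchy square has the coefficients of the first power of 1 - x.\<close>

lemma sqrt_one_minus:
  fixes X :: "'h::complex_hilbert bop"
  assumes "star X = X" "norm X \<le> 1"
  obtains S where "star S = S" "S * S = 1 - X"
proof -
  have pow: "norm (X ^ k) \<le> 1" for k
  proof (induction k)
    case (Suc k)
    have "norm (X * X ^ k) \<le> norm X * norm (X ^ k)" by (rule norm_mult_ineq)
    also have "\<dots> \<le> 1" using Suc assms(2) by (intro mult_le_one) auto
    finally show ?case by simp
  qed (simp add: norm_one_bop_le)
  define f where "f k = sqrt_coeff k *\<^sub>R X ^ k" for k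
  have "norm (f k) \<le> \<bar>sqrt_coeff k\<bar>" for k
    using mult_left_mono[OF pow[of k], of "\<bar>sqrt_coeff k\<bar>"] by (simp add: f_def)
  then have sum: "summable (\<lambda>k. norm (f k))"
    by (intro summable_comparison_test'[OF summable_abs_sqrt_coeff, of 0]) simp
  define S where "S = suminf f"
  have "star (X ^ k) = X ^ k" for k
    by (induction k) (simp_all add: star_mult assms(1) power_commutes)
  then have "star (f k) = f k" for k by (simp add: f_def star_scaleR)
  then have "star S = S"
    unfolding S_def bounded_linear.suminf[OF bounded_linear_star summable_norm_cancel[OF sum]]
    by simp
  moreover have "S * S = 1 - X"
  proof -
    have conv: "(\<Sum>i\<le>k. f i * f (k - i)) = ((1 gchoose k) * (- 1) ^ k) *\<^sub>R X ^ k" for k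
    proof -
      have "f i * f (k - i) = (((1/2 gchoose i) * (1/2 gchoose (k - i))) * (- 1) ^ k) *\<^sub>R X ^ k"
        if "i \<le> k" for i
      proof -
        have "X ^ i * X ^ (k - i) = X ^ k" "(- 1 :: real) ^ i * (- 1) ^ (k - i) = (- 1) ^ k"
          using that by (simp_all flip: power_add)
        then show ?thesis by (simp add: f_def sqrt_coeff_def mult_ac)
      qed
      then have "(\<Sum>i\<le>k. f i * f (k - i))
          = ((\<Sum>i\<le>k. (1/2 gchoose i) * (1/2 gchoose (k - i))) * (- 1) ^ k) *\<^sub>R X ^ k"
        by (simp add: scaleR_sum_left sum_distrib_right)
      then show ?thesis
        using gbinomial_Vandermonde[of "1/2 :: real" "1/2" k] by (simp add: atMost_atLeast0)
    qed
    have "S * S = (\<Sum>k. \<Sum>i\<le>k. f i * f (k - i))"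
      unfolding S_def by (rule Cauchy_product[OF sum sum])
    also have "\<dots> = (\<Sum>k\<in>{0, 1}. ((1 gchoose k) * (- 1) ^ k) *\<^sub>R X ^ k)"
      unfolding conv
    proof (rule suminf_finite)
      fix k :: nat assume "k \<notin> {0, 1}"
      then have "(1::nat) < k" by auto
      then have "1 choose k = 0" by (rule binomial_eq_0)
      then have "(1::real) gchoose k = 0" by (metis binomial_gbinomial of_nat_0 of_nat_1)
      then show "((1 gchoose k) * (- 1) ^ k) *\<^sub>R X ^ k = 0" by simp
    qed simp
    also have "\<dots> = 1 - X" by simp
    finally show ?thesis .
  qed
  ultimately show thesis using that by blast
qed

lemma cinner_selfadjoint: "star X = X \<Longrightarrow> cinner (bop_apply X x) y = cinner x (bop_apply X y)"
  using bop_cinner_star[of X x y] by simp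

lemma cinner_selfadjoint_cnj: "star X = X \<Longrightarrow> cinner (bop_apply X x) y = cnj (cinner (bop_apply X y) x)"
  by (metis cinner_selfadjoint cinner_commute)

text \<open>Brings the expansion of a sesquilinear form along \<open>u + z v\<close> into the shape
  expected by \<open>semidefinite_cauchy_schwarz\<close>.\<close>

lemma Re_quadratic:
  "Re (p + (w + cnj w) + z * cnj z * q) = Re p + 2 * Re w + (cmod z)\<^sup>2 * Re q"
  by (simp only: complex_add_cnj complex_norm_square[symmetric] plus_complex.sel Re_complex_of_real)
    simp

lemma positive_bop_cauchy_schwarz:
  assumes X: "star X = X" and pos: "\<And>x. 0 \<le> Re (cinner (bop_apply X x) x)"
  shows "(cmod (cinner (bop_apply X x) y))\<^sup>2
    \<le> Re (cinner (bop_apply X x) x) * Re (cinner (bop_apply X y) y)"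
proof (subst mult.commute, rule semidefinite_cauchy_schwarz[OF pos])
  fix z
  have "cinner (bop_apply X (y + z *\<^sub>C x)) (y + z *\<^sub>C x)
      = cinner (bop_apply X y) y + (z * cinner (bop_apply X x) y + cnj (z * cinner (bop_apply X x) y))
        + z * cnj z * cinner (bop_apply X x) x"
    using cinner_selfadjoint_cnj[OF X, of y x]
    by (simp add: bop_apply_add bop_apply_scaleC cinner_add_left cinner_add_right
        cinner_scaleC_left cinner_scaleC_right algebra_simps)
  then have "Re (cinner (bop_apply X (y + z *\<^sub>C x)) (y + z *\<^sub>C x))
      = Re (cinner (bop_apply X y) y) + 2 * Re (z * cinner (bop_apply X x) y)
        + (cmod z)\<^sup>2 * Re (cinner (bop_apply X x) x)"
    by (simp only: Re_quadratic)
  then show "0 \<le> Re (cinner (bop_apply X y) y) + 2 * Re (z * cinner (bop_apply X x) y)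
        + (cmod z)\<^sup>2 * Re (cinner (bop_apply X x) x)"
    using pos by metis
qed

lemma positive_bop_sqrt:
  assumes M: "star M = M" and pos: "\<And>x. 0 \<le> Re (cinner (bop_apply M x) x)"
  obtains S where "star S = S" "S * S = M"
proof -
  \<comment> \<open>Any bound for the form of \<open>M\<close> would do; the added 1 keeps
    \<open>r\<close> positive when \<open>M = 0\<close>. With it the form of \<open>X\<close> lies
    between 0 and that of the identity.\<close>
  define r where "r = norm M + 1"
  have r: "0 < r" unfolding r_def using norm_ge_zero[of M] by linarith
  define X where "X = 1 - (1 / r) *\<^sub>R M"
  have X: "star X = X" by (simp add: X_def star_diff star_scaleR M)
  have form: "Re (cinner (bop_apply X x) x) = (norm x)\<^sup>2 - Re (cinner (bop_apply M x) x) / r" for x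
    by (simp add: X_def bop_simps cinner_diff_left cinner_scaleR_left cinner_self)
  have le: "Re (cinner (bop_apply M x) x) \<le> r * (norm x)\<^sup>2" for x
  proof -
    have "Re (cinner (bop_apply M x) x) \<le> norm (bop_apply M x) * norm x"
      using cinner_cauchy_schwarz complex_Re_le_cmod order_trans by blast
    also have "\<dots> \<le> (norm M * norm x) * norm x"
      by (intro mult_right_mono norm_bop_apply_le) simp
    also have "\<dots> \<le> r * (norm x)\<^sup>2" by (simp add: r_def power2_eq_square algebra_simps)
    finally show ?thesis .
  qed
  have X0: "0 \<le> Re (cinner (bop_apply X x) x)" for x
    using le[of x] r by (simp add: form field_simps)
  have X1: "Re (cinner (bop_apply X x) x) \<le> (norm x)\<^sup>2" for x
    using pos[of x] r by (simp add: form)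
  \<comment> \<open>Cauchy-Schwarz for the form of \<open>X\<close>, applied to \<open>x\<close> and
    \<open>X x\<close>, turns the bound on the quadratic form into a bound on the norm.\<close>
  have "norm X \<le> 1"
  proof (rule norm_bop_leI)
    fix x
    let ?y = "bop_apply X x"
    have "(cmod (cinner ?y ?y))\<^sup>2 \<le> (norm x)\<^sup>2 * (norm ?y)\<^sup>2"
      using positive_bop_cauchy_schwarz[OF X X0, of x ?y] mult_mono[OF X1[of x] X1[of ?y]] X0
      by (meson order_trans zero_le_power2)
    then have "((norm ?y)\<^sup>2)\<^sup>2 \<le> (norm x)\<^sup>2 * (norm ?y)\<^sup>2"
      by (simp add: cinner_self norm_power)
    then have "(norm ?y)\<^sup>2 * (norm ?y)\<^sup>2 \<le> (norm x)\<^sup>2 * (norm ?y)\<^sup>2"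
      by (simp only: power2_eq_square[of "(norm ?y)\<^sup>2"])
    then have "norm ?y \<le> norm x"
    proof (cases "?y = 0")
      case False
      then have "0 < (norm ?y)\<^sup>2" by simp
      with \<open>(norm ?y)\<^sup>2 * (norm ?y)\<^sup>2 \<le> _\<close> have "(norm ?y)\<^sup>2 \<le> (norm x)\<^sup>2"
        by (rule mult_right_le_imp_le)
      then show ?thesis by (rule power2_le_imp_le) simp
    qed simp
    then show "norm ?y \<le> 1 * norm x" by simp
  qed simp
  then obtain S where S: "star S = S" "S * S = 1 - X" using sqrt_one_minus[OF X] by blast
  have "star (sqrt r *\<^sub>R S) = sqrt r *\<^sub>R S" using S by (simp add: star_scaleR)
  moreover have "(sqrt r *\<^sub>R S) * (sqrt r *\<^sub>R S) = M"
    using r by (simp add: S X_def)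
  ultimately show thesis by (rule that)
qed

section \<open>Factorisation of positive operator matrices\<close>

lemma closure_range_kernel:
  assumes "star S = S" "u \<in> closure (range (bop_apply S))" "bop_apply S u = 0"
  shows "u = 0"
proof -
  have "closure (range (bop_apply S)) \<subseteq> {v. cinner v u = 0}"
    by (rule closure_minimal)
      (use assms in \<open>auto simp: cinner_selfadjoint intro!: closed_Collect_eq continuous_intros\<close>)
  then show ?thesis using assms(2) cinner_self_eq_0 by blast
qed

lemma subspace_range_bop: "subspace (range (bop_apply S))"
  by (intro linear_subspace_image subspace_UNIV bounded_linear.linear bop_bounded_linear)

text \<open>A form of Douglas' lemma. By the bound, pairing \<open>g\<close> with \<open>M h\<close>
  depends boundedly on \<open>S g\<close>, and the Riesz vector of this functional is
  \<open>c h\<close>. Keeping it in the closed range of \<open>S\<close>, where \<open>S\<close> is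
  injective, makes it unique; uniqueness in turn yields linearity.\<close>

lemma douglas_factor:
  assumes S: "star S = S"
    and "0 \<le> C" and bound: "\<And>g h. cmod (cinner (bop_apply M h) g) \<le> C * norm h * norm (bop_apply S g)"
  obtains c where "S * c = M" "\<And>h. bop_apply c h \<in> closure (range (bop_apply S))"
proof -
  have "\<exists>w. w \<in> closure (range (bop_apply S)) \<and> norm w \<le> C * norm h \<and> bop_apply S w = bop_apply M h" for h
  proof -
    have "\<exists>w. w \<in> closure (range (bop_apply S)) \<and> norm w \<le> C * norm h
        \<and> (\<forall>g. cinner (bop_apply S g) w = cinner g (bop_apply M h))"
    proof (rule riesz_family[where z = 0 and add = "(+)" and scale = scaleC])
      show "cmod (cinner g (bop_apply M h)) \<le> C * norm h * norm (bop_apply S g)" for g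
        using bound[of h g] by (metis cinner_commute complex_mod_cnj)
    qed (simp_all add: assms(2) bop_apply_add bop_apply_scaleC cinner_add_left cinner_scaleC_left)
    then obtain w where w: "w \<in> closure (range (bop_apply S))" "norm w \<le> C * norm h"
      "\<And>g. cinner (bop_apply S g) w = cinner g (bop_apply M h)" by blast
    have "bop_apply S w = bop_apply M h"
      by (rule cinner_extI) (simp flip: w(3) cinner_selfadjoint[OF S])
    then show ?thesis using w by blast
  qed
  then obtain f where f: "\<And>h. f h \<in> closure (range (bop_apply S))" "\<And>h. norm (f h) \<le> C * norm h"
    "\<And>h. bop_apply S (f h) = bop_apply M h" by metis
  note cl = subspace_closure[OF subspace_range_bop[of S]]
  have uniq: "u = v" if "u \<in> closure (range (bop_apply S))" "v \<in> closure (range (bop_apply S))"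
    "bop_apply S u = bop_apply S v" for u v
    using closure_range_kernel[OF S, of "u - v"] subspace_diff[OF cl that(1,2)] that(3)
    by (simp add: bop_apply_diff)
  have "clinear f"
    unfolding clinear_iff
  proof (intro conjI allI)
    show "f (x + y) = f x + f y" for x y
      by (rule uniq) (simp_all add: f bop_apply_add subspace_add[OF cl])
    fix c x
    have "c *\<^sub>C f x \<in> closure (range (bop_apply S))"
      by (rule closure_scaleC[OF f(1)]) (auto simp flip: bop_apply_scaleC)
    then show "f (c *\<^sub>C x) = c *\<^sub>C f x"
      by (rule uniq[OF f(1)]) (simp add: f bop_apply_scaleC)
  qed
  then obtain c where c: "bop_apply c = f" using bop_ex f(2) by blast
  have "S * c = M" by (rule bop_eqI) (simp add: bop_simps c f)
  then show thesis using that[of c] c f by simp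
qed

lemma sum_sum_support:
  assumes "finite I" "J \<subseteq> I" "\<And>i. i \<in> I - J \<Longrightarrow> h i = (0::'h::complex_hilbert)"
  shows "(\<Sum>i\<in>I. \<Sum>j\<in>I. cinner (bop_apply (M i j) (h j)) (h i))
       = (\<Sum>i\<in>J. \<Sum>j\<in>J. cinner (bop_apply (M i j) (h j)) (h i))"
proof -
  have "(\<Sum>j\<in>I. cinner (bop_apply (M i j) (h j)) (h i)) = (\<Sum>j\<in>J. cinner (bop_apply (M i j) (h j)) (h i))" for i
    by (rule sum.mono_neutral_right) (use assms in auto)
  then show ?thesis
    by (simp only:) (rule sum.mono_neutral_right, use assms in auto)
qed

text \<open>
  The matrix is factorised as in the Cholesky decomposition, the last index being the pivot.  The
  Schur complement is again positive because the last variable can be chosen to make the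
  completed square arbitrarily small.
\<close>

lemma matrix_positive_bopI:
  fixes M :: "nat \<Rightarrow> nat \<Rightarrow> 'h::complex_hilbert bop"
  assumes "\<And>i j. i < n \<Longrightarrow> j < n \<Longrightarrow> star (M i j) = M j i"
    and "\<And>h. 0 \<le> Re (\<Sum>i<n. \<Sum>j<n. cinner (bop_apply (M i j) (h j)) (h i))"
  shows "matrix_positive n M"
  using assms
proof (induction n arbitrary: M)
  case 0
  then show ?case by (simp add: matrix_positive_def)
next
  case (Suc n)
  note herm = Suc.prems(1) and pos = Suc.prems(2)
  define a where "a = M n n"
  have a_sa: "star a = a" unfolding a_def by (rule herm) simp_all
  have a_pos: "0 \<le> Re (cinner (bop_apply a x) x)" for x
    using pos[of "\<lambda>i. if i = n then x else 0"]
    by (subst (asm) sum_sum_support[of _ "{n}"]) (auto simp: a_def)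
  obtain S where S: "star S = S" "S * S = a" by (rule positive_bop_sqrt[OF a_sa a_pos])
  have aS: "cinner (bop_apply a g) g' = cinner (bop_apply S g) (bop_apply S g')" for g g'
    unfolding S(2)[symmetric] by (simp add: bop_simps cinner_selfadjoint[OF S(1)])
  \<comment> \<open>Positivity of the 2 by 2 block with indices \<open>j\<close> and
    \<open>n\<close> bounds the off-diagonal entry by the two diagonal ones. This is the hypothesis
    of \<open>douglas_factor\<close>, and the constant is the root of the norm of
    \<open>M j j\<close>.\<close>
  have "\<exists>c. S * c = M n j \<and> (\<forall>h. bop_apply c h \<in> closure (range (bop_apply S)))" if j: "j < n" for j
  proof -
    define C where "C = sqrt (norm (M j j))"
    have "cmod (cinner (bop_apply (M n j) h) g) \<le> C * norm h * norm (bop_apply S g)" for g h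
    proof -
      let ?b = "Re (cinner (bop_apply (M j j) h) h)"
      have herm': "cinner (bop_apply (M j n) g) h = cnj (cinner (bop_apply (M n j) h) g)"
        using herm[of n j] j bop_cinner_star[of "M n j" h g] cinner_commute[of _ h] by simp
      have "(cmod (cinner (bop_apply (M n j) h) g))\<^sup>2 \<le> (norm (bop_apply S g))\<^sup>2 * ?b"
      proof (rule semidefinite_cauchy_schwarz)
        show "0 \<le> ?b"
          using pos[of "\<lambda>i. if i = j then h else 0"] j
          by (subst (asm) sum_sum_support[of _ "{j}"]) auto
        fix z
        show "0 \<le> (norm (bop_apply S g))\<^sup>2 + 2 * Re (z * cinner (bop_apply (M n j) h) g) + (cmod z)\<^sup>2 * ?b"
        proof -
          let ?h = "\<lambda>i. if i = n then g else if i = j then z *\<^sub>C h else 0"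
          have "(\<Sum>i<Suc n. \<Sum>k<Suc n. cinner (bop_apply (M i k) (?h k)) (?h i))
              = of_real ((norm (bop_apply S g))\<^sup>2)
                + (z * cinner (bop_apply (M n j) h) g + cnj (z * cinner (bop_apply (M n j) h) g))
                + z * cnj z * cinner (bop_apply (M j j) h) h"
            using j by (subst sum_sum_support[of _ "{j, n}"])
              (auto simp: a_def[symmetric] aS cinner_self bop_apply_scaleC
                cinner_scaleC_left cinner_scaleC_right herm' algebra_simps)
          then have "Re (\<Sum>i<Suc n. \<Sum>k<Suc n. cinner (bop_apply (M i k) (?h k)) (?h i))
              = (norm (bop_apply S g))\<^sup>2 + 2 * Re (z * cinner (bop_apply (M n j) h) g) + (cmod z)\<^sup>2 * ?b"
            by (simp only: Re_quadratic Re_complex_of_real)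
          then show ?thesis using pos[of ?h] by simp
        qed
      qed
      also have "\<dots> \<le> (norm (bop_apply S g))\<^sup>2 * (norm (M j j) * (norm h)\<^sup>2)"
      proof (rule mult_left_mono)
        have "?b \<le> norm (bop_apply (M j j) h) * norm h"
          using cinner_cauchy_schwarz complex_Re_le_cmod order_trans by blast
        also have "\<dots> \<le> (norm (M j j) * norm h) * norm h"
          by (intro mult_right_mono norm_bop_apply_le) simp
        finally show "?b \<le> norm (M j j) * (norm h)\<^sup>2" by (simp add: power2_eq_square mult_ac)
      qed simp
      also have "\<dots> = (C * norm h * norm (bop_apply S g))\<^sup>2"
        by (simp add: C_def power_mult_distrib mult_ac)
      finally show ?thesis by (rule power2_le_imp_le) (simp add: C_def)
    qed
    moreover have "0 \<le> C" by (simp add: C_def)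
    ultimately show ?thesis using douglas_factor[OF S(1)] by blast
  qed
  then obtain c where c: "\<And>j. j < n \<Longrightarrow> S * c j = M n j"
    "\<And>j h. j < n \<Longrightarrow> bop_apply (c j) h \<in> closure (range (bop_apply S))" by metis
  \<comment> \<open>The Schur complement of the pivot, with \<open>star (c i) * c j\<close> in the
    role of the product that would contain the inverse of \<open>a\<close>.\<close>
  define N where "N i j = M i j - star (c i) * c j" for i j
  have "matrix_positive n N"
  proof (rule Suc.IH)
    show "star (N i j) = N j i" if "i < n" "j < n" for i j
      using herm[of i j] that by (simp add: N_def star_diff star_mult star_star)
    fix h :: "nat \<Rightarrow> 'h"
    define y where "y = (\<Sum>j<n. bop_apply (c j) (h j))"
    let ?N = "Re (\<Sum>i<n. \<Sum>j<n. cinner (bop_apply (N i j) (h j)) (h i))"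
    let ?M = "Re (\<Sum>i<n. \<Sum>j<n. cinner (bop_apply (M i j) (h j)) (h i))"
    \<comment> \<open>The pivot variable contributes only vectors \<open>S g\<close> to the
      completed square. Cancelling \<open>y\<close> in the limit therefore relies on every
      \<open>c j\<close> having its values in the closed range of \<open>S\<close>.\<close>
    have yS: "- y \<in> closure (range (bop_apply S))"
      unfolding y_def using c(2)
      by (intro subspace_neg subspace_sum subspace_closure subspace_range_bop) auto
    have NM: "?N = ?M - (norm y)\<^sup>2"
    proof -
      have "complex_of_real ((norm y)\<^sup>2) = (\<Sum>i<n. \<Sum>j<n. cinner (bop_apply (c j) (h j)) (bop_apply (c i) (h i)))"
        unfolding cinner_self[symmetric] y_def by (simp add: cinner_sum_left cinner_sum_right)
      then have "(norm y)\<^sup>2 = Re (\<Sum>i<n. \<Sum>j<n. cinner (bop_apply (c j) (h j)) (bop_apply (c i) (h i)))"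
        by (metis Re_complex_of_real)
      then show ?thesis
        by (simp add: N_def bop_simps(4,6) cinner_diff_left bop_cinner_star' sum_subtractf)
    qed
    have "0 \<le> ?N + (norm (y + v))\<^sup>2" if vS: "v \<in> range (bop_apply S)" for v
    proof -
      obtain g where g: "v = bop_apply S g" using vS by blast
      let ?h = "h(n := g)"
      have 1: "(\<Sum>j<n. cinner (bop_apply (M n j) (h j)) g) = cinner y v"
        unfolding y_def g by (simp add: cinner_sum_left bop_simps cinner_selfadjoint[OF S(1)] flip: c(1))
      have "cinner (bop_apply (M i n) g) (h i) = cnj (cinner (bop_apply (M n i) (h i)) g)" if "i < n" for i
        using herm[of n i] that bop_cinner_star[of "M n i" "h i" g] cinner_commute[of _ "h i"] by simp
      then have 2: "(\<Sum>i<n. cinner (bop_apply (M i n) g) (h i)) = cnj (cinner y v)"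
        by (simp add: cnj_sum flip: 1)
      have "0 \<le> Re (\<Sum>i<Suc n. \<Sum>j<Suc n. cinner (bop_apply (M i j) (?h j)) (?h i))" by (rule pos)
      also have "(\<Sum>i<Suc n. \<Sum>j<Suc n. cinner (bop_apply (M i j) (?h j)) (?h i))
          = (\<Sum>i<n. \<Sum>j<n. cinner (bop_apply (M i j) (h j)) (h i)) + cnj (cinner y v)
            + cinner y v + cinner v v"
        by (simp add: sum.distrib 1 2 a_def[symmetric] aS g)
      also have "Re \<dots> = ?N + (norm (y + v))\<^sup>2"
      proof -
        have "(norm (y + v))\<^sup>2 = (norm y)\<^sup>2 + 2 * inner y v + (norm v)\<^sup>2"
          by (simp add: power2_norm_eq_inner inner_add_left inner_add_right inner_commute[of v y])
        then show ?thesis unfolding NM inner_eq_Re_cinner by (simp add: cinner_self)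
      qed
      finally show ?thesis .
    qed
    then have "closure (range (bop_apply S)) \<subseteq> {v. 0 \<le> ?N + (norm (y + v))\<^sup>2}"
      by (intro closure_minimal closed_Collect_le continuous_intros) auto
    then have "0 \<le> ?N + (norm (y + - y))\<^sup>2" using yS by blast
    then show "0 \<le> ?N" by simp
  qed
  then obtain b where b: "\<And>i j. i < n \<Longrightarrow> j < n \<Longrightarrow> N i j = (\<Sum>k<n. star (b k i) * b k j)"
    unfolding matrix_positive_def by blast
  \<comment> \<open>The triangular factor: the factor of the Schur complement, extended by a zero
    column and by the pivot row \<open>c\<close>, \<open>S\<close>.\<close>
  define b' where "b' k i = (if k < n then if i < n then b k i else 0 else if i < n then c i else S)" for k i
  have "M i j = (\<Sum>k<Suc n. star (b' k i) * b' k j)" if ij: "i < Suc n" "j < Suc n" for i j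
  proof -
    consider "i < n" "j < n" | "i = n" "j < n" | "i < n" "j = n" | "i = n" "j = n"
      using ij by linarith
    then show ?thesis
    proof cases
      case 1
      then show ?thesis using b[OF 1] by (simp add: b'_def N_def algebra_simps)
    next
      case 2
      then show ?thesis by (simp add: b'_def S c(1))
    next
      case 3
      have "M i n = star (M n i)" using herm[of n i] 3 by simp
      then show ?thesis using 3 by (simp add: b'_def star_mult S flip: c(1))
    next
      case 4
      then show ?thesis by (simp add: b'_def S a_def)
    qed
  qed
  then show ?case unfolding matrix_positive_def by blast
qed

section \<open>Completely positive maps\<close>

lemma completely_positiveD:
  assumes "completely_positive \<theta>" "matrix_positive n a"
  shows "matrix_positive n (\<lambda>i j. \<theta> (a i j))"
  using assms unfolding completely_positive_def by blast

lemma completely_positive_scaleR: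
  fixes \<theta> :: "'a::cstar_algebra \<Rightarrow> 'b::cstar_algebra"
  assumes "completely_positive \<theta>" "0 \<le> r"
  shows "completely_positive (r *\<^sub>R \<theta>)"
  unfolding completely_positive_def
proof (intro conjI allI impI)
  have \<theta>: "clinear \<theta>" using assms(1) by (simp add: completely_positive_def)
  show "clinear (r *\<^sub>R \<theta>)"
    unfolding clinear_iff scaleR_fun_def
    by (use \<theta> in \<open>auto simp: clinear_iff scaleR_eq_scaleC scaleC_add_right scaleC_scaleC mult.commute\<close>)
  fix n and a :: "nat \<Rightarrow> nat \<Rightarrow> 'a" assume "matrix_positive n a"
  from completely_positiveD[OF assms(1) this] obtain b where b: "\<forall>i<n. \<forall>j<n. \<theta> (a i j) = (\<Sum>k<n. star (b k i) * b k j)"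
    unfolding matrix_positive_def ..
  show "matrix_positive n (\<lambda>i j. (r *\<^sub>R \<theta>) (a i j))"
    unfolding matrix_positive_def scaleR_fun_def
    by (intro exI[of _ "\<lambda>k i. sqrt r *\<^sub>R b k i"])
      (simp add: b star_scaleR scaleR_sum_right assms(2) flip: real_sqrt_mult)
qed

text \<open>
  A list of pairs \<open>(a, h)\<close> stands for the formal sum of the elementary tensors \<open>a \<otimes> h\<close>, and
  \<open>cp_form\<close> is the sesquilinear form from which Stinespring's theorem constructs \<open>K\<close>.
\<close>

definition cp_form ::
    "('a::cstar_algebra \<Rightarrow> 'h::complex_hilbert bop) \<Rightarrow> ('a \<times> 'h) list \<Rightarrow> ('a \<times> 'h) list \<Rightarrow> complex"
  where "cp_form \<theta> xs ys =
    (\<Sum>p\<leftarrow>xs. \<Sum>q\<leftarrow>ys. cinner (bop_apply (\<theta> (star (fst q) * fst p)) (snd p)) (snd q))"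

definition tensor_scale :: "complex \<Rightarrow> ('a \<times> 'h::complex_vector) list \<Rightarrow> ('a \<times> 'h) list"
  where "tensor_scale z = map (\<lambda>p. (fst p, z *\<^sub>C snd p))"

lemma cp_form_append_left: "cp_form \<theta> (xs @ ys) zs = cp_form \<theta> xs zs + cp_form \<theta> ys zs"
  by (simp add: cp_form_def)

lemma cp_form_append_right: "cp_form \<theta> xs (ys @ zs) = cp_form \<theta> xs ys + cp_form \<theta> xs zs"
  by (simp add: cp_form_def sum_list_addf)

lemma cp_form_scale_left: "cp_form \<theta> (tensor_scale z xs) ys = z * cp_form \<theta> xs ys"
  by (simp add: cp_form_def tensor_scale_def o_def bop_apply_scaleC cinner_scaleC_left
      sum_list_const_mult)

lemma cp_form_scale_right: "cp_form \<theta> xs (tensor_scale z ys) = cnj z * cp_form \<theta> xs ys"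
  by (simp add: cp_form_def tensor_scale_def o_def cinner_scaleC_right sum_list_const_mult)

lemma sum_list_swap: "(\<Sum>p\<leftarrow>xs. \<Sum>q\<leftarrow>ys. f p q) = (\<Sum>q\<leftarrow>ys. \<Sum>p\<leftarrow>xs. f p q :: 'c::comm_monoid_add)"
  by (induction xs) (simp_all add: sum_list_addf)

lemma cnj_sum_list: "cnj (\<Sum>p\<leftarrow>xs. f p) = (\<Sum>p\<leftarrow>xs. cnj (f p))"
  by (induction xs) simp_all

lemma sum_list_conv_sum: "(\<Sum>p\<leftarrow>xs. f p) = (\<Sum>i<length xs. f (xs ! i))"
  by (simp add: sum_list_sum_nth atLeast0LessThan)

lemma sum_cinner_gram:
  fixes f g :: "'j \<Rightarrow> 'i \<Rightarrow> 'h::complex_hilbert"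
  shows "(\<Sum>j\<in>A. \<Sum>i\<in>A. \<Sum>k\<in>B. cinner (f k j) (g k i))
    = (\<Sum>k\<in>B. cinner (\<Sum>j\<in>A. f k j) (\<Sum>i\<in>A. g k i))"
proof -
  have "cinner (\<Sum>j\<in>A. f k j) (\<Sum>i\<in>A. g k i) = (\<Sum>j\<in>A. \<Sum>i\<in>A. cinner (f k j) (g k i))" for k
    by (subst cinner_sum_left) (simp add: cinner_sum_right)
  then show ?thesis by (simp only: sum.swap[of _ B A])
qed

lemma matrix_positive_gram: "matrix_positive n (\<lambda>i j. star (a i) * a j)" if "0 < n"
proof -
  have "star (a i) * a j = (\<Sum>k<n. star (if k = 0 then a i else 0) * (if k = 0 then a j else 0))" for i j
    using that by (subst sum.remove[of _ 0]) (auto simp: sum.neutral)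
  then show ?thesis
    unfolding matrix_positive_def by (intro exI[of _ "\<lambda>k i. if k = 0 then a i else 0"] allI impI)
qed

section \<open>Positivity of the form attached to a completely positive map\<close>

context
  fixes \<theta> :: "'a::cstar_algebra \<Rightarrow> 'h::complex_hilbert bop"
  assumes cp: "completely_positive \<theta>"
begin

text \<open>The Gram matrix of \<open>a\<close> and \<open>b\<close> has a positive image, and a
  factored matrix is Hermitian. This reads the symmetry off a 2 by 2 matrix without splitting
  elements of the algebra into positive parts.\<close>

lemma cp_hermitian: "star (\<theta> (star b * a)) = \<theta> (star a * b)"
proof -
  define c where "c i = (if i = 0 then a else b)" for i :: nat
  have "matrix_positive 2 (\<lambda>i j. \<theta> (star (c i) * c j))"
    by (rule completely_positiveD[OF cp matrix_positive_gram]) simp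
  then obtain d where gram: "\<forall>i<2. \<forall>j<2. \<theta> (star (c i) * c j) = (\<Sum>k<2::nat. star (d k i) * d k j)"
    unfolding matrix_positive_def ..
  from gram[rule_format, of 0 1] gram[rule_format, of 1 0] show ?thesis
    by (simp add: c_def star_sum star_mult star_star)
qed

lemma cp_form_cnj: "cp_form \<theta> ys xs = cnj (cp_form \<theta> xs ys)"
proof -
  have *: "cnj (cinner (bop_apply (\<theta> (star a * b)) k) h) = cinner (bop_apply (\<theta> (star b * a)) h) k" for a b h k
    by (simp add: bop_cinner_star[of _ h] cp_hermitian flip: cinner_commute)
  show ?thesis
    unfolding cp_form_def cnj_sum_list * by (rule sum_list_swap)
qed

text \<open>The first components of the list form a Gram matrix. Factorising its image exhibits the
  form as a sum of squared norms, one for each row of the factor.\<close>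

lemma cp_form_nonneg: "0 \<le> Re (cp_form \<theta> xs xs)"
proof (cases "xs = []")
  case False
  define n where "n = length xs"
  define a where "a i = fst (xs ! i)" for i
  define h where "h i = snd (xs ! i)" for i
  have "matrix_positive n (\<lambda>i j. \<theta> (star (a i) * a j))"
    by (rule completely_positiveD[OF cp matrix_positive_gram]) (simp add: n_def False)
  then obtain d where d: "\<forall>i<n. \<forall>j<n. \<theta> (star (a i) * a j) = (\<Sum>k<n. star (d k i) * d k j)"
    unfolding matrix_positive_def ..
  have "cp_form \<theta> xs xs = (\<Sum>j<n. \<Sum>i<n. cinner (bop_apply (\<theta> (star (a i) * a j)) (h j)) (h i))"
    by (simp add: cp_form_def sum_list_conv_sum n_def a_def h_def)
  also have "\<dots> = (\<Sum>j<n. \<Sum>i<n. \<Sum>k<n. cinner (bop_apply (d k j) (h j)) (bop_apply (d k i) (h i)))"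
    by (intro sum.cong refl) (simp add: d bop_sum_apply cinner_sum_left bop_simps bop_cinner_star')
  also have "\<dots> = (\<Sum>k<n. cinner (\<Sum>j<n. bop_apply (d k j) (h j)) (\<Sum>j<n. bop_apply (d k j) (h j)))"
    by (rule sum_cinner_gram)
  finally show ?thesis by (simp add: cinner_self sum_nonneg)
qed (simp add: cp_form_def)

lemma cp_form_cauchy_schwarz:
  "(cmod (cp_form \<theta> xs ys))\<^sup>2 \<le> Re (cp_form \<theta> xs xs) * Re (cp_form \<theta> ys ys)"
proof (subst mult.commute, rule semidefinite_cauchy_schwarz[OF cp_form_nonneg])
  fix z
  let ?zs = "ys @ tensor_scale z xs"
  have "cp_form \<theta> ?zs ?zs = cp_form \<theta> ys ys + (z * cp_form \<theta> xs ys + cnj (z * cp_form \<theta> xs ys))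
      + z * cnj z * cp_form \<theta> xs xs"
    using cp_form_cnj[of ys xs]
    by (simp add: cp_form_append_left cp_form_append_right cp_form_scale_left cp_form_scale_right
        algebra_simps)
  then show "0 \<le> Re (cp_form \<theta> ys ys) + 2 * Re (z * cp_form \<theta> xs ys)
      + (cmod z)\<^sup>2 * Re (cp_form \<theta> xs xs)"
    using cp_form_nonneg[of ?zs] by (simp only: Re_quadratic)
qed

end

text \<open>The definite description denotes because real orthogonality to a complex subspace is
  already complex orthogonality, the subspace being stable under multiplication by
  \<open>\<i>\<close>.\<close>

lemma orth_proj_eq_0_iff:
  fixes S :: "'k::complex_hilbert set"
  assumes "csubspace S" "closed S"
  shows "orth_proj S x = 0 \<longleftrightarrow> (\<forall>z\<in>S. cinner x z = 0)"
proof -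
  have S: "subspace S"
    using complex_vector.subspace_0[OF assms(1)] complex_vector.subspace_add[OF assms(1)]
      complex_vector.subspace_scale[OF assms(1)]
    by (simp add: subspace_def scaleR_eq_scaleC)
  obtain y where y: "y \<in> S" "\<And>z. z \<in> S \<Longrightarrow> inner (x - y) z = 0"
    using complete_closed_subspace_projection[OF S assms(2)] by blast
  have y': "cinner (x - y) z = 0" if "z \<in> S" for z
    unfolding cinner_eq_inner using y(2) that complex_vector.subspace_scale[OF assms(1) that]
    by (simp add: complex_eq_iff)
  have uniq: "u = y" if u: "u \<in> S" "\<forall>z\<in>S. cinner (x - u) z = 0" for u
  proof -
    have "u - y \<in> S" using u(1) y(1) by (rule complex_vector.subspace_diff[OF assms(1)])
    then have "cinner (x - y) (u - y) - cinner (x - u) (u - y) = 0" using y' u(2) by simp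
    then have "cinner (u - y) (u - y) = 0" by (simp add: cinner_diff_left)
    then show ?thesis by (simp add: cinner_self_eq_0)
  qed
  have p: "orth_proj S x = y"
    unfolding orth_proj_def by (rule the_equality) (simp_all add: y(1) y' uniq)
  show ?thesis
  proof
    assume "orth_proj S x = 0"
    then show "\<forall>z\<in>S. cinner x z = 0" using y' p by simp
  next
    assume "\<forall>z\<in>S. cinner x z = 0"
    then have "cinner y y = 0" using y'[OF y(1)] y(1) by (simp add: cinner_diff_left)
    then show "orth_proj S x = 0" using p by (simp add: cinner_self_eq_0)
  qed
qed

lemma bounded_sesquilinear_bop:
  fixes B :: "'h::complex_hilbert \<Rightarrow> 'h \<Rightarrow> complex"
  assumes add: "\<And>x y z. B (x + y) z = B x z + B y z" "\<And>x y z. B x (y + z) = B x y + B x z"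
    and scale: "\<And>c x y. B (c *\<^sub>C x) y = c * B x y" "\<And>c x y. B x (c *\<^sub>C y) = cnj c * B x y"
    and "0 \<le> C" and bound: "\<And>x y. cmod (B x y) \<le> C * norm x * norm y"
  shows "\<exists>T. \<forall>x y. cinner (bop_apply T x) y = B x y"
proof -
  have "\<exists>w. w \<in> closure (range (\<lambda>y. y)) \<and> norm w \<le> C * norm x \<and> (\<forall>y. cinner y w = cnj (B x y))" for x
    by (rule riesz_family[where z = 0 and add = "(+)" and scale = scaleC])
      (use assms scale(2)[of x 0 x] in \<open>simp_all add: complex_vector.scale_zero_left\<close>)
  then obtain f where f: "\<And>x. norm (f x) \<le> C * norm x" "\<And>x y. cinner y (f x) = cnj (B x y)" by metis
  have "clinear f"
    unfolding clinear_iff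
    by (intro conjI allI cinner_extI) (simp_all add: f add scale cinner_add_right cinner_scaleC_right)
  then obtain T where "bop_apply T = f" using bop_ex f(1) by blast
  then have "cinner (bop_apply T x) y = B x y" for x y
    by (subst cinner_commute) (simp add: f(2))
  then show ?thesis by blast
qed

section \<open>The covariant Stinespring dilation\<close>

locale covariant_stinespring =
  fixes G :: "('g, 'm) monoid_scheme"
    and \<tau> :: "'g \<Rightarrow> 'a::cstar_algebra \<Rightarrow> 'a"
    and \<phi> :: "'a \<Rightarrow> 'h::complex_hilbert bop"
    and \<rho> :: "'a \<Rightarrow> 'k::complex_hilbert bop"
    and V :: "'h \<Rightarrow> 'k"
    and U :: "'g \<Rightarrow> 'k bop"
  assumes action: "cstar_action G \<tau>"
    and phi_UCP: "\<phi> \<in> UCP G \<tau>"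
    and dilation: "minimal_stinespring \<phi> \<rho> V"
    and unitaries: "stinespring_unitary_rep G \<tau> \<rho> V U"
begin

abbreviation "M \<equiv> bop_commutant (range \<rho> \<union> U ` carrier G)"

lemma rho_simps:
  "\<rho> (x * y) = \<rho> x * \<rho> y" "\<rho> (star x) = star (\<rho> x)" "\<rho> 1 = 1"
  "\<rho> (x + y) = \<rho> x + \<rho> y" "\<rho> (c *\<^sub>C x) = c *\<^sub>C \<rho> x"
  using dilation by (simp_all add: minimal_stinespring_def unital_star_hom_def clinear_iff)

lemma V_simps: "V (x + y) = V x + V y" "V (c *\<^sub>C x) = c *\<^sub>C V x" "norm (V x) = norm x"
  using dilation by (simp_all add: minimal_stinespring_def clinear_iff)

lemma V_zero [simp]: "V 0 = 0" using V_simps(3)[of 0] by simp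

lemma V_bounded_linear: "bounded_linear V"
  by (rule bounded_linear_intro[of _ 1]) (simp_all add: V_simps scaleR_eq_scaleC)

lemma V_clinear: "clinear V" by (simp add: clinear_iff V_simps)

lemma phi_form: "cinner (bop_apply (\<phi> a) h) k = cinner (bop_apply (\<rho> a) (V h)) (V k)"
proof -
  have "cinner k (bop_apply (\<phi> a) h) = cinner (V k) (bop_apply (\<rho> a) (V h))"
    using dilation cinner_cadjoint[OF V_bounded_linear V_clinear] by (simp add: minimal_stinespring_def)
  then show ?thesis by (metis cinner_commute)
qed

lemma phi_one: "\<phi> 1 = 1" using phi_UCP by (simp add: UCP_def)

lemma cinner_V: "cinner (V h) (V k) = cinner h k"
  using phi_form[of 1 h k] by (simp add: phi_one rho_simps bop_simps)

lemma dense: "closure (cspan {bop_apply (\<rho> a) (V h) | a h. True}) = UNIV"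
  using dilation by (simp add: minimal_stinespring_def)

lemma U_V: "g \<in> carrier G \<Longrightarrow> bop_apply (U g) (V h) = V h"
  and U_unitary: "g \<in> carrier G \<Longrightarrow> star (U g) * U g = 1" "g \<in> carrier G \<Longrightarrow> U g * star (U g) = 1"
  and U_rho_star: "g \<in> carrier G \<Longrightarrow> U g * \<rho> a * star (U g) = \<rho> (\<tau> g a)"
  using unitaries by (simp_all add: stinespring_unitary_rep_def unitary_rep_def)

lemma U_rho: "g \<in> carrier G \<Longrightarrow> U g * \<rho> a = \<rho> (\<tau> g a) * U g"
  using U_rho_star[of g a] U_unitary(1)[of g] by (metis mult.assoc mult_1_right)

lemma Ustar_V: "g \<in> carrier G \<Longrightarrow> bop_apply (star (U g)) (V h) = V h"
  using U_V[of g h] U_unitary(1)[of g] by (metis bop_simps(3,4))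

lemma U_rho_V: "g \<in> carrier G \<Longrightarrow>
    bop_apply (U g) (bop_apply (\<rho> a) (V h)) = bop_apply (\<rho> (\<tau> g a)) (V h)"
  using U_rho[of g a] by (metis bop_simps(4) U_V)

lemma tau_simps:
  "g \<in> carrier G \<Longrightarrow> \<tau> g (x * y) = \<tau> g x * \<tau> g y" "g \<in> carrier G \<Longrightarrow> \<tau> g (star x) = star (\<tau> g x)"
  using action by (simp_all add: cstar_action_def unital_star_hom_def)

lemma commutantD:
  "T \<in> M \<Longrightarrow> T * \<rho> a = \<rho> a * T" "T \<in> M \<Longrightarrow> g \<in> carrier G \<Longrightarrow> T * U g = U g * T"
  by (auto simp: bop_commutant_def)

lemma commutantI:
  "(\<And>a. T * \<rho> a = \<rho> a * T) \<Longrightarrow> (\<And>g. g \<in> carrier G \<Longrightarrow> T * U g = U g * T) \<Longrightarrow> T \<in> M"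
  by (auto simp: bop_commutant_def)

lemma commutant_star: "T \<in> M \<Longrightarrow> star T \<in> M"
proof (rule commutantI)
  assume T: "T \<in> M"
  show "star T * \<rho> a = \<rho> a * star T" for a
    using arg_cong[OF commutantD(1)[OF T, of "star a"], of star] by (simp add: star_mult rho_simps star_star)
  fix g assume g: "g \<in> carrier G"
  have "star (U g) * star T = star T * star (U g)"
    using arg_cong[OF commutantD(2)[OF T g], of star] by (simp add: star_mult)
  then have "U g * (star (U g) * star T) * U g = U g * (star T * star (U g)) * U g" by simp
  then have "(U g * star (U g)) * star T * U g = U g * star T * (star (U g) * U g)"
    by (simp only: mult.assoc)
  then show "star T * U g = U g * star T" by (simp add: U_unitary[OF g])
qed

lemma commutant_add: "S \<in> M \<Longrightarrow> T \<in> M \<Longrightarrow> S + T \<in> M"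
  by (simp add: bop_commutant_def distrib_left distrib_right)

lemma commutant_scaleC: "T \<in> M \<Longrightarrow> c *\<^sub>C T \<in> M"
  by (simp add: bop_commutant_def scaleC_mult_left scaleC_mult_right)

lemma commutant_one: "1 \<in> M"
  by (simp add: bop_commutant_def)

text \<open>The range of the isometry \<open>V\<close> is complete, hence a closed subspace, so span
  and closure add nothing. Vanishing of the projected vectors is orthogonality to that
  range.\<close>

lemma faithful_iff:
  "faithful_subspace M (closure (cspan (range V))) \<longleftrightarrow>
    (\<forall>T\<in>M. (\<forall>h k. cinner (bop_apply T (V h)) (V k) = 0) \<longrightarrow> T = 0)"
proof -
  have sub: "csubspace (range V)"
    unfolding complex_vector.subspace_def
    by (auto simp flip: V_simps(1,2) intro: image_eqI[of 0 V 0])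
  have "complete (V ` UNIV)"
    by (rule complete_isometric_image[of 1, OF _ subspace_UNIV V_bounded_linear])
      (simp_all add: V_simps complete_UNIV)
  then have cl: "closed (range V)" by (rule complete_imp_closed)
  have "closure (cspan (range V)) = range V"
    using cl sub by (simp add: complex_vector.span_eq_iff[THEN iffD2])
  then show ?thesis
    by (simp add: faithful_subspace_def sub cl orth_proj_eq_0_iff)
qed

section \<open>Formal tensors in the dilation space and Radon-Nikodym operators\<close>

definition tensor_vec :: "('a \<times> 'h) list \<Rightarrow> 'k"
  where "tensor_vec xs = (\<Sum>p\<leftarrow>xs. bop_apply (\<rho> (fst p)) (V (snd p)))"

lemma tensor_vec_simps:
  "tensor_vec [] = 0" "tensor_vec (xs @ ys) = tensor_vec xs + tensor_vec ys"
  "tensor_vec [(a, h)] = bop_apply (\<rho> a) (V h)"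
  by (simp_all add: tensor_vec_def)

lemma tensor_vec_scale: "tensor_vec (tensor_scale z xs) = z *\<^sub>C tensor_vec xs"
  by (induction xs)
    (simp_all add: tensor_vec_def tensor_scale_def V_simps bop_apply_scaleC scaleC_add_right)

lemma tensor_vec_eqI: "(\<And>xs. cinner (tensor_vec xs) u = cinner (tensor_vec xs) v) \<Longrightarrow> u = v"
  by (rule dense_cinner_eqI[OF dense]) (auto simp flip: tensor_vec_simps(3))

lemma cp_form_phi: "cp_form \<phi> xs ys = cinner (tensor_vec xs) (tensor_vec ys)"
  by (simp add: cp_form_def tensor_vec_def cinner_sum_list_left cinner_sum_list_right phi_form
      rho_simps bop_simps bop_cinner_star') (rule sum_list_swap)

text \<open>Positivity of \<open>\<phi> - \<theta>\<close> dominates the form of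
  \<open>\<theta>\<close> by that of \<open>\<phi>\<close>, which is the inner product of
  \<open>K\<close> on tensors. Cauchy-Schwarz for \<open>\<theta>\<close> then bounds its form by
  the product of the norms in \<open>K\<close>, and a bounded form is represented by an
  operator.\<close>

lemma radon_nikodym:
  assumes "\<theta> \<in> cp_interval \<phi>"
  obtains T where "\<And>a h b k. cinner (bop_apply T (bop_apply (\<rho> a) (V h))) (bop_apply (\<rho> b) (V k))
      = cinner (bop_apply (\<theta> (star b * a)) h) k"
proof -
  have cp: "completely_positive \<theta>" "completely_positive (\<phi> - \<theta>)"
    using assms by (simp_all add: cp_interval_def)
  have "cp_form (\<phi> - \<theta>) xs xs = cp_form \<phi> xs xs - cp_form \<theta> xs xs" for xs
    by (simp add: cp_form_def fun_diff_def bop_diff_apply cinner_diff_left sum_list_subtractf)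
  then have le: "Re (cp_form \<theta> xs xs) \<le> (norm (tensor_vec xs))\<^sup>2" for xs
    using cp_form_nonneg[OF cp(2), of xs] by (simp add: cp_form_phi cinner_self)
  have bound: "cmod (cp_form \<theta> xs ys) \<le> norm (tensor_vec ys) * norm (tensor_vec xs)" for xs ys
  proof (rule power2_le_imp_le)
    have "(cmod (cp_form \<theta> xs ys))\<^sup>2 \<le> (norm (tensor_vec xs))\<^sup>2 * (norm (tensor_vec ys))\<^sup>2"
      using cp_form_cauchy_schwarz[OF cp(1), of xs ys]
        mult_mono[OF le[of xs] le[of ys] _ cp_form_nonneg[OF cp(1)]] by simp
    then show "(cmod (cp_form \<theta> xs ys))\<^sup>2 \<le> (norm (tensor_vec ys) * norm (tensor_vec xs))\<^sup>2"
      by (simp add: power_mult_distrib mult.commute)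
  qed simp
  \<comment> \<open>First use of Riesz: \<open>w ys\<close> is to be the adjoint of \<open>T\<close>
    at the tensor \<open>ys\<close>, still indexed by formal sums.\<close>
  have "\<exists>w. norm w \<le> norm (tensor_vec ys) \<and> (\<forall>xs. cinner (tensor_vec xs) w = cp_form \<theta> xs ys)" for ys
  proof -
    have "\<exists>w. w \<in> closure (range tensor_vec) \<and> norm w \<le> norm (tensor_vec ys)
        \<and> (\<forall>xs. cinner (tensor_vec xs) w = cp_form \<theta> xs ys)"
      by (rule riesz_family[where z = "[]" and add = "(@)" and scale = tensor_scale])
        (simp_all add: bound tensor_vec_simps tensor_vec_scale cp_form_append_left cp_form_scale_left,
          simp add: cp_form_def)
    then show ?thesis by blast
  qed
  then obtain w where w: "\<And>ys. norm (w ys) \<le> norm (tensor_vec ys)"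
    "\<And>xs ys. cinner (tensor_vec xs) (w ys) = cp_form \<theta> xs ys" by metis
  \<comment> \<open>Second use of Riesz: the adjoint of \<open>w\<close> is defined at every vector
    of \<open>K\<close>, so no separate extension by continuity arises.\<close>
  have "\<exists>v. norm v \<le> norm u \<and> (\<forall>ys. cinner (tensor_vec ys) v = cinner (w ys) u)" for u
  proof -
    have w_app: "w (xs @ ys) = w xs + w ys" for xs ys
      by (rule tensor_vec_eqI) (simp add: w cinner_add_right cp_form_append_right)
    have w_scale: "w (tensor_scale c xs) = c *\<^sub>C w xs" for c xs
      by (rule tensor_vec_eqI) (simp add: w cinner_scaleC_right cp_form_scale_right)
    have "\<exists>v. v \<in> closure (range tensor_vec) \<and> norm v \<le> norm u
        \<and> (\<forall>ys. cinner (tensor_vec ys) v = cinner (w ys) u)"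
    proof (rule riesz_family[where z = "[]" and add = "(@)" and scale = tensor_scale])
      show "cinner (w []) u = 0" using w(1)[of "[]"] by (simp add: tensor_vec_simps)
      show "cmod (cinner (w ys) u) \<le> norm u * norm (tensor_vec ys)" for ys
        using cinner_cauchy_schwarz[of "w ys" u] mult_left_mono[OF w(1)[of ys], of "norm u"]
        by (simp add: mult.commute)
    qed (simp_all add: tensor_vec_simps tensor_vec_scale w_app w_scale cinner_add_left cinner_scaleC_left)
    then show ?thesis by blast
  qed
  then obtain f where f: "\<And>u. norm (f u) \<le> 1 * norm u"
    "\<And>u ys. cinner (tensor_vec ys) (f u) = cinner (w ys) u" by (metis mult_1)
  have "clinear f"
    unfolding clinear_iff
    by (intro conjI allI tensor_vec_eqI) (simp_all add: f cinner_add_right cinner_scaleC_right)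
  then obtain T where T: "bop_apply T = f" using bop_ex f(1) by blast
  have "cinner (f (tensor_vec xs)) (tensor_vec ys) = cp_form \<theta> xs ys" for xs ys
    by (metis cinner_commute f(2) w(2) complex_cnj_cnj)
  from this[of "[(_, _)]" "[(_, _)]"] that[of T] show thesis
    by (simp add: T tensor_vec_simps cp_form_def)
qed

text \<open>The form of \<open>\<theta>\<close> sees two tensors only through
  \<open>star b * a\<close>, so a factor \<open>\<rho> c\<close> can move from one side to the other
  across \<open>T\<close>. Invariance of \<open>\<theta>\<close> gives commutation with the
  unitaries, which act on tensors through \<open>\<tau>\<close> because they fix the range of
  \<open>V\<close>.\<close>

lemma invariant_radon_nikodym:
  assumes "\<theta> \<in> cp_interval \<phi>" and inv: "\<And>g a. g \<in> carrier G \<Longrightarrow> \<theta> (\<tau> g a) = \<theta> a"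
  obtains T where "T \<in> M"
    "\<And>a h k. cinner (bop_apply T (bop_apply (\<rho> a) (V h))) (V k) = cinner (bop_apply (\<theta> a) h) k"
proof -
  obtain T where T: "\<And>a h b k. cinner (bop_apply T (bop_apply (\<rho> a) (V h))) (bop_apply (\<rho> b) (V k))
      = cinner (bop_apply (\<theta> (star b * a)) h) k" using radon_nikodym[OF assms(1)] by blast
  have "T \<in> M"
  proof (rule commutantI)
    fix c
    show "T * \<rho> c = \<rho> c * T"
    proof (rule dense_bop_eqI[OF dense], clarify)
      fix a h b k
      have "cinner (bop_apply (\<rho> c) (bop_apply T (bop_apply (\<rho> a) (V h)))) (bop_apply (\<rho> b) (V k))
          = cinner (bop_apply T (bop_apply (\<rho> a) (V h))) (bop_apply (\<rho> (star c * b)) (V k))"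
        by (simp add: bop_cinner_star rho_simps bop_simps)
      also have "\<dots> = cinner (bop_apply T (bop_apply (\<rho> (c * a)) (V h))) (bop_apply (\<rho> b) (V k))"
        unfolding T by (simp add: star_mult star_star mult.assoc)
      finally show "cinner (bop_apply (T * \<rho> c) (bop_apply (\<rho> a) (V h))) (bop_apply (\<rho> b) (V k))
          = cinner (bop_apply (\<rho> c * T) (bop_apply (\<rho> a) (V h))) (bop_apply (\<rho> b) (V k))"
        by (simp add: bop_simps rho_simps)
    qed
  next
    fix g assume g: "g \<in> carrier G"
    have "star (U g) * (T * U g) = T"
    proof (rule dense_bop_eqI[OF dense], clarify)
      fix a h b k
      show "cinner (bop_apply (star (U g) * (T * U g)) (bop_apply (\<rho> a) (V h))) (bop_apply (\<rho> b) (V k))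
          = cinner (bop_apply T (bop_apply (\<rho> a) (V h))) (bop_apply (\<rho> b) (V k))"
        using inv[OF g, of "star b * a"]
        by (simp add: bop_simps bop_cinner_star' U_rho_V g T tau_simps)
    qed
    then have "U g * (star (U g) * (T * U g)) = U g * T" by simp
    then show "T * U g = U g * T" by (simp add: U_unitary(2)[OF g] flip: mult.assoc)
  qed
  moreover have "cinner (bop_apply T (bop_apply (\<rho> a) (V h))) (V k) = cinner (bop_apply (\<theta> a) h) k" for a h k
    using T[of a h 1 k] by (simp add: rho_simps bop_simps)
  ultimately show thesis by (rule that)
qed

section \<open>Compression to \<open>H\<close> and the circle of implications\<close>

lemma compression:
  obtains C where "\<And>B h k. cinner (bop_apply (C B) h) k = cinner (bop_apply B (V h)) (V k)"
proof -
  have "\<exists>C. \<forall>h k. cinner (bop_apply C h) k = cinner (bop_apply B (V h)) (V k)" for B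
  proof -
    have "cmod (cinner (bop_apply B (V h)) (V k)) \<le> norm B * norm h * norm k" for h k
      using order_trans[OF cinner_cauchy_schwarz mult_right_mono[OF norm_bop_apply_le]]
      by (metis V_simps(3) norm_ge_zero)
    then show ?thesis
      by (intro bounded_sesquilinear_bop[where C = "norm B"])
        (simp_all add: V_simps bop_apply_add bop_apply_scaleC cinner_add_left cinner_add_right
          cinner_scaleC_left cinner_scaleC_right)
  qed
  then have "\<exists>C. \<forall>B h k. cinner (bop_apply (C B) h) k = cinner (bop_apply B (V h)) (V k)"
    by (rule choice[OF allI])
  then show thesis using that by blast
qed

text \<open>As \<open>B\<close> commutes with \<open>\<rho>\<close>, a factored matrix over the
  algebra is sent to a sum of Gram matrices for the semidefinite form of \<open>B\<close>;
  \<open>matrix_positive_bopI\<close> turns the resulting quadratic form back into a factorisation.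
  Invariance follows by pulling a unitary through \<open>B\<close> and absorbing it in
  \<open>V\<close> on the other side.\<close>

lemma weighted_UCP:
  assumes C: "\<And>B h k. cinner (bop_apply (C B) h) k = cinner (bop_apply B (V h)) (V k)"
    and B: "B \<in> M" "star B = B" and pos: "\<And>x. 0 \<le> Re (cinner (bop_apply B x) x)"
    and unit: "\<And>h k. cinner (bop_apply B (V h)) (V k) = cinner h k"
  shows "(\<lambda>a. C (B * \<rho> a)) \<in> UCP G \<tau>"
  unfolding UCP_def completely_positive_def
proof (intro CollectI conjI allI impI ballI)
  show "clinear (\<lambda>a. C (B * \<rho> a))"
    unfolding clinear_iff
    by (intro conjI allI bop_cinner_eqI)
      (simp_all add: C bop_simps rho_simps bop_apply_add bop_apply_scaleC cinner_add_left cinner_scaleC_left)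
  show "C (B * \<rho> 1) = 1"
    by (rule bop_cinner_eqI) (simp add: C rho_simps unit bop_simps)
  show "C (B * \<rho> (\<tau> g a)) = C (B * \<rho> a)" if g: "g \<in> carrier G" for g a
  proof (rule bop_cinner_eqI)
    fix h k
    have "cinner (bop_apply (B * \<rho> (\<tau> g a)) (V h)) (V k)
        = cinner (bop_apply (B * U g) (bop_apply (\<rho> a) (V h))) (V k)"
      by (simp add: bop_simps U_rho_V[OF g])
    also have "\<dots> = cinner (bop_apply (B * \<rho> a) (V h)) (V k)"
      unfolding commutantD(2)[OF B(1) g] by (simp add: bop_simps bop_cinner_star Ustar_V[OF g])
    finally show "cinner (bop_apply (C (B * \<rho> (\<tau> g a))) h) k = cinner (bop_apply (C (B * \<rho> a)) h) k"
      by (simp add: C)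
  qed
next
  fix n and a :: "nat \<Rightarrow> nat \<Rightarrow> 'a" assume "matrix_positive n a"
  then obtain c where c: "\<forall>i<n. \<forall>j<n. a i j = (\<Sum>k<n. star (c k i) * c k j)"
    unfolding matrix_positive_def ..
  have rho_sum: "\<rho> (\<Sum>k\<in>I. f k) = (\<Sum>k\<in>I. \<rho> (f k))" if "finite I" for I :: "nat set" and f
    using that by induction (use rho_simps(5)[of 0 0] in \<open>simp_all add: rho_simps\<close>)
  have form: "cinner (bop_apply (C (B * \<rho> (a i j))) h) h'
      = (\<Sum>k<n. cinner (bop_apply B (bop_apply (\<rho> (c k j)) (V h))) (bop_apply (\<rho> (c k i)) (V h')))"
    if "i < n" "j < n" for i j h h'
  proof -
    have "B * (star (\<rho> x) * \<rho> y) = star (\<rho> x) * (B * \<rho> y)" for x y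
      using commutantD(1)[OF B(1), of "star x"] by (simp add: rho_simps flip: mult.assoc)
    then have "B * \<rho> (a i j) = (\<Sum>k<n. star (\<rho> (c k i)) * (B * \<rho> (c k j)))"
      by (simp add: c[rule_format, OF that] rho_sum rho_simps sum_distrib_left)
    then show ?thesis
      by (simp add: C bop_sum_apply bop_simps cinner_sum_left bop_cinner_star')
  qed
  show "matrix_positive n (\<lambda>i j. C (B * \<rho> (a i j)))"
  proof (rule matrix_positive_bopI)
    show "star (C (B * \<rho> (a i j))) = C (B * \<rho> (a j i))" if "i < n" "j < n" for i j
    proof (rule bop_cinner_eqI)
      fix x y
      show "cinner (bop_apply (star (C (B * \<rho> (a i j)))) x) y = cinner (bop_apply (C (B * \<rho> (a j i))) x) y"
      proof -
        have sa: "cnj (cinner (bop_apply B u) v) = cinner (bop_apply B v) u" for u v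
          using cinner_selfadjoint_cnj[OF B(2), of v u] by simp
        have "cinner (bop_apply (star (C (B * \<rho> (a i j)))) x) y
            = cnj (cinner (bop_apply (C (B * \<rho> (a i j))) y) x)"
          unfolding bop_cinner_star' by (rule cinner_commute)
        also have "\<dots> = cinner (bop_apply (C (B * \<rho> (a j i))) x) y"
          using that by (simp add: form sa)
        finally show ?thesis .
      qed
    qed
    fix h :: "nat \<Rightarrow> 'h"
    have "(\<Sum>i<n. \<Sum>j<n. cinner (bop_apply (C (B * \<rho> (a i j))) (h j)) (h i))
        = (\<Sum>i<n. \<Sum>j<n. \<Sum>k<n. cinner (bop_apply B (bop_apply (\<rho> (c k j)) (V (h j)))) (bop_apply (\<rho> (c k i)) (V (h i))))"
      by (simp add: form)
    also have "\<dots> = (\<Sum>k<n. cinner (bop_apply B (\<Sum>j<n. bop_apply (\<rho> (c k j)) (V (h j))))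
        (\<Sum>j<n. bop_apply (\<rho> (c k j)) (V (h j))))"
      unfolding bop_apply_sum by (subst sum.swap) (rule sum_cinner_gram)
    finally show "0 \<le> Re (\<Sum>i<n. \<Sum>j<n. cinner (bop_apply (C (B * \<rho> (a i j))) (h j)) (h i))"
      using pos by (simp add: sum_nonneg)
  qed
qed

lemma extreme_imp_faithful:
  assumes extreme: "\<phi> extreme_point_of UCP G \<tau>"
    and T: "T \<in> M" "\<And>h k. cinner (bop_apply T (V h)) (V k) = 0"
  shows "T = 0"
proof -
  have sa: "A = 0" if A: "A \<in> M" "star A = A" "\<And>h k. cinner (bop_apply A (V h)) (V k) = 0" for A
  proof -
    obtain C where C: "\<And>B h k. cinner (bop_apply (C B) h) k = cinner (bop_apply B (V h)) (V k)"
      using compression by blast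
    \<comment> \<open>Small enough for \<open>1 + s A\<close> to have a nonnegative form for both
      signs of \<open>s\<close>, and well defined for \<open>A = 0\<close>.\<close>
    define r where "r = 1 / (norm A + 1)"
    have "0 < norm A + 1" using norm_ge_zero[of A] by linarith
    then have r: "0 < r" "r * norm A \<le> 1" by (simp_all add: r_def field_simps)
    have ucp: "(\<lambda>a. C ((1 + s *\<^sub>R A) * \<rho> a)) \<in> UCP G \<tau>" if s: "\<bar>s\<bar> = r" for s
    proof (rule weighted_UCP[OF C])
      show "1 + s *\<^sub>R A \<in> M" unfolding scaleR_eq_scaleC
        by (intro commutant_add commutant_one commutant_scaleC A)
      show "star (1 + s *\<^sub>R A) = 1 + s *\<^sub>R A" by (simp add: star_add star_scaleR A)
      show "cinner (bop_apply (1 + s *\<^sub>R A) (V h)) (V k) = cinner h k" for h k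
        by (simp add: bop_simps cinner_add_left cinner_scaleR_left A cinner_V)
      fix x
      have "\<bar>s * Re (cinner (bop_apply A x) x)\<bar> \<le> r * cmod (cinner (bop_apply A x) x)"
        unfolding abs_mult s using r(1) by (intro mult_left_mono abs_Re_le_cmod) simp
      also have "\<dots> \<le> r * (norm A * norm x * norm x)"
        using r(1) order_trans[OF cinner_cauchy_schwarz mult_right_mono[OF norm_bop_apply_le]]
        by (intro mult_left_mono) auto
      also have "\<dots> \<le> (norm x)\<^sup>2"
        using mult_right_mono[OF r(2), of "(norm x)\<^sup>2"] by (simp add: power2_eq_square mult_ac)
      finally show "0 \<le> Re (cinner (bop_apply (1 + s *\<^sub>R A) x) x)"
        by (simp add: bop_simps cinner_add_left cinner_scaleR_left cinner_self)
    qed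
    let ?p = "\<lambda>a. C ((1 + r *\<^sub>R A) * \<rho> a)" and ?m = "\<lambda>a. C ((1 + (- r) *\<^sub>R A) * \<rho> a)"
    have mid: "\<phi> = (1 - 1/2) *\<^sub>R ?p + (1/2) *\<^sub>R ?m"
    proof (rule ext, rule bop_cinner_eqI)
      fix a x y
      show "cinner (bop_apply (\<phi> a) x) y
          = cinner (bop_apply (((1 - 1/2) *\<^sub>R ?p + (1/2) *\<^sub>R ?m) a) x) y"
        by (simp add: phi_form C scaleR_fun_def bop_simps cinner_add_left cinner_diff_left
            cinner_scaleR_left scaleR_conv_of_real field_simps)
    qed
    have "?p = ?m"
    proof (rule ccontr)
      assume "?p \<noteq> ?m"
      then have "\<phi> \<in> open_segment ?p ?m"
        unfolding in_segment(2) using mid by (intro conjI exI[of _ "1/2"]) auto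
      then show False using extreme ucp[of r] ucp[of "- r"] r(1) unfolding extreme_point_of_def by auto
    qed
    then have "cinner (bop_apply (C ((1 + r *\<^sub>R A) * \<rho> a)) h) k = cinner (bop_apply (C ((1 + (- r) *\<^sub>R A) * \<rho> a)) h) k"
      for a h k by metis
    \<comment> \<open>Equality of the two halves removes the identity and leaves the compression of
      \<open>A * \<rho> a\<close>. Commutation then carries a second factor \<open>\<rho> b\<close>
      across, so that all matrix coefficients of \<open>A\<close> on a dense span vanish.\<close>
    then have 0: "cinner (bop_apply A (bop_apply (\<rho> a) (V h))) (V k) = 0" for a h k
      using r(1) by (simp add: C bop_simps cinner_add_left cinner_diff_left cinner_scaleR_left
          scaleR_conv_of_real)
    show "A = 0"
    proof (rule dense_bop_eqI[OF dense], clarify)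
      fix a h b k
      have "cinner (bop_apply A (bop_apply (\<rho> a) (V h))) (bop_apply (\<rho> b) (V k))
          = cinner (bop_apply (\<rho> (star b) * A) (bop_apply (\<rho> a) (V h))) (V k)"
        by (simp add: rho_simps bop_simps bop_cinner_star')
      also have "\<dots> = 0"
        unfolding commutantD(1)[OF A(1), symmetric] using 0[of "star b * a"] by (simp add: rho_simps bop_simps)
      finally show "cinner (bop_apply A (bop_apply (\<rho> a) (V h))) (bop_apply (\<rho> b) (V k))
          = cinner (bop_apply 0 (bop_apply (\<rho> a) (V h))) (bop_apply (\<rho> b) (V k))" by simp
    qed
  qed
  have T': "cinner (bop_apply (star T) (V h)) (V k) = 0" for h k
    using T(2)[of k h] by (metis bop_cinner_star' cinner_commute complex_cnj_zero)
  \<comment> \<open>The self-adjoint case is applied to twice the real part of \<open>T\<close>, and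
    below to a multiple of its imaginary part; \<open>T\<close> is then both equal and opposite to
    its adjoint.\<close>
  have "T + star T = 0"
    by (rule sa) (simp_all add: commutant_add commutant_star T T' star_add star_star add.commute
        bop_simps cinner_add_left)
  moreover have "\<i> *\<^sub>C (T + (- 1) *\<^sub>C star T) = 0"
  proof (rule sa)
    show "\<i> *\<^sub>C (T + (- 1) *\<^sub>C star T) \<in> M"
      by (intro commutant_add commutant_scaleC commutant_star T)
    show "star (\<i> *\<^sub>C (T + (- 1) *\<^sub>C star T)) = \<i> *\<^sub>C (T + (- 1) *\<^sub>C star T)"
      by (simp add: star_diff star_scaleC star_star complex_vector.scale_right_diff_distrib
          complex_vector.scale_minus_left)
  qed (simp add: bop_simps cinner_diff_left cinner_scaleC_left T T')
  then have "T + - star T = 0" by (metis complex_vector.scale_eq_0_iff complex_i_not_zero scaleC_minus1)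
  ultimately have "T + T = 0" by (metis add.right_inverse add_left_cancel eq_neg_iff_add_eq_0)
  then show "T = 0" by (metis scaleR_2 scaleR_eq_0_iff zero_neq_numeral)
qed

lemma faithful_imp_pure:
  assumes faithful: "\<And>T. T \<in> M \<Longrightarrow> (\<And>h k. cinner (bop_apply T (V h)) (V k) = 0) \<Longrightarrow> T = 0"
    and \<psi>: "\<psi> \<in> UCP G \<tau>" "t *\<^sub>R \<psi> \<in> cp_interval \<phi>"
  shows "t *\<^sub>R \<psi> = t *\<^sub>R \<phi>"
proof -
  have "(t *\<^sub>R \<psi>) (\<tau> g a) = (t *\<^sub>R \<psi>) a" if "g \<in> carrier G" for g a
    using \<psi>(1) that by (simp add: UCP_def scaleR_fun_def)
  then obtain T where T: "T \<in> M"
    "\<And>a h k. cinner (bop_apply T (bop_apply (\<rho> a) (V h))) (V k) = cinner (bop_apply ((t *\<^sub>R \<psi>) a) h) k"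
    using invariant_radon_nikodym[OF \<psi>(2)] by blast
  have "\<psi> 1 = 1" using \<psi>(1) by (simp add: UCP_def)
  then have TV: "cinner (bop_apply T (V h)) (V k) = t *\<^sub>R cinner h k" for h k
    using T(2)[of 1 h k] by (simp add: rho_simps bop_simps scaleR_fun_def cinner_scaleR_left)
  have "T + (- t) *\<^sub>R 1 = 0"
  proof (rule faithful)
    show "T + (- t) *\<^sub>R 1 \<in> M"
      unfolding scaleR_eq_scaleC by (intro commutant_add commutant_scaleC commutant_one T)
    show "cinner (bop_apply (T + (- t) *\<^sub>R 1) (V h)) (V k) = 0" for h k
      by (simp only: bop_simps cinner_add_left cinner_scaleR_left TV cinner_V) simp
  qed
  then have "T = t *\<^sub>R 1" by simp
  then show ?thesis
    by (intro ext bop_cinner_eqI)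
      (simp add: T(2)[symmetric], simp add: bop_simps scaleR_fun_def cinner_scaleR_left phi_form)
qed

text \<open>In a proper convex combination a weighted summand lies below \<open>\<phi>\<close>,
  since the difference is the other weighted summand and hence completely positive.\<close>

lemma pure_imp_extreme:
  assumes pure: "\<And>t \<psi>. 0 < t \<Longrightarrow> t < 1 \<Longrightarrow> \<psi> \<in> UCP G \<tau> \<Longrightarrow> t *\<^sub>R \<psi> \<in> cp_interval \<phi> \<Longrightarrow> t *\<^sub>R \<psi> = t *\<^sub>R \<phi>"
  shows "\<phi> extreme_point_of UCP G \<tau>"
  unfolding extreme_point_of_def
proof (intro conjI ballI notI)
  fix \<psi> \<omega> assume ucp: "\<psi> \<in> UCP G \<tau>" "\<omega> \<in> UCP G \<tau>" and "\<phi> \<in> open_segment \<psi> \<omega>"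
  then obtain u where ne: "\<psi> \<noteq> \<omega>" and u: "0 < u" "u < 1" "\<phi> = (1 - u) *\<^sub>R \<psi> + u *\<^sub>R \<omega>"
    unfolding in_segment(2) by blast
  have diff: "\<phi> - u *\<^sub>R \<omega> = (1 - u) *\<^sub>R \<psi>" using u(3) by simp
  have "u *\<^sub>R \<omega> \<in> cp_interval \<phi>"
    using diff ucp u(1,2) completely_positive_scaleR[of \<psi> "1 - u"] completely_positive_scaleR[of \<omega> u]
    by (simp add: cp_interval_def UCP_def)
  from pure[OF u(1,2) ucp(2) this] have "\<omega> = \<phi>" using u(1) by simp
  moreover from this have "(1 - u) *\<^sub>R \<psi> = (1 - u) *\<^sub>R \<phi>"
    using diff by (simp add: scaleR_left_diff_distrib)
  then have "\<psi> = \<phi>" using u(2) by simp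
  ultimately show False using ne by simp
qed (rule phi_UCP)

end

section \<open>Hilbert modules over the bounded operators\<close>

text \<open>The sublevel sets of the norm of \<open>f\<close> are closed, because the adjoint
  relation rewrites them as intersections of closed conditions on \<open>x\<close>. They cover the
  space, so by Baire one contains a ball; differences move the ball to the origin, where the bound
  doubles.\<close>

lemma hellinger_toeplitz:
  fixes f g :: "'k::complex_hilbert \<Rightarrow> 'k"
  assumes adj: "\<And>x y. cinner (f x) y = cinner x (g y)"
  obtains T where "bop_apply T = f"
proof -
  have adj': "cinner y (f x) = cinner (g y) x" for x y
    by (metis adj cinner_commute)
  have lin: "clinear f"
    unfolding clinear_iff
    by (intro conjI allI cinner_extI) (simp_all add: adj' cinner_add_right cinner_scaleC_right)
  have f_diff: "f (x - y) = f x - f y" for x y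
    by (rule cinner_extI) (simp add: adj' cinner_diff_right)
  have f_scale: "f (c *\<^sub>R x) = c *\<^sub>R f x" for c x
    by (rule cinner_extI) (simp add: adj' cinner_scaleR_right)
  define A where "A n = {x. norm (f x) \<le> real n}" for n :: nat
  have A_eq: "A n = (\<Inter>y. {x. cmod (cinner x (g y)) \<le> real n * norm y})" for n
  proof (intro subset_antisym subsetI)
    fix x assume x: "x \<in> A n"
    have "cmod (cinner x (g y)) \<le> real n * norm y" for y
      using order_trans[OF cinner_cauchy_schwarz[of "f x" y] mult_right_mono[of "norm (f x)" "real n" "norm y"]] x
      by (simp add: A_def adj)
    then show "x \<in> (\<Inter>y. {x. cmod (cinner x (g y)) \<le> real n * norm y})" by simp
  next
    fix x assume "x \<in> (\<Inter>y. {x. cmod (cinner x (g y)) \<le> real n * norm y})"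
    then have "cmod (cinner x (g (f x))) \<le> real n * norm (f x)" by blast
    then have "norm (f x) * norm (f x) \<le> real n * norm (f x)"
      by (simp add: cinner_self norm_mult power2_eq_square flip: adj)
    then have "norm (f x) \<le> real n" by (cases "f x = 0") simp_all
    then show "x \<in> A n" by (simp add: A_def)
  qed
  have closed: "closed (A n)" for n
    unfolding A_eq by (intro closed_INT ballI closed_Collect_le continuous_intros)
  have "\<exists>n. interior (A n) \<noteq> {}"
  proof (rule ccontr)
    assume "\<not> (\<exists>n. interior (A n) \<noteq> {})"
    then have "interior (\<Union>(range A)) = {}"
      using Met_TC.metric_Baire_category_alt[of "range A :: 'k set set"] closed complete_UNIV
      by auto
    moreover have "\<Union>(range A) = UNIV"
      using real_arch_simple by (auto simp: A_def)
    ultimately show False by simp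
  qed
  then obtain n x e where e: "0 < e" "ball x e \<subseteq> A n"
    by (metis all_not_in_conv mem_interior)
  have small: "norm (f z) \<le> 2 * real n" if "norm z < e" for z
  proof -
    have "x \<in> A n" "x - z \<in> A n" using e that by (auto simp: dist_norm)
    then have "norm (f x) \<le> real n" "norm (f (x - z)) \<le> real n" by (simp_all add: A_def)
    moreover have "f z = f x - f (x - z)" by (simp add: f_diff)
    ultimately show ?thesis using norm_triangle_ineq4[of "f x" "f (x - z)"] by simp
  qed
  have "norm (f z) \<le> (4 * real n / e) * norm z" for z
  proof (cases "z = 0")
    case True
    then show ?thesis using f_scale[of 0 0] by simp
  next
    case False
    \<comment> \<open>Scaling \<open>z\<close> to half the radius stays inside the open ball, whence
      the factor 4 in the final bound.\<close>
    define c where "c = e / (2 * norm z)"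
    have "norm (c *\<^sub>R z) < e" "0 < c" using e(1) False by (simp_all add: c_def)
    then have "c * norm (f z) \<le> 2 * real n" using small[of "c *\<^sub>R z"] by (simp add: f_scale)
    then show ?thesis using e(1) False by (simp add: c_def field_simps)
  qed
  then show thesis using bop_ex[OF lin] that by blast
qed

definition rank_one :: "'h \<Rightarrow> 'h \<Rightarrow> 'h::complex_hilbert bop"
  where "rank_one g h = (SOME T. \<forall>f. bop_apply T f = cinner f h *\<^sub>C g)"

lemma rank_one_apply: "bop_apply (rank_one g h) f = cinner f h *\<^sub>C g"
proof -
  have "clinear (\<lambda>f. cinner f h *\<^sub>C g)"
    by (simp add: clinear_iff cinner_add_left cinner_scaleC_left scaleC_add_left scaleC_scaleC)
  moreover have "norm (cinner f h *\<^sub>C g) \<le> (norm h * norm g) * norm f" for f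
    using mult_right_mono[OF cinner_cauchy_schwarz[of f h], of "norm g"]
    by (simp add: norm_scaleC_hilbert mult_ac)
  ultimately have "\<exists>T. bop_apply T = (\<lambda>f. cinner f h *\<^sub>C g)" by (rule bop_ex)
  then have "\<exists>T. \<forall>f. bop_apply T f = cinner f h *\<^sub>C g" by (simp add: fun_eq_iff)
  from someI_ex[OF this] show ?thesis unfolding rank_one_def by blast
qed

lemma rank_one_star: "bop_apply (star (rank_one g h)) f = cinner f g *\<^sub>C h"
  by (rule cinner_extI)
    (simp add: rank_one_apply cinner_scaleC_left cinner_scaleC_right flip: bop_cinner_star cinner_commute)

lemma norm_bop_le_form:
  assumes "0 \<le> c" "\<And>h k. cmod (cinner (bop_apply T h) k) \<le> c * norm h * norm k"
  shows "norm T \<le> c"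
proof (rule norm_bop_leI[OF assms(1)])
  fix h
  have "norm (bop_apply T h) * norm (bop_apply T h) \<le> (c * norm h) * norm (bop_apply T h)"
    using assms(2)[of h "bop_apply T h"] by (simp add: cinner_self norm_mult power2_eq_square)
  then show "norm (bop_apply T h) \<le> c * norm h"
    using assms(1) by (cases "bop_apply T h = 0") simp_all
qed

section \<open>Elementary rules for Hilbert modules and adjoints\<close>

context hilbert_module
begin

definition msub :: "'x \<Rightarrow> 'x \<Rightarrow> 'x"
  where "msub x y = madd X x (mscale X (- 1) y)"

lemmas closed_simps = zero_closed add_closed scale_closed act_closed

lemma msub_closed: "x \<in> carrier X \<Longrightarrow> y \<in> carrier X \<Longrightarrow> msub x y \<in> carrier X"
  by (simp add: msub_def closed_simps)

lemma ip_add_right: "\<lbrakk>x \<in> carrier X; y \<in> carrier X; z \<in> carrier X\<rbrakk> \<Longrightarrow>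
    mip X z (madd X x y) = mip X z x + mip X z y"
  using ip_star[of "madd X x y" z] by (simp add: add_closed ip_add_left star_add flip: ip_star)

lemma ip_scale_right: "\<lbrakk>x \<in> carrier X; y \<in> carrier X\<rbrakk> \<Longrightarrow> mip X x (mscale X c y) = cnj c *\<^sub>C mip X x y"
  using ip_star[of "mscale X c y" x] by (simp add: scale_closed ip_scale_left star_scaleC flip: ip_star)

lemma ip_act_right: "\<lbrakk>x \<in> carrier X; y \<in> carrier X\<rbrakk> \<Longrightarrow> mip X x (mact X y b) = star b * mip X x y"
  using ip_star[of "mact X y b" x] by (simp add: act_closed ip_act_left star_mult flip: ip_star)

lemma ip_zero_left: "x \<in> carrier X \<Longrightarrow> mip X (mzero X) x = 0"
  using ip_add_left[of "mzero X" "mzero X" x] by (simp add: zero_closed add_zero)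

lemma ip_zero_right: "x \<in> carrier X \<Longrightarrow> mip X x (mzero X) = 0"
  using ip_star[of "mzero X" x] by (simp add: zero_closed ip_zero_left)

lemmas ip_simps = ip_add_left ip_add_right ip_scale_left ip_scale_right ip_act_left ip_act_right
  ip_zero_left ip_zero_right

lemma ip_sub_left: "\<lbrakk>x \<in> carrier X; y \<in> carrier X; z \<in> carrier X\<rbrakk> \<Longrightarrow>
    mip X (msub x y) z = mip X x z - mip X y z"
  by (simp add: msub_def closed_simps ip_simps)

lemma ip_sub_right: "\<lbrakk>x \<in> carrier X; y \<in> carrier X; z \<in> carrier X\<rbrakk> \<Longrightarrow>
    mip X z (msub x y) = mip X z x - mip X z y"
  by (simp add: msub_def closed_simps ip_simps)

lemma msub_eq_zero:
  assumes "x \<in> carrier X" "y \<in> carrier X" "msub x y = mzero X"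
  shows "x = y"
proof -
  have "y = madd X (msub x y) y" using assms by (simp add: add_zero)
  also have "\<dots> = madd X (madd X y (mscale X (- 1) y)) x"
    using assms(1,2) unfolding msub_def by (metis add_assoc add_commute closed_simps(2,3))
  also have "\<dots> = x" using assms(1,2) by (simp add: add_neg add_zero)
  finally show ?thesis by simp
qed

lemma ip_eqI:
  assumes "x \<in> carrier X" "y \<in> carrier X" "\<And>z. z \<in> carrier X \<Longrightarrow> mip X x z = mip X y z"
  shows "x = y"
proof (rule msub_eq_zero[OF assms(1,2)])
  show "msub x y = mzero X"
    by (rule ip_definite) (simp_all add: assms msub_closed ip_sub_left)
qed

lemma is_madjoint_unique:
  assumes "is_madjoint X T S" "is_madjoint X T S'"
  shows "S = S'"
proof (rule extensionalityI[of S "carrier X"])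
  fix y assume y: "y \<in> carrier X"
  have "mip X x (S y) = mip X x (S' y)" if "x \<in> carrier X" for x
    using assms y that unfolding is_madjoint_def by metis
  moreover have "S y \<in> carrier X" "S' y \<in> carrier X"
    using assms y by (auto simp: is_madjoint_def)
  ultimately show "S y = S' y" by (intro ip_eqI) (metis ip_star)+
qed (use assms in \<open>auto simp: is_madjoint_def PiE_def\<close>)

lemma madjoint_eq: "is_madjoint X T S \<Longrightarrow> madjoint X T = S"
  unfolding madjoint_def using is_madjoint_unique by (intro the_equality) auto

lemma is_madjoint_madjoint: "T \<in> adjointable X \<Longrightarrow> is_madjoint X T (madjoint X T)"
  unfolding adjointable_def using madjoint_eq by auto

lemma adjointable_closed: "T \<in> adjointable X \<Longrightarrow> x \<in> carrier X \<Longrightarrow> T x \<in> carrier X"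
  by (auto simp: adjointable_def)

lemma madjoint_closed: "T \<in> adjointable X \<Longrightarrow> x \<in> carrier X \<Longrightarrow> madjoint X T x \<in> carrier X"
  using is_madjoint_madjoint[of T] by (auto simp: is_madjoint_def)

lemma madjoint_ip: "\<lbrakk>T \<in> adjointable X; x \<in> carrier X; y \<in> carrier X\<rbrakk> \<Longrightarrow>
    mip X (T x) y = mip X x (madjoint X T y)"
  using is_madjoint_madjoint[of T] by (auto simp: is_madjoint_def)

lemma madjoint_ip': "\<lbrakk>T \<in> adjointable X; x \<in> carrier X; y \<in> carrier X\<rbrakk> \<Longrightarrow>
    mip X x (T y) = mip X (madjoint X T x) y"
  using madjoint_ip[of T y x] ip_star[of "T y" x] ip_star[of y "madjoint X T x"]
  by (simp add: adjointable_closed madjoint_closed)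

text \<open>Module linearity is a consequence of having an adjoint: inner products against every
  element agree.\<close>

lemma adjointable_act: "\<lbrakk>T \<in> adjointable X; x \<in> carrier X\<rbrakk> \<Longrightarrow> T (mact X x b) = mact X (T x) b"
  by (rule ip_eqI) (simp_all add: adjointable_closed closed_simps madjoint_ip madjoint_closed ip_simps)

end

section \<open>Cauchy-Schwarz, metric and limits over the bounded operators\<close>

locale bop_hilbert_module = hilbert_module X
  for X :: "('x, 'h::complex_hilbert bop) hmodule"
begin

lemma ip_self_nonneg: "x \<in> carrier X \<Longrightarrow> 0 \<le> Re (cinner (bop_apply (mip X x x) h) h)"
  using ip_positive[of x] by (auto simp: cstar_positive_def bop_simps bop_cinner_star' cinner_self)

lemma mnorm_nonneg: "0 \<le> mnorm X x"
  by (simp add: mnorm_def)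

lemma ip_self_le:
  assumes "x \<in> carrier X"
  shows "Re (cinner (bop_apply (mip X x x) h) h) \<le> (mnorm X x)\<^sup>2 * (norm h)\<^sup>2"
proof -
  have "Re (cinner (bop_apply (mip X x x) h) h) \<le> norm (bop_apply (mip X x x) h) * norm h"
    using cinner_cauchy_schwarz complex_Re_le_cmod order_trans by blast
  also have "\<dots> \<le> (norm (mip X x x) * norm h) * norm h"
    by (intro mult_right_mono norm_bop_apply_le) simp
  finally show ?thesis by (simp add: mnorm_def power2_eq_square)
qed

text \<open>Writing the positive operator \<open>mip X x x\<close> as \<open>star b * b\<close>
  makes the module norm equal to the norm of \<open>b\<close>, which the quadratic form
  controls.\<close>

lemma mnorm_leI:
  assumes "x \<in> carrier X" "0 \<le> c" "\<And>h. Re (cinner (bop_apply (mip X x x) h) h) \<le> (c * norm h)\<^sup>2"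
  shows "mnorm X x \<le> c"
proof -
  obtain b where b: "mip X x x = star b * b"
    using ip_positive[OF assms(1)] by (auto simp: cstar_positive_def)
  have "norm b \<le> c"
  proof (rule norm_bop_leI[OF assms(2)])
    fix h
    have "(norm (bop_apply b h))\<^sup>2 \<le> (c * norm h)\<^sup>2"
      using assms(3)[of h] by (simp add: b bop_simps bop_cinner_star' cinner_self)
    then show "norm (bop_apply b h) \<le> c * norm h"
      by (rule power2_le_imp_le) (simp add: assms(2))
  qed
  then show ?thesis by (simp add: mnorm_def b norm_star_mult_self)
qed

text \<open>A rank one \<open>b\<close> with \<open>b k = h\<close> transfers the vector
  \<open>h\<close> to the module side: \<open>x b\<close> evaluated at \<open>k\<close> behaves like
  \<open>x\<close> at \<open>h\<close>. The scalar Cauchy-Schwarz inequality then applies along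
  \<open>y + z x b\<close>, everything being evaluated at \<open>k\<close>.\<close>

lemma ip_form_le:
  assumes x: "x \<in> carrier X" and y: "y \<in> carrier X"
  shows "cmod (cinner (bop_apply (mip X x y) h) k) \<le> mnorm X x * mnorm X y * norm h * norm k"
proof (cases "k = 0")
  case False
  define b where "b = rank_one ((1 / (norm k)\<^sup>2) *\<^sub>R h) k"
  have bk: "bop_apply b k = h"
    using False by (simp add: b_def rank_one_apply cinner_self scaleR_eq_scaleC scaleC_scaleC scaleC_one)
  have "(cmod (cinner (bop_apply (mip X x y) h) k))\<^sup>2
      \<le> Re (cinner (bop_apply (mip X y y) k) k) * Re (cinner (bop_apply (mip X x x) h) h)"
  proof (rule semidefinite_cauchy_schwarz[OF ip_self_nonneg[OF x]])
    fix z
    let ?w = "madd X y (mscale X z (mact X x b))"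
    have w: "?w \<in> carrier X" by (intro closed_simps x y)
    have "mip X ?w ?w = mip X y y + (z *\<^sub>C (mip X x y * b) + cnj z *\<^sub>C (star b * mip X y x))
        + (z * cnj z) *\<^sub>C (star b * (mip X x x * b))"
      by (simp add: closed_simps x y ip_simps scaleC_scaleC scaleC_add_right scaleC_mult_left
          scaleC_mult_right algebra_simps)
    then have "cinner (bop_apply (mip X ?w ?w) k) k = cinner (bop_apply (mip X y y) k) k
        + (z * cinner (bop_apply (mip X x y) h) k + cnj z * cinner (bop_apply (mip X y x) k) h)
        + z * cnj z * cinner (bop_apply (mip X x x) h) h"
      by (simp add: bop_simps bk cinner_add_left cinner_scaleC_left bop_cinner_star')
    moreover have "cinner (bop_apply (mip X y x) k) h = cnj (cinner (bop_apply (mip X x y) h) k)"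
      unfolding ip_star[OF x y] bop_cinner_star' by (rule cinner_commute)
    ultimately have "cinner (bop_apply (mip X ?w ?w) k) k = cinner (bop_apply (mip X y y) k) k
        + (z * cinner (bop_apply (mip X x y) h) k + cnj (z * cinner (bop_apply (mip X x y) h) k))
        + z * cnj z * cinner (bop_apply (mip X x x) h) h" by simp
    then show "0 \<le> Re (cinner (bop_apply (mip X y y) k) k) + 2 * Re (z * cinner (bop_apply (mip X x y) h) k)
        + (cmod z)\<^sup>2 * Re (cinner (bop_apply (mip X x x) h) h)"
      using ip_self_nonneg[OF w, of k] by (simp only: Re_quadratic)
  qed
  also have "\<dots> \<le> ((mnorm X y)\<^sup>2 * (norm k)\<^sup>2) * ((mnorm X x)\<^sup>2 * (norm h)\<^sup>2)"
    by (intro mult_mono ip_self_le ip_self_nonneg x y) simp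
  also have "\<dots> = (mnorm X x * mnorm X y * norm h * norm k)\<^sup>2"
    by (simp add: power_mult_distrib mult_ac)
  finally show ?thesis by (rule power2_le_imp_le) (simp add: mnorm_nonneg)
qed simp

lemma norm_ip_le: "x \<in> carrier X \<Longrightarrow> y \<in> carrier X \<Longrightarrow> norm (mip X x y) \<le> mnorm X x * mnorm X y"
  by (rule norm_bop_le_form) (simp_all add: mnorm_nonneg ip_form_le)

lemma mnorm_triangle:
  assumes x: "x \<in> carrier X" and y: "y \<in> carrier X"
  shows "mnorm X (madd X x y) \<le> mnorm X x + mnorm X y"
proof (rule mnorm_leI[OF add_closed[OF x y]])
  fix h
  have "Re (cinner (bop_apply (mip X (madd X x y) (madd X x y)) h) h)
      = Re (cinner (bop_apply (mip X x x) h) h) + Re (cinner (bop_apply (mip X x y) h) h)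
      + Re (cinner (bop_apply (mip X y x) h) h) + Re (cinner (bop_apply (mip X y y) h) h)"
    by (simp add: closed_simps x y ip_simps bop_simps cinner_add_left)
  also have "\<dots> \<le> (mnorm X x)\<^sup>2 * (norm h)\<^sup>2 + mnorm X x * mnorm X y * norm h * norm h
      + mnorm X y * mnorm X x * norm h * norm h + (mnorm X y)\<^sup>2 * (norm h)\<^sup>2"
    by (intro add_mono ip_self_le order_trans[OF complex_Re_le_cmod ip_form_le] x y)
  also have "\<dots> = ((mnorm X x + mnorm X y) * norm h)\<^sup>2"
    by (simp add: power2_eq_square algebra_simps)
  finally show "Re (cinner (bop_apply (mip X (madd X x y) (madd X x y)) h) h)
      \<le> ((mnorm X x + mnorm X y) * norm h)\<^sup>2" .
qed (simp add: mnorm_nonneg)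

sublocale Metric_space "carrier X" "mmetric X"
proof
  fix x y z
  show "0 \<le> mmetric X x y" by (simp add: mmetric_def mnorm_nonneg)
  show "mmetric X x y = mmetric X y x"
    by (auto simp: mmetric_def mnorm_def ip_sub_left ip_sub_right msub_closed simp flip: msub_def)
      (simp add: algebra_simps)
  assume x: "x \<in> carrier X" and y: "y \<in> carrier X"
  show "mmetric X x y = 0 \<longleftrightarrow> x = y"
  proof
    assume "mmetric X x y = 0"
    then have "mip X (msub x y) (msub x y) = 0" using x y by (simp add: mmetric_def mnorm_def msub_def)
    then show "x = y" by (rule msub_eq_zero[OF x y ip_definite[OF msub_closed[OF x y]]])
  next
    assume "x = y"
    then show "mmetric X x y = 0"
      using x by (simp add: mmetric_def mnorm_def add_neg ip_zero_left zero_closed)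
  qed
  assume z: "z \<in> carrier X"
  have "msub x z = madd X (msub x y) (msub y z)"
    by (rule ip_eqI) (simp_all add: x y z msub_closed closed_simps ip_simps ip_sub_left)
  then show "mmetric X x z \<le> mmetric X x y + mmetric X y z"
    using mnorm_triangle[OF msub_closed[OF x y] msub_closed[OF y z]]
    by (simp add: mmetric_def x y z msub_def)
qed

lemma cauchy_limit:
  assumes f: "\<And>n. f n \<in> carrier X"
    and cauchy: "\<And>e. 0 < e \<Longrightarrow> \<exists>N. \<forall>m\<ge>N. \<forall>n\<ge>N. mnorm X (msub (f m) (f n)) < e"
  obtains x where "x \<in> carrier X" "(\<lambda>n. mnorm X (msub (f n) x)) \<longlonglongrightarrow> 0"
proof -
  have "MCauchy f"
    unfolding MCauchy_def using f cauchy by (auto simp: mmetric_def msub_def)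
  then obtain x where "limitin mtopology f x sequentially"
    using complete unfolding mcomplete_def by blast
  then have x: "x \<in> carrier X" "\<And>e. 0 < e \<Longrightarrow> \<exists>N. \<forall>n\<ge>N. mmetric X (f n) x < e"
    unfolding limit_metric_sequentially by blast+
  have "(\<lambda>n. mnorm X (msub (f n) x)) \<longlonglongrightarrow> 0"
    by (rule metric_LIMSEQ_I) (use x f in \<open>auto simp: mmetric_def msub_def mnorm_nonneg\<close>)
  then show thesis using x(1) that by blast
qed

lemma dense_approx:
  assumes "mtopology closure_of S = carrier X" "x \<in> carrier X"
  obtains f where "\<And>n. f n \<in> S" "\<And>n. f n \<in> carrier X" "(\<lambda>n. mnorm X (msub (f n) x)) \<longlonglongrightarrow> 0"
proof -
  have "x \<in> mtopology closure_of S" using assms by simp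
  then have "\<forall>r>0. \<exists>y\<in>S. y \<in> mball x r" unfolding metric_closure_of by blast
  then have "\<exists>y\<in>S. y \<in> mball x (1 / Suc n)" for n using assms(2) by simp
  then obtain f where f: "\<And>n. f n \<in> S" "\<And>n. f n \<in> mball x (1 / Suc n)" by metis
  then have c: "f n \<in> carrier X" and "mmetric X (f n) x < 1 / Suc n" for n
    by (simp_all add: commute)
  then have "mnorm X (msub (f n) x) \<le> 1 / Suc n" for n
    using assms(2) by (simp add: mmetric_def msub_def less_imp_le)
  then have "(\<lambda>n. mnorm X (msub (f n) x)) \<longlonglongrightarrow> 0"
    by (intro tendsto_sandwich[OF _ _ tendsto_const LIMSEQ_inverse_real_of_nat])
      (auto simp: mnorm_nonneg inverse_eq_divide)
  then show thesis using f(1) c that by blast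
qed

lemma tendsto_ip_left:
  assumes "\<And>n. f n \<in> carrier X" "x \<in> carrier X" "y \<in> carrier X"
    "(\<lambda>n. mnorm X (msub (f n) x)) \<longlonglongrightarrow> 0"
  shows "(\<lambda>n. mip X (f n) y) \<longlonglongrightarrow> mip X x y"
proof (rule Lim_null_comparison[THEN LIM_zero_cancel])
  show "\<forall>\<^sub>F n in sequentially. norm (mip X (f n) y - mip X x y) \<le> mnorm X (msub (f n) x) * mnorm X y"
    using norm_ip_le[OF msub_closed assms(3)] assms(1-3) by (simp add: ip_sub_left)
  show "(\<lambda>n. mnorm X (msub (f n) x) * mnorm X y) \<longlonglongrightarrow> 0"
    using tendsto_mult_left_zero[OF assms(4)] by simp
qed

lemma tendsto_ip_right:
  assumes "\<And>n. f n \<in> carrier X" "x \<in> carrier X" "y \<in> carrier X"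
    "(\<lambda>n. mnorm X (msub (f n) x)) \<longlonglongrightarrow> 0"
  shows "(\<lambda>n. mip X y (f n)) \<longlonglongrightarrow> mip X y x"
  using bounded_linear.tendsto[OF bounded_linear_star tendsto_ip_left[OF assms]] assms
  by (simp flip: ip_star)

end

section \<open>The dual of the Paschke module\<close>

lemma norm_rank_one_le: "norm (rank_one g h) \<le> norm g * norm h"
proof (rule norm_bop_leI)
  fix f
  show "norm (bop_apply (rank_one g h) f) \<le> norm g * norm h * norm f"
    using mult_right_mono[OF cinner_cauchy_schwarz[of f h], of "norm g"]
    by (simp add: rank_one_apply norm_scaleC_hilbert mult_ac)
qed simp

lemma tendsto_scaleC_left:
  assumes "(f \<longlongrightarrow> c) F"
  shows "((\<lambda>n. f n *\<^sub>C T) \<longlongrightarrow> c *\<^sub>C (T :: 'a::cstar_algebra)) F"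
proof -
  have "bounded_linear (\<lambda>c. c *\<^sub>C T)"
    by (rule bounded_linear_intro[of _ "norm T"])
      (simp_all add: scaleC_add_left scaleR_eq_scaleC scaleC_scaleC scaleR_conv_of_real norm_scaleC)
  from bounded_linear.tendsto[OF this assms] show ?thesis .
qed

text \<open>The unit vector is a parameter since it exists only for nonzero \<open>H\<close>; the
  theorem settles the zero space separately.\<close>

locale covariant_paschke = covariant_stinespring G \<tau> \<phi> \<rho> V U
  for G :: "('g, 'm) monoid_scheme"
    and \<tau> :: "'g \<Rightarrow> 'a::cstar_algebra \<Rightarrow> 'a"
    and \<phi> :: "'a \<Rightarrow> 'h::complex_hilbert bop"
    and \<rho> :: "'a \<Rightarrow> 'k::complex_hilbert bop"
    and V :: "'h \<Rightarrow> 'k"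
    and U :: "'g \<Rightarrow> 'k bop" +
  fixes X :: "('x, 'h bop) hmodule"
    and \<sigma> :: "'a \<Rightarrow> 'x \<Rightarrow> 'x"
    and e :: 'x
    and W :: "'g \<Rightarrow> 'x \<Rightarrow> 'x"
    and ip' :: "('x \<Rightarrow> 'h bop) \<Rightarrow> ('x \<Rightarrow> 'h bop) \<Rightarrow> 'h bop"
    and \<sigma>' :: "'a \<Rightarrow> ('x \<Rightarrow> 'h bop) \<Rightarrow> ('x \<Rightarrow> 'h bop)"
    and W' :: "'g \<Rightarrow> ('x \<Rightarrow> 'h bop) \<Rightarrow> ('x \<Rightarrow> 'h bop)"
    and h0 :: 'h
  assumes paschke: "paschke_dilation \<phi> X \<sigma> e"
    and paschke_unitaries: "paschke_unitary_rep G \<tau> X \<sigma> e W"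
    and dual: "dual_inner_product X ip'"
    and sigma_ext: "dual_extension X ip' (\<sigma> a) (\<sigma>' a)"
    and W_ext: "g \<in> carrier G \<Longrightarrow> dual_extension X ip' (W g) (W' g)"
    and norm_h0: "norm h0 = 1"
begin

abbreviation "D \<equiv> dual_module X ip'"

sublocale Mod: bop_hilbert_module X
  using paschke by (simp add: paschke_dilation_def bop_hilbert_module_def)

sublocale Dual: bop_hilbert_module D
  using dual by (simp add: dual_inner_product_def self_dual_def bop_hilbert_module_def)

lemma dual_sel:
  "carrier D = bounded_module_maps X" "mip D = ip'" "mzero D = (\<lambda>x\<in>carrier X. 0)"
  "mact D \<eta> b = (\<lambda>x\<in>carrier X. star b * \<eta> x)"
  by (simp_all add: dual_module_def)

lemma h0_h0: "cinner h0 h0 = 1"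
  by (simp add: cinner_self norm_h0)

lemma e_closed: "e \<in> carrier X"
  using paschke by (simp add: paschke_dilation_def)

lemma sigma_adj: "\<sigma> a \<in> adjointable X"
  and sigma_mult: "x \<in> carrier X \<Longrightarrow> \<sigma> (a * b) x = \<sigma> a (\<sigma> b x)"
  and sigma_star: "\<sigma> (star a) = madjoint X (\<sigma> a)"
  using paschke by (simp_all add: paschke_dilation_def module_star_rep_def)

lemma sigma_closed: "x \<in> carrier X \<Longrightarrow> \<sigma> a x \<in> carrier X"
  by (rule Mod.adjointable_closed[OF sigma_adj])

lemma phi_ip: "mip X (\<sigma> a e) e = \<phi> a"
  using paschke by (simp add: paschke_dilation_def)

lemma sigma_e_ip: "mip X (\<sigma> a e) (\<sigma> b e) = \<phi> (star b * a)"
  using phi_ip[of "star b * a"]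
  by (simp add: Mod.madjoint_ip'[OF sigma_adj] sigma_closed e_closed sigma_mult flip: sigma_star)

lemma W_adj: "g \<in> carrier G \<Longrightarrow> W g \<in> adjointable X"
  and W_inv: "g \<in> carrier G \<Longrightarrow> x \<in> carrier X \<Longrightarrow> madjoint X (W g) (W g x) = x"
  and W_e: "g \<in> carrier G \<Longrightarrow> W g e = e"
  and W_sigma: "g \<in> carrier G \<Longrightarrow> x \<in> carrier X \<Longrightarrow> W g (\<sigma> a (madjoint X (W g) x)) = \<sigma> (\<tau> g a) x"
  using paschke_unitaries by (simp_all add: paschke_unitary_rep_def module_unitary_rep_def)

lemma W_adj_sigma_e:
  assumes g: "g \<in> carrier G"
  shows "madjoint X (W g) (\<sigma> (\<tau> g a) e) = \<sigma> a e"
proof -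
  have "madjoint X (W g) e = e" using W_inv[OF g e_closed] by (simp add: W_e[OF g])
  then have "W g (\<sigma> a e) = \<sigma> (\<tau> g a) e" using W_sigma[OF g e_closed, of a] by simp
  then show ?thesis using W_inv[OF g sigma_closed[OF e_closed], of a] by simp
qed

lemma bmm:
  assumes "\<eta> \<in> bounded_module_maps X"
  shows "x \<in> carrier X \<Longrightarrow> y \<in> carrier X \<Longrightarrow> \<eta> (madd X x y) = \<eta> x + \<eta> y"
    and "x \<in> carrier X \<Longrightarrow> \<eta> (mscale X c x) = c *\<^sub>C \<eta> x"
    and "x \<in> carrier X \<Longrightarrow> \<eta> (mact X x b) = \<eta> x * b"
    and "\<eta> \<in> extensional (carrier X)"
  using assms by (simp_all add: bounded_module_maps_def)

lemma bmm_zero: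
  assumes "\<eta> \<in> bounded_module_maps X"
  shows "\<eta> (mzero X) = 0"
  using bmm(1)[OF assms Mod.zero_closed Mod.zero_closed] by (simp add: Mod.add_zero Mod.zero_closed)

lemma bmm_bound:
  assumes "\<eta> \<in> bounded_module_maps X"
  obtains C where "0 \<le> C" "\<And>x. x \<in> carrier X \<Longrightarrow> norm (\<eta> x) \<le> C * mnorm X x"
proof -
  obtain C where C: "\<forall>x\<in>carrier X. norm (\<eta> x) \<le> C * mnorm X x"
    using assms by (auto simp: bounded_module_maps_def)
  have "norm (\<eta> x) \<le> \<bar>C\<bar> * mnorm X x" if "x \<in> carrier X" for x
    using C[rule_format, OF that] mult_right_mono[OF abs_ge_self[of C] Mod.mnorm_nonneg[of x]] by simp
  then show thesis using that[of "\<bar>C\<bar>"] by simp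
qed

lemma bmm_eqI:
  assumes \<eta>: "\<eta> \<in> bounded_module_maps X" and \<zeta>: "\<zeta> \<in> bounded_module_maps X"
    and eq: "\<And>a b. \<eta> (\<sigma> a (mact X e b)) = \<zeta> (\<sigma> a (mact X e b))"
  shows "\<eta> = \<zeta>"
proof (rule extensionalityI[OF bmm(4)[OF \<eta>] bmm(4)[OF \<zeta>]])
  fix x assume x: "x \<in> carrier X"
  let ?S = "mspan X {\<sigma> a (mact X e b) | a b. True}"
  have span: "y \<in> carrier X \<and> \<eta> y = \<zeta> y" if "y \<in> ?S" for y
    using that
  proof induction
    case mspan_zero
    then show ?case by (simp add: Mod.zero_closed bmm_zero \<eta> \<zeta>)
  next
    case (mspan_base y)
    then show ?case by (auto simp: eq sigma_closed Mod.act_closed e_closed)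
  next
    case (mspan_add y z)
    then show ?case by (simp add: Mod.add_closed bmm(1) \<eta> \<zeta>)
  next
    case (mspan_scale y c)
    then show ?case by (simp add: Mod.scale_closed bmm(2) \<eta> \<zeta>)
  qed
  have cl: "Mod.mtopology closure_of ?S = carrier X"
    using paschke by (simp add: paschke_dilation_def)
  obtain f where f: "\<And>n. f n \<in> ?S" "\<And>n. f n \<in> carrier X"
    "(\<lambda>n. mnorm X (Mod.msub (f n) x)) \<longlonglongrightarrow> 0"
    using Mod.dense_approx[OF cl x] by blast
  have lim: "(\<lambda>n. \<xi> (f n)) \<longlonglongrightarrow> \<xi> x" if \<xi>: "\<xi> \<in> bounded_module_maps X" for \<xi>
  proof -
    obtain C where C: "\<And>y. y \<in> carrier X \<Longrightarrow> norm (\<xi> y) \<le> C * mnorm X y"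
      using bmm_bound[OF \<xi>] by blast
    have le: "norm (\<xi> (f n) - \<xi> x) \<le> C * mnorm X (Mod.msub (f n) x)" for n
      using C[OF Mod.msub_closed[OF f(2) x], of n]
      by (simp add: Mod.msub_def bmm(1,2)[OF \<xi>] f(2) x Mod.scale_closed)
    show ?thesis
      by (rule LIM_zero_cancel[OF Lim_null_comparison[OF always_eventually[OF allI[OF le]]]])
        (rule tendsto_mult_right_zero[OF f(3)])
  qed
  have "(\<lambda>n. \<eta> (f n)) \<longlonglongrightarrow> \<zeta> x" using lim[OF \<zeta>] span[OF f(1)] by simp
  then show "\<eta> x = \<zeta> x" using lim[OF \<eta>] LIMSEQ_unique by blast
qed

lemma hat_closed: "x \<in> carrier X \<Longrightarrow> hat X x \<in> bounded_module_maps X"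
  unfolding bounded_module_maps_def hat_def
  by (auto simp: Mod.closed_simps Mod.ip_simps intro!: exI[of _ "mnorm X x"])
    (metis Mod.norm_ip_le mult.commute)

lemma hat_apply: "y \<in> carrier X \<Longrightarrow> hat X x y = mip X y x"
  by (simp add: hat_def)

lemma ip'_hat: "x \<in> carrier X \<Longrightarrow> y \<in> carrier X \<Longrightarrow> ip' (hat X x) (hat X y) = mip X x y"
  and ip'_hat_left: "x \<in> carrier X \<Longrightarrow> \<eta> \<in> bounded_module_maps X \<Longrightarrow> ip' (hat X x) \<eta> = \<eta> x"
  using dual by (simp_all add: dual_inner_product_def)

text \<open>An extension is prescribed only on the image of \<open>X\<close>. Pairing with
  \<open>hat X x\<close> is evaluation at \<open>x\<close>, and the adjoint of the extension sends
  this element to the hat of the adjoint vector, which fixes the extension on all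
  functionals.\<close>

lemma dual_extension_apply:
  assumes T: "T \<in> adjointable X" and T': "dual_extension X ip' T T'"
    and \<eta>: "\<eta> \<in> bounded_module_maps X" and x: "x \<in> carrier X"
  shows "T' \<eta> x = \<eta> (madjoint X T x)"
proof -
  have adj: "T' \<in> adjointable D" and hat: "\<And>y. y \<in> carrier X \<Longrightarrow> T' (hat X y) = hat X (T y)"
    using T' by (simp_all add: dual_extension_def)
  note cl = Dual.adjointable_closed[OF adj, unfolded dual_sel] Dual.madjoint_closed[OF adj, unfolded dual_sel]
  have Tx: "madjoint X T x \<in> carrier X" by (rule Mod.madjoint_closed[OF T x])
  have "madjoint D T' (hat X x) = hat X (madjoint X T x)"
  proof (rule extensionalityI)
    fix y assume y: "y \<in> carrier X"
    have "madjoint D T' (hat X x) y = ip' (hat X y) (madjoint D T' (hat X x))"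
      by (simp add: ip'_hat_left y cl hat_closed x)
    also have "\<dots> = ip' (T' (hat X y)) (hat X x)"
      using Dual.madjoint_ip[OF adj, of "hat X y" "hat X x"] by (simp add: dual_sel hat_closed x y)
    also have "\<dots> = mip X y (madjoint X T x)"
      by (simp add: hat y x ip'_hat Mod.adjointable_closed[OF T] Mod.madjoint_ip[OF T])
    finally show "madjoint D T' (hat X x) y = hat X (madjoint X T x) y" by (simp add: hat_apply y)
  qed (auto intro!: bmm(4) hat_closed Tx cl x)
  then have "ip' (hat X x) (T' \<eta>) = ip' (hat X (madjoint X T x)) \<eta>"
    using Dual.madjoint_ip'[OF adj, of "hat X x" \<eta>] by (simp add: dual_sel hat_closed x \<eta>)
  then show ?thesis by (simp add: ip'_hat_left x \<eta> cl Tx)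
qed

section \<open>The copy of \<open>K\<close> inside the module\<close>

definition tensor_elem :: "('a \<times> 'h) list \<Rightarrow> 'x"
  where "tensor_elem xs =
    foldr (\<lambda>p. madd X (\<sigma> (fst p) (mact X e (rank_one (snd p) h0)))) xs (mzero X)"

lemma gen_closed: "\<sigma> a (mact X e b) \<in> carrier X"
  by (intro sigma_closed Mod.act_closed e_closed)

lemma gen_eq: "\<sigma> a (mact X e b) = mact X (\<sigma> a e) b"
  by (rule Mod.adjointable_act[OF sigma_adj e_closed])

lemma tensor_elem_simps:
  "tensor_elem [] = mzero X"
  "tensor_elem (p # xs) = madd X (\<sigma> (fst p) (mact X e (rank_one (snd p) h0))) (tensor_elem xs)"
  by (simp_all add: tensor_elem_def)

lemma tensor_elem_closed: "tensor_elem xs \<in> carrier X"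
  by (induction xs) (simp_all add: tensor_elem_simps Mod.closed_simps gen_closed)

lemma gen_ip:
  "mip X (\<sigma> a (mact X e (rank_one h h0))) (\<sigma> b (mact X e (rank_one k h0)))
    = cinner (bop_apply (\<rho> a) (V h)) (bop_apply (\<rho> b) (V k)) *\<^sub>C rank_one h0 h0"
  by (rule bop_eqI)
    (simp add: gen_eq Mod.ip_simps Mod.closed_simps sigma_closed e_closed sigma_e_ip bop_simps
      rank_one_apply rank_one_star bop_apply_scaleC cinner_scaleC_left scaleC_scaleC phi_form
      rho_simps bop_cinner_star' mult.commute)

text \<open>The rank one coefficients compress each value of \<open>\<phi>\<close> to a scalar
  multiple of the projection onto \<open>h0\<close>. Hence tensors have the same inner products in
  the module as in \<open>K\<close>, up to this fixed projection.\<close>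

lemma tensor_elem_ip:
  "mip X (tensor_elem xs) (tensor_elem ys) = cinner (tensor_vec xs) (tensor_vec ys) *\<^sub>C rank_one h0 h0"
proof -
  have "mip X (\<sigma> a (mact X e (rank_one h h0))) (tensor_elem ys)
      = cinner (bop_apply (\<rho> a) (V h)) (tensor_vec ys) *\<^sub>C rank_one h0 h0" for a h
    by (induction ys)
      (simp_all add: tensor_elem_simps tensor_elem_closed Mod.closed_simps gen_closed Mod.ip_simps gen_ip
        tensor_vec_def cinner_add_right scaleC_add_left complex_vector.scale_zero_left)
  then show ?thesis
    by (induction xs)
      (simp_all add: tensor_elem_simps tensor_elem_closed Mod.closed_simps gen_closed Mod.ip_simps
        tensor_vec_def cinner_add_left scaleC_add_left complex_vector.scale_zero_left)
qed

lemma mnorm_le_of_ip: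
  assumes "mip X x x = cinner k k *\<^sub>C rank_one h0 h0"
  shows "mnorm X x \<le> norm k"
proof -
  have "norm (mip X x x) \<le> (norm k)\<^sup>2"
    using mult_left_mono[OF norm_rank_one_le[of h0 h0], of "(norm k)\<^sup>2"]
    by (simp add: assms norm_scaleC cinner_self norm_h0 norm_power)
  then show ?thesis unfolding mnorm_def by (rule real_le_lsqrt[rotated]) simp
qed

lemma tensor_vec_dense: "closure (range tensor_vec) = UNIV"
proof -
  have "csubspace (range tensor_vec)"
    unfolding complex_vector.subspace_def
    by (auto intro: range_eqI[of _ _ "[]"] simp: tensor_vec_simps(1) simp flip: tensor_vec_simps(2) tensor_vec_scale)
  then have "cspan {bop_apply (\<rho> a) (V h) | a h. True} \<subseteq> range tensor_vec"
    by (intro complex_vector.span_minimal) (auto simp flip: tensor_vec_simps(3))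
  then show ?thesis using closure_mono dense by blast
qed

text \<open>
  The Hilbert space \<open>K\<close> sits inside the module as \<open>X p\<close>, where \<open>p\<close> is the projection onto \<open>h0\<close>:
  \<open>K_embed\<close> extends \<open>\<rho>(a) V h \<mapsto> \<sigma>(a) e (h \<otimes> h0\<^sup>*)\<close>.
\<close>

definition K_embed :: "'k \<Rightarrow> 'x"
  where "K_embed k = (SOME x. x \<in> carrier X \<and> (\<exists>f. (\<lambda>n. tensor_vec (f n)) \<longlonglongrightarrow> k \<and>
    (\<lambda>n. mnorm X (Mod.msub (tensor_elem (f n)) x)) \<longlonglongrightarrow> 0))"

lemma K_embed_spec:
  "K_embed k \<in> carrier X \<and> (\<exists>f. (\<lambda>n. tensor_vec (f n)) \<longlonglongrightarrow> k \<and>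
    (\<lambda>n. mnorm X (Mod.msub (tensor_elem (f n)) (K_embed k))) \<longlonglongrightarrow> 0)"
  unfolding K_embed_def
proof (rule someI_ex)
  have "k \<in> closure (range tensor_vec)" by (simp add: tensor_vec_dense)
  then obtain g where g: "\<forall>n. g n \<in> range tensor_vec" "g \<longlonglongrightarrow> k"
    unfolding closure_sequential by blast
  define f where "f n = (SOME xs. g n = tensor_vec xs)" for n
  have "g = (\<lambda>n. tensor_vec (f n))"
    unfolding f_def by (rule HOL.ext, rule someI_ex) (use g(1) in blast)
  then have f: "(\<lambda>n. tensor_vec (f n)) \<longlonglongrightarrow> k" using g(2) by simp
  \<comment> \<open>With this estimate a Cauchy sequence of tensors in \<open>K\<close> is Cauchy in
    the module, whose completeness supplies the limit.\<close>
  have le: "mnorm X (Mod.msub (tensor_elem xs) (tensor_elem ys)) \<le> norm (tensor_vec xs - tensor_vec ys)" for xs ys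
    by (rule mnorm_le_of_ip)
      (simp add: Mod.ip_sub_left Mod.ip_sub_right Mod.msub_closed tensor_elem_closed tensor_elem_ip
        cinner_diff_left cinner_diff_right complex_vector.scale_left_diff_distrib)
  have "\<exists>N. \<forall>m\<ge>N. \<forall>n\<ge>N. mnorm X (Mod.msub (tensor_elem (f m)) (tensor_elem (f n))) < d" if "0 < d" for d
    using LIMSEQ_imp_Cauchy[OF f] that le unfolding Cauchy_def dist_norm by (meson le_less_trans)
  then obtain x where "x \<in> carrier X" "(\<lambda>n. mnorm X (Mod.msub (tensor_elem (f n)) x)) \<longlonglongrightarrow> 0"
    using Mod.cauchy_limit[of "\<lambda>n. tensor_elem (f n)"] tensor_elem_closed by blast
  then show "\<exists>x. x \<in> carrier X \<and> (\<exists>f. (\<lambda>n. tensor_vec (f n)) \<longlonglongrightarrow> k \<and>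
    (\<lambda>n. mnorm X (Mod.msub (tensor_elem (f n)) x)) \<longlonglongrightarrow> 0)" using f by blast
qed

lemma K_embed_closed: "K_embed k \<in> carrier X"
  using K_embed_spec by blast

lemma K_embed_ip_elem:
  "mip X (tensor_elem ys) (K_embed k) = cinner (tensor_vec ys) k *\<^sub>C rank_one h0 h0"
proof -
  obtain f where f: "(\<lambda>n. tensor_vec (f n)) \<longlonglongrightarrow> k"
    "(\<lambda>n. mnorm X (Mod.msub (tensor_elem (f n)) (K_embed k))) \<longlonglongrightarrow> 0"
    using K_embed_spec by blast
  have "(\<lambda>n. mip X (tensor_elem ys) (tensor_elem (f n))) \<longlonglongrightarrow> mip X (tensor_elem ys) (K_embed k)"
    by (rule Mod.tendsto_ip_right[OF tensor_elem_closed K_embed_closed tensor_elem_closed f(2)])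
  moreover have "(\<lambda>n. mip X (tensor_elem ys) (tensor_elem (f n))) \<longlonglongrightarrow> cinner (tensor_vec ys) k *\<^sub>C rank_one h0 h0"
    unfolding tensor_elem_ip by (intro tendsto_scaleC_left tendsto_intros f)
  ultimately show ?thesis by (rule LIMSEQ_unique)
qed

lemma K_embed_ip: "mip X (K_embed k) (K_embed l) = cinner k l *\<^sub>C rank_one h0 h0"
proof -
  obtain f where f: "(\<lambda>n. tensor_vec (f n)) \<longlonglongrightarrow> k"
    "(\<lambda>n. mnorm X (Mod.msub (tensor_elem (f n)) (K_embed k))) \<longlonglongrightarrow> 0"
    using K_embed_spec by blast
  have "(\<lambda>n. mip X (tensor_elem (f n)) (K_embed l)) \<longlonglongrightarrow> mip X (K_embed k) (K_embed l)"
    by (rule Mod.tendsto_ip_left[OF tensor_elem_closed K_embed_closed K_embed_closed f(2)])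
  moreover have "(\<lambda>n. mip X (tensor_elem (f n)) (K_embed l)) \<longlonglongrightarrow> cinner k l *\<^sub>C rank_one h0 h0"
    unfolding K_embed_ip_elem by (intro tendsto_scaleC_left tendsto_intros f)
  ultimately show ?thesis by (rule LIMSEQ_unique)
qed

text \<open>Right multiplication by \<open>rank_one g h0\<close> followed by evaluation at
  \<open>h0\<close> is evaluation at \<open>g\<close>, which reduces the claim to single
  tensors.\<close>

lemma K_embed_ip_gen:
  "bop_apply (mip X (\<sigma> a e) (K_embed k)) g = cinner (bop_apply (\<rho> a) (V g)) k *\<^sub>C h0"
proof -
  have "mip X (tensor_elem [(a, g)]) (K_embed k) = mip X (\<sigma> a e) (K_embed k) * rank_one g h0"
    by (simp add: tensor_elem_simps gen_eq Mod.closed_simps sigma_closed e_closed K_embed_closed Mod.ip_simps)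
  then have "bop_apply (mip X (\<sigma> a e) (K_embed k) * rank_one g h0) h0
      = bop_apply (cinner (tensor_vec [(a, g)]) k *\<^sub>C rank_one h0 h0) h0"
    by (simp add: K_embed_ip_elem)
  then show ?thesis
    by (simp add: bop_simps rank_one_apply h0_h0 scaleC_one tensor_vec_simps)
qed

text \<open>
  \<open>\<eta> \<mapsto> dual_op \<eta>\<close> is the identification of \<open>X'\<close> with the bounded operators from \<open>H\<close> to \<open>K\<close>;
  on \<open>X\<close> it sends \<open>\<sigma>(a) e b\<close> to \<open>\<rho>(a) V b\<close>.
\<close>

definition dual_op :: "('x \<Rightarrow> 'h bop) \<Rightarrow> 'h \<Rightarrow> 'k"
  where "dual_op \<eta> h = (SOME w. \<forall>a g. cinner (bop_apply (\<rho> a) (V g)) w = cinner (bop_apply (\<eta> (\<sigma> a e)) g) h)"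

lemma dual_op_spec:
  assumes \<eta>: "\<eta> \<in> bounded_module_maps X"
  shows "cinner (bop_apply (\<rho> a) (V g)) (dual_op \<eta> h) = cinner (bop_apply (\<eta> (\<sigma> a e)) g) h"
proof -
  define t where "t xs = (\<Sum>p\<leftarrow>xs. cinner (bop_apply (\<eta> (\<sigma> (fst p) e)) (snd p)) h)" for xs
  \<comment> \<open>On formal sums the functional is \<open>\<eta>\<close> at a module element of
    norm at most that of the tensor in \<open>K\<close>, so the bound of \<open>\<eta>\<close> is
    the bound that Riesz asks for.\<close>
  have t: "t xs = cinner (bop_apply (\<eta> (tensor_elem xs)) h0) h" for xs
    by (induction xs)
      (simp_all add: t_def tensor_elem_simps bmm_zero \<eta> bmm(1,3)[OF \<eta>] gen_eq Mod.closed_simps sigma_closed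
        e_closed tensor_elem_closed bop_simps cinner_add_left rank_one_apply h0_h0 scaleC_one)
  obtain C where C: "0 \<le> C" "\<And>x. x \<in> carrier X \<Longrightarrow> norm (\<eta> x) \<le> C * mnorm X x"
    using bmm_bound[OF \<eta>] by blast
  have "\<exists>w. w \<in> closure (range tensor_vec) \<and> norm w \<le> C * norm h \<and> (\<forall>xs. cinner (tensor_vec xs) w = t xs)"
  proof (rule riesz_family[where z = "[]" and add = "(@)" and scale = tensor_scale])
    fix xs
    have "cmod (t xs) \<le> norm (bop_apply (\<eta> (tensor_elem xs)) h0) * norm h"
      unfolding t by (rule cinner_cauchy_schwarz)
    also have "\<dots> \<le> norm (\<eta> (tensor_elem xs)) * norm h"
      using norm_bop_apply_le[of "\<eta> (tensor_elem xs)" h0] norm_h0 by (intro mult_right_mono) auto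
    also have "\<dots> \<le> (C * norm (tensor_vec xs)) * norm h"
    proof (intro mult_right_mono)
      show "norm (\<eta> (tensor_elem xs)) \<le> C * norm (tensor_vec xs)"
        using C(2)[OF tensor_elem_closed[of xs]] mult_left_mono[OF mnorm_le_of_ip[OF tensor_elem_ip[of xs xs]] C(1)]
        by simp
    qed simp
    finally show "cmod (t xs) \<le> C * norm h * norm (tensor_vec xs)" by (simp add: mult_ac)
  qed (simp_all add: C(1) tensor_vec_simps tensor_vec_scale,
      simp_all add: t_def tensor_scale_def o_def bop_apply_scaleC cinner_scaleC_left sum_list_const_mult)
  then obtain w where "\<And>xs. cinner (tensor_vec xs) w = t xs" by blast
  from this[of "[(_, _)]"]
  have "\<forall>a g. cinner (bop_apply (\<rho> a) (V g)) w = cinner (bop_apply (\<eta> (\<sigma> a e)) g) h"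
    by (simp add: tensor_vec_simps t_def)
  then have "\<forall>a g. cinner (bop_apply (\<rho> a) (V g)) (dual_op \<eta> h) = cinner (bop_apply (\<eta> (\<sigma> a e)) g) h"
    unfolding dual_op_def by (rule someI)
  then show ?thesis by blast
qed

lemma dual_op_eqI:
  assumes "\<eta> \<in> bounded_module_maps X"
    and "\<And>a g. cinner (bop_apply (\<rho> a) (V g)) w = cinner (bop_apply (\<eta> (\<sigma> a e)) g) h"
  shows "dual_op \<eta> h = w"
  by (rule dense_cinner_eqI[OF dense]) (auto simp: dual_op_spec[OF assms(1)] assms(2))

lemma dual_op_zero: "dual_op (mzero D) h = 0"
  by (rule dual_op_eqI) (use Dual.zero_closed in \<open>simp_all add: dual_sel sigma_closed e_closed\<close>)

lemma dual_op_e: "dual_op (hat X e) h = V h"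
  by (rule dual_op_eqI) (simp_all add: hat_closed e_closed hat_apply sigma_closed phi_ip phi_form)

lemma dual_op_K_embed: "dual_op (hat X (K_embed k)) h0 = k"
  by (rule dual_op_eqI)
    (simp_all add: hat_closed K_embed_closed hat_apply sigma_closed e_closed K_embed_ip_gen
      cinner_scaleC_left h0_h0)

lemma dual_op_add: "\<eta> \<in> bounded_module_maps X \<Longrightarrow> dual_op \<eta> (g + h) = dual_op \<eta> g + dual_op \<eta> h"
  by (rule dual_op_eqI) (simp_all add: dual_op_spec cinner_add_right)

lemma dual_op_scale: "\<eta> \<in> bounded_module_maps X \<Longrightarrow> dual_op \<eta> (c *\<^sub>C h) = c *\<^sub>C dual_op \<eta> h"
  by (rule dual_op_eqI) (simp_all add: dual_op_spec cinner_scaleC_right)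

lemma dual_op_hat_add: "x \<in> carrier X \<Longrightarrow> y \<in> carrier X \<Longrightarrow>
    dual_op (hat X (madd X x y)) h = dual_op (hat X x) h + dual_op (hat X y) h"
  by (rule dual_op_eqI)
    (simp_all add: dual_op_spec hat_closed Mod.closed_simps hat_apply sigma_closed e_closed Mod.ip_simps
      cinner_add_right bop_simps cinner_add_left)

lemma dual_op_hat_scale: "x \<in> carrier X \<Longrightarrow>
    dual_op (hat X (mscale X c x)) h = c *\<^sub>C dual_op (hat X x) h"
  by (rule dual_op_eqI)
    (simp_all add: dual_op_spec hat_closed Mod.closed_simps hat_apply sigma_closed e_closed Mod.ip_simps
      cinner_scaleC_right bop_simps cinner_scaleC_left)

lemma dual_op_hat_act: "x \<in> carrier X \<Longrightarrow>
    dual_op (hat X (mact X x b)) h = dual_op (hat X x) (bop_apply b h)"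
  by (rule dual_op_eqI)
    (simp_all add: dual_op_spec hat_closed Mod.closed_simps hat_apply sigma_closed e_closed Mod.ip_simps
      bop_simps bop_cinner_star')

lemma dual_op_tensor_elem: "dual_op (hat X (tensor_elem [(a, g)])) h0 = bop_apply (\<rho> a) (V g)"
proof (rule dense_cinner_eqI[OF dense], clarify)
  fix b h
  show "cinner (bop_apply (\<rho> b) (V h)) (dual_op (hat X (tensor_elem [(a, g)])) h0)
      = cinner (bop_apply (\<rho> b) (V h)) (bop_apply (\<rho> a) (V g))"
    by (simp add: dual_op_spec hat_closed tensor_elem_closed hat_apply sigma_closed e_closed)
      (simp add: tensor_elem_simps gen_eq Mod.closed_simps sigma_closed e_closed Mod.ip_simps sigma_e_ip
        bop_simps rank_one_star cinner_scaleC_left h0_h0 phi_form rho_simps bop_cinner_star')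
qed

lemma act_closed: "\<eta> \<in> bounded_module_maps X \<Longrightarrow> mact D \<eta> b \<in> bounded_module_maps X"
  using Dual.act_closed by (simp add: dual_sel(1))

lemma dual_op_act: "\<eta> \<in> bounded_module_maps X \<Longrightarrow> dual_op (mact D \<eta> b) h = dual_op \<eta> (bop_apply b h)"
  by (rule dual_op_eqI)
    (simp_all add: act_closed dual_op_spec, simp add: dual_sel sigma_closed e_closed bop_simps bop_cinner_star')

text \<open>A coefficient factoring through the line of \<open>h0\<close> pushes any functional into
  the copy of \<open>K\<close>. This brings all of \<open>X'\<close> back to hats, where the inner
  product is known.\<close>

lemma act_rank_one:
  assumes \<eta>: "\<eta> \<in> bounded_module_maps X"
  shows "mact D \<eta> (rank_one h h0) = hat X (K_embed (dual_op \<eta> h))"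
proof (rule bmm_eqI[OF act_closed[OF \<eta>] hat_closed[OF K_embed_closed]], rule bop_eqI)
  fix a b g
  show "bop_apply (mact D \<eta> (rank_one h h0) (\<sigma> a (mact X e b))) g
      = bop_apply (hat X (K_embed (dual_op \<eta> h)) (\<sigma> a (mact X e b))) g"
    by (simp add: dual_sel gen_eq Mod.closed_simps sigma_closed e_closed hat_apply Mod.ip_simps
        K_embed_closed bmm(3)[OF \<eta>] bop_simps rank_one_star K_embed_ip_gen dual_op_spec[OF \<eta>])
qed

text \<open>Acting with \<open>rank_one h h0\<close> and \<open>rank_one k h0\<close> isolates one
  matrix coefficient of \<open>ip' \<eta> \<zeta>\<close>, and turns both arguments into elements of
  the copy of \<open>K\<close>.\<close>

lemma ip'_dual_op:
  assumes \<eta>: "\<eta> \<in> bounded_module_maps X" and \<zeta>: "\<zeta> \<in> bounded_module_maps X"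
  shows "cinner (bop_apply (ip' \<eta> \<zeta>) h) k = cinner (dual_op \<eta> h) (dual_op \<zeta> k)"
proof -
  have "ip' (mact D \<eta> (rank_one h h0)) (mact D \<zeta> (rank_one k h0))
      = star (rank_one k h0) * (ip' \<eta> \<zeta> * rank_one h h0)"
    using Dual.ip_act_left[of \<eta> "mact D \<zeta> (rank_one k h0)" "rank_one h h0"]
      Dual.ip_act_right[of \<eta> \<zeta> "rank_one k h0"] act_closed[OF \<zeta>, of "rank_one k h0"] \<eta> \<zeta>
    by (simp add: dual_sel(1,2) mult.assoc)
  moreover have "ip' (mact D \<eta> (rank_one h h0)) (mact D \<zeta> (rank_one k h0))
      = cinner (dual_op \<eta> h) (dual_op \<zeta> k) *\<^sub>C rank_one h0 h0"
    by (simp add: act_rank_one \<eta> \<zeta> ip'_hat K_embed_closed K_embed_ip)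
  ultimately have "cinner (bop_apply (star (rank_one k h0) * (ip' \<eta> \<zeta> * rank_one h h0)) h0) h0
      = cinner (bop_apply (cinner (dual_op \<eta> h) (dual_op \<zeta> k) *\<^sub>C rank_one h0 h0) h0) h0" by simp
  then show ?thesis
    by (simp add: bop_simps rank_one_star rank_one_apply h0_h0 scaleC_one cinner_scaleC_left)
qed

lemma dual_op_inj:
  assumes "\<eta> \<in> bounded_module_maps X" "\<zeta> \<in> bounded_module_maps X" "\<And>h. dual_op \<eta> h = dual_op \<zeta> h"
  shows "\<eta> = \<zeta>"
  using assms by (intro Dual.ip_eqI bop_cinner_eqI) (simp_all add: dual_sel(1,2) ip'_dual_op)

lemma norm_dual_op_le: "\<eta> \<in> bounded_module_maps X \<Longrightarrow> norm (dual_op \<eta> h) \<le> mnorm D \<eta> * norm h"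
  by (rule power2_le_imp_le)
    (use Dual.ip_self_le[of \<eta> h] in \<open>simp_all add: dual_sel(1,2) ip'_dual_op cinner_self
      power_mult_distrib Dual.mnorm_nonneg\<close>)

lemma mnorm_hat: "x \<in> carrier X \<Longrightarrow> mnorm D (hat X x) = mnorm X x"
  by (simp add: mnorm_def dual_sel(2) ip'_hat)

section \<open>Transport of the representations and their commutants between \<open>X'\<close> and
  \<open>K\<close>\<close>

lemma sigma'_closed: "\<eta> \<in> bounded_module_maps X \<Longrightarrow> \<sigma>' a \<eta> \<in> bounded_module_maps X"
  and W'_closed: "g \<in> carrier G \<Longrightarrow> \<eta> \<in> bounded_module_maps X \<Longrightarrow> W' g \<eta> \<in> bounded_module_maps X"
  using Dual.adjointable_closed sigma_ext[of a] W_ext[of g] by (simp_all add: dual_extension_def dual_sel(1))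

lemma dual_op_sigma':
  assumes \<eta>: "\<eta> \<in> bounded_module_maps X"
  shows "dual_op (\<sigma>' a \<eta>) h = bop_apply (\<rho> a) (dual_op \<eta> h)"
proof (rule dual_op_eqI[OF sigma'_closed[OF \<eta>]])
  fix b g
  have "cinner (bop_apply (\<rho> b) (V g)) (bop_apply (\<rho> a) (dual_op \<eta> h))
      = cinner (bop_apply (\<rho> (star a * b)) (V g)) (dual_op \<eta> h)"
    by (simp add: rho_simps bop_simps bop_cinner_star')
  then show "cinner (bop_apply (\<rho> b) (V g)) (bop_apply (\<rho> a) (dual_op \<eta> h))
      = cinner (bop_apply (\<sigma>' a \<eta> (\<sigma> b e)) g) h"
    by (simp add: dual_op_spec[OF \<eta>] dual_extension_apply[OF sigma_adj sigma_ext \<eta>] sigma_closed e_closed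
        sigma_mult flip: sigma_star)
qed

lemma dual_op_W':
  assumes g: "g \<in> carrier G" and \<eta>: "\<eta> \<in> bounded_module_maps X"
  shows "dual_op (W' g \<eta>) h = bop_apply (U g) (dual_op \<eta> h)"
proof -
  \<comment> \<open>The extension is evaluated through the adjoint of \<open>W g\<close>, which is
    known on the vectors \<open>\<sigma> (\<tau> g a) e\<close>. It is therefore the inverse
    relation that can be tested on generators.\<close>
  have "dual_op \<eta> h = bop_apply (star (U g)) (dual_op (W' g \<eta>) h)"
  proof (rule dual_op_eqI[OF \<eta>])
    fix a k
    have "cinner (bop_apply (\<rho> a) (V k)) (bop_apply (star (U g)) (dual_op (W' g \<eta>) h))
        = cinner (bop_apply (\<rho> (\<tau> g a)) (V k)) (dual_op (W' g \<eta>) h)"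
      by (simp add: U_rho_V[OF g] flip: bop_cinner_star)
    then show "cinner (bop_apply (\<rho> a) (V k)) (bop_apply (star (U g)) (dual_op (W' g \<eta>) h))
        = cinner (bop_apply (\<eta> (\<sigma> a e)) k) h"
      by (simp add: dual_op_spec[OF W'_closed[OF g \<eta>]] dual_extension_apply[OF W_adj[OF g] W_ext[OF g] \<eta>]
          sigma_closed e_closed W_adj_sigma_e[OF g])
  qed
  then have "bop_apply (U g) (dual_op \<eta> h) = bop_apply (U g * star (U g)) (dual_op (W' g \<eta>) h)"
    by (simp add: bop_simps)
  then show ?thesis by (simp add: U_unitary[OF g] bop_simps)
qed

text \<open>Restricting \<open>T\<close> to the copy of \<open>K\<close> and reading the result at
  \<open>h0\<close> gives a map on \<open>K\<close>. The adjoint of \<open>T\<close>, treated alike,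
  is a formal adjoint for it, so \<open>hellinger_toeplitz\<close> provides the bounded operator
  \<open>T0\<close> to which faithfulness applies.\<close>

lemma faithful_imp_dual_separating:
  assumes faithful: "\<And>T. T \<in> M \<Longrightarrow> (\<And>h k. cinner (bop_apply T (V h)) (V k) = 0) \<Longrightarrow> T = 0"
    and T: "T \<in> mcommutant D (range \<sigma>' \<union> W' ` carrier G)" and zero: "ip' (T (hat X e)) (hat X e) = 0"
    and \<eta>: "\<eta> \<in> bounded_module_maps X"
  shows "T \<eta> = mzero D"
proof -
  have adj: "T \<in> adjointable D" using T by (simp add: mcommutant_def)
  have closed: "T \<zeta> \<in> bounded_module_maps X" if "\<zeta> \<in> bounded_module_maps X" for \<zeta>
    using Dual.adjointable_closed[OF adj] that by (simp add: dual_sel(1))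
  have closed': "madjoint D T \<zeta> \<in> bounded_module_maps X" if "\<zeta> \<in> bounded_module_maps X" for \<zeta>
    using Dual.madjoint_closed[OF adj] that by (simp add: dual_sel(1))
  have hat_K_embed: "hat X (K_embed k) \<in> bounded_module_maps X" for k
    by (rule hat_closed[OF K_embed_closed])
  have "cinner (dual_op (T (hat X (K_embed k))) h0) l = cinner k (dual_op (madjoint D T (hat X (K_embed l))) h0)" for k l
  proof -
    have "cinner (dual_op (T (hat X (K_embed k))) h0) (dual_op (hat X (K_embed l)) h0)
        = cinner (dual_op (hat X (K_embed k)) h0) (dual_op (madjoint D T (hat X (K_embed l))) h0)"
      using Dual.madjoint_ip[OF adj, of "hat X (K_embed k)" "hat X (K_embed l)"]
      by (simp add: hat_K_embed closed closed' dual_sel(1,2) flip: ip'_dual_op)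
    then show ?thesis by (simp add: dual_op_K_embed)
  qed
  then obtain T0 where T0: "bop_apply T0 = (\<lambda>k. dual_op (T (hat X (K_embed k))) h0)"
    by (rule hellinger_toeplitz)
  \<comment> \<open>Module linearity of \<open>T\<close> spreads the defining relation from the copy
    of \<open>K\<close> to all functionals: \<open>rank_one h h0\<close> carries \<open>h0\<close>
    to an arbitrary \<open>h\<close>.\<close>
  have T0_dual_op: "bop_apply T0 (dual_op \<zeta> h) = dual_op (T \<zeta>) h" if \<zeta>: "\<zeta> \<in> bounded_module_maps X" for \<zeta> h
  proof -
    have "bop_apply T0 (dual_op \<zeta> h) = dual_op (mact D (T \<zeta>) (rank_one h h0)) h0"
      using Dual.adjointable_act[OF adj, of \<zeta> "rank_one h h0"] \<zeta>
      by (simp add: T0 dual_sel(1) flip: act_rank_one)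
    then show ?thesis by (simp add: dual_op_act[OF closed[OF \<zeta>]] rank_one_apply h0_h0 scaleC_one)
  qed
  have comm: "T (\<sigma>' a \<zeta>) = \<sigma>' a (T \<zeta>)" "g \<in> carrier G \<Longrightarrow> T (W' g \<zeta>) = W' g (T \<zeta>)"
    if "\<zeta> \<in> bounded_module_maps X" for a g \<zeta>
    using T that by (simp_all add: mcommutant_def dual_sel(1))
  have "T0 = 0"
  proof (rule faithful)
    show "T0 \<in> M"
    proof (rule commutantI; rule bop_eqI)
      fix a k
      have "bop_apply T0 (bop_apply (\<rho> a) (dual_op (hat X (K_embed k)) h0))
          = bop_apply (\<rho> a) (bop_apply T0 (dual_op (hat X (K_embed k)) h0))"
        by (simp only: dual_op_sigma'[symmetric] T0_dual_op hat_K_embed sigma'_closed closed comm)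
      then show "bop_apply (T0 * \<rho> a) k = bop_apply (\<rho> a * T0) k"
        by (simp add: bop_simps dual_op_K_embed)
    next
      fix g k assume g: "g \<in> carrier G"
      have "bop_apply T0 (bop_apply (U g) (dual_op (hat X (K_embed k)) h0))
          = bop_apply (U g) (bop_apply T0 (dual_op (hat X (K_embed k)) h0))"
        by (simp only: dual_op_W'[OF g, symmetric] T0_dual_op hat_K_embed W'_closed[OF g] closed comm(2)[OF _ g])
      then show "bop_apply (T0 * U g) k = bop_apply (U g * T0) k"
        by (simp add: bop_simps dual_op_K_embed)
    qed
    fix h k
    have "cinner (bop_apply T0 (V h)) (V k) = cinner (bop_apply (ip' (T (hat X e)) (hat X e)) h) k"
      by (simp add: ip'_dual_op closed hat_closed e_closed dual_op_e flip: T0_dual_op)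
    then show "cinner (bop_apply T0 (V h)) (V k) = 0" by (simp add: zero)
  qed
  then have "dual_op (T \<eta>) h = 0" for h using T0_dual_op[OF \<eta>, of h] by simp
  then show ?thesis
    using Dual.zero_closed by (intro dual_op_inj closed \<eta>) (simp_all add: dual_sel(1) dual_op_zero)
qed

text \<open>\<open>transfer_op B\<close> is the operator on \<open>X'\<close> that corresponds to composition with \<open>B\<close> on \<open>B(H, K)\<close>.\<close>

definition transfer_op :: "'k bop \<Rightarrow> ('x \<Rightarrow> 'h bop) \<Rightarrow> ('x \<Rightarrow> 'h bop)"
  where "transfer_op B = (\<lambda>\<eta>\<in>carrier D. \<lambda>x\<in>carrier X.
    SOME R. \<forall>g h. cinner (bop_apply R g) h = cinner (dual_op (hat X x) g) (bop_apply B (dual_op \<eta> h)))"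

text \<open>Since a functional at \<open>x\<close> is its inner product with \<open>hat X x\<close>,
  the formula prescribes that inner product after composing with \<open>B\<close>. Its boundedness
  both produces the operator chosen in the definition and makes the new functional bounded.\<close>

lemma transfer_op_form:
  assumes \<eta>: "\<eta> \<in> bounded_module_maps X" and x: "x \<in> carrier X"
  shows "cinner (bop_apply (transfer_op B \<eta> x) g) h = cinner (dual_op (hat X x) g) (bop_apply B (dual_op \<eta> h))"
    and "norm (transfer_op B \<eta> x) \<le> (norm B * mnorm D \<eta>) * mnorm X x"
proof -
  let ?F = "\<lambda>g h. cinner (dual_op (hat X x) g) (bop_apply B (dual_op \<eta> h))"
  let ?C = "(norm B * mnorm D \<eta>) * mnorm X x"
  have C: "0 \<le> ?C" by (simp add: Dual.mnorm_nonneg Mod.mnorm_nonneg)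
  have bound: "cmod (?F g h) \<le> ?C * norm g * norm h" for g h
  proof -
    have "cmod (?F g h) \<le> norm (dual_op (hat X x) g) * norm (bop_apply B (dual_op \<eta> h))"
      by (rule cinner_cauchy_schwarz)
    also have "\<dots> \<le> (mnorm X x * norm g) * (norm B * (mnorm D \<eta> * norm h))"
      using norm_dual_op_le[OF hat_closed[OF x], of g] order_trans[OF norm_bop_apply_le mult_left_mono[OF norm_dual_op_le[OF \<eta>]]]
      by (intro mult_mono) (simp_all add: mnorm_hat x Mod.mnorm_nonneg)
    finally show ?thesis by (simp add: mult_ac)
  qed
  have "\<exists>R. \<forall>g h. cinner (bop_apply R g) h = ?F g h"
    by (rule bounded_sesquilinear_bop[where C = ?C])
      (simp_all add: dual_op_add dual_op_scale hat_closed x \<eta> bop_apply_add bop_apply_scaleC cinner_add_left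
        cinner_add_right cinner_scaleC_left cinner_scaleC_right C bound)
  from someI_ex[OF this] have *: "cinner (bop_apply (transfer_op B \<eta> x) g) h = ?F g h" for g h
    by (simp add: transfer_op_def dual_sel(1) \<eta> x)
  then show "cinner (bop_apply (transfer_op B \<eta> x) g) h = ?F g h" .
  show "norm (transfer_op B \<eta> x) \<le> ?C"
    by (rule norm_bop_le_form[OF C]) (simp add: * bound)
qed

lemma transfer_op_closed:
  assumes \<eta>: "\<eta> \<in> bounded_module_maps X"
  shows "transfer_op B \<eta> \<in> bounded_module_maps X"
  unfolding bounded_module_maps_def
proof (intro CollectI conjI ballI allI)
  show "transfer_op B \<eta> \<in> extensional (carrier X)"
    using \<eta> by (simp add: transfer_op_def dual_sel(1))
  show "\<exists>C. \<forall>x\<in>carrier X. norm (transfer_op B \<eta> x) \<le> C * mnorm X x"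
    using transfer_op_form(2)[OF \<eta>] by blast
qed (rule bop_cinner_eqI, simp add: transfer_op_form(1)[OF \<eta>] Mod.closed_simps dual_op_hat_add dual_op_hat_scale
    dual_op_hat_act bop_simps cinner_add_left cinner_scaleC_left)+

lemma dual_op_transfer_op:
  assumes \<eta>: "\<eta> \<in> bounded_module_maps X"
  shows "dual_op (transfer_op B \<eta>) h = bop_apply B (dual_op \<eta> h)"
proof (rule dual_op_eqI[OF transfer_op_closed[OF \<eta>]])
  fix a g
  have "dual_op (hat X (\<sigma> a e)) g = bop_apply (\<rho> a) (V g)"
  proof -
    \<comment> \<open>The fold behind \<open>tensor_elem\<close> ends in \<open>mzero X\<close>; the
      second method discharges its vanishing contribution.\<close>
    have "dual_op (hat X (tensor_elem [(a, g)])) h0 = dual_op (hat X (\<sigma> a e)) g"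
      by (simp add: tensor_elem_simps gen_eq dual_op_hat_add dual_op_hat_act Mod.closed_simps sigma_closed
          e_closed rank_one_apply h0_h0 scaleC_one)
        (rule dual_op_eqI, simp_all add: hat_closed Mod.zero_closed hat_apply sigma_closed e_closed Mod.ip_simps)
    then show ?thesis by (simp add: dual_op_tensor_elem)
  qed
  then show "cinner (bop_apply (\<rho> a) (V g)) (bop_apply B (dual_op \<eta> h))
      = cinner (bop_apply (transfer_op B \<eta> (\<sigma> a e)) g) h"
    by (simp add: transfer_op_form(1)[OF \<eta>] sigma_closed e_closed)
qed

lemma transfer_op_adjointable: "transfer_op B \<in> adjointable D"
proof -
  have "transfer_op B \<in> carrier D \<rightarrow>\<^sub>E carrier D" for B
    by (auto simp: dual_sel(1) transfer_op_closed) (simp add: transfer_op_def dual_sel(1))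
  moreover have "ip' (transfer_op B \<eta>) \<zeta> = ip' \<eta> (transfer_op (star B) \<zeta>)"
    if "\<eta> \<in> bounded_module_maps X" "\<zeta> \<in> bounded_module_maps X" for \<eta> \<zeta>
    using that by (intro bop_cinner_eqI)
      (simp add: ip'_dual_op transfer_op_closed dual_op_transfer_op bop_cinner_star[of B])
  ultimately show ?thesis
    unfolding adjointable_def is_madjoint_def
    by (intro CollectI conjI exI[of _ "transfer_op (star B)"]) (simp_all add: dual_sel(1,2))
qed

lemma dual_separating_imp_faithful:
  assumes separating: "\<And>T \<eta>. T \<in> mcommutant D (range \<sigma>' \<union> W' ` carrier G) \<Longrightarrow>
      ip' (T (hat X e)) (hat X e) = 0 \<Longrightarrow> \<eta> \<in> bounded_module_maps X \<Longrightarrow> T \<eta> = mzero D"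
    and B: "B \<in> M" "\<And>h k. cinner (bop_apply B (V h)) (V k) = 0"
  shows "B = 0"
proof (rule bop_eqI)
  fix k
  have comm: "bop_apply B (bop_apply (\<rho> a) v) = bop_apply (\<rho> a) (bop_apply B v)"
    "g \<in> carrier G \<Longrightarrow> bop_apply B (bop_apply (U g) v) = bop_apply (U g) (bop_apply B v)" for a g v
    using commutantD[OF B(1)] by (metis bop_simps(4))+
  have 1: "transfer_op B \<in> mcommutant D (range \<sigma>' \<union> W' ` carrier G)"
    unfolding mcommutant_def
    by (auto simp: transfer_op_adjointable dual_sel(1) intro!: dual_op_inj)
      (simp_all add: transfer_op_closed sigma'_closed W'_closed dual_op_transfer_op dual_op_sigma' dual_op_W' comm)
  have 2: "ip' (transfer_op B (hat X e)) (hat X e) = 0"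
    by (rule bop_cinner_eqI)
      (simp add: ip'_dual_op transfer_op_closed hat_closed e_closed dual_op_transfer_op dual_op_e B(2))
  have hat_K_embed: "hat X (K_embed k) \<in> bounded_module_maps X" by (rule hat_closed[OF K_embed_closed])
  \<comment> \<open>The hat of \<open>K_embed k\<close>, read at \<open>h0\<close>, returns
    \<open>k\<close>, so vanishing of the transferred operator at this one functional gives
    \<open>B k = 0\<close>.\<close>
  have "bop_apply B (dual_op (hat X (K_embed k)) h0) = 0"
    using separating[OF 1 2 hat_K_embed] dual_op_zero[of h0] dual_op_transfer_op[OF hat_K_embed, of B h0] by simp
  then show "bop_apply B k = bop_apply 0 k" by (simp add: dual_op_K_embed)
qed

end

section \<open>Extreme points\<close>

theorem theorem4p4:
  fixes G :: "('g, 'm) monoid_scheme"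
    and \<tau> :: "'g \<Rightarrow> 'a::cstar_algebra \<Rightarrow> 'a"
    and \<phi> :: "'a \<Rightarrow> 'h::complex_hilbert bop"
    and \<rho> :: "'a \<Rightarrow> 'k::complex_hilbert bop"
    and V :: "'h \<Rightarrow> 'k"
    and U :: "'g \<Rightarrow> 'k bop"
    and X :: "('x, 'h bop) hmodule"
    and \<sigma> :: "'a \<Rightarrow> 'x \<Rightarrow> 'x"
    and e :: 'x
    and W :: "'g \<Rightarrow> 'x \<Rightarrow> 'x"
    and ip' :: "('x \<Rightarrow> 'h bop) \<Rightarrow> ('x \<Rightarrow> 'h bop) \<Rightarrow> 'h bop"
    and \<sigma>' :: "'a \<Rightarrow> ('x \<Rightarrow> 'h bop) \<Rightarrow> ('x \<Rightarrow> 'h bop)"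
    and W' :: "'g \<Rightarrow> ('x \<Rightarrow> 'h bop) \<Rightarrow> ('x \<Rightarrow> 'h bop)"
  assumes "separable_space (euclidean :: 'a topology)"
    and "separable_space (euclidean :: 'h topology)"
    and "group G"
    and "cstar_action G \<tau>"
    and "\<phi> \<in> UCP G \<tau>"
    and "minimal_stinespring \<phi> \<rho> V"
    and "stinespring_unitary_rep G \<tau> \<rho> V U"
    and "paschke_dilation \<phi> X \<sigma> e"
    and "paschke_unitary_rep G \<tau> X \<sigma> e W"
    and "dual_inner_product X ip'"
    and "\<And>a. dual_extension X ip' (\<sigma> a) (\<sigma>' a)"
    and "\<And>g. g \<in> carrier G \<Longrightarrow> dual_extension X ip' (W g) (W' g)"
  shows "(\<phi> extreme_point_of UCP G \<tau>
          \<longleftrightarrow> (\<forall>t::real. 0 < t \<and> t < 1 \<longrightarrow>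
                (\<forall>\<phi>\<^sub>0 \<in> cp_interval \<phi> \<inter> (\<lambda>\<psi>. t *\<^sub>R \<psi>) ` UCP G \<tau>. \<phi>\<^sub>0 = t *\<^sub>R \<phi>)))
       \<and> (\<phi> extreme_point_of UCP G \<tau>
          \<longleftrightarrow> faithful_subspace (bop_commutant (range \<rho> \<union> U ` carrier G)) (closure (cspan (range V))))
       \<and> (\<phi> extreme_point_of UCP G \<tau>
          \<longleftrightarrow> (\<forall>T \<in> mcommutant (dual_module X ip') (range \<sigma>' \<union> W' ` carrier G).
                ip' (T (hat X e)) (hat X e) = 0 \<longrightarrow>
                (\<forall>\<eta> \<in> carrier (dual_module X ip'). T \<eta> = mzero (dual_module X ip'))))"
proof -
  interpret stinespring: covariant_stinespring G \<tau> \<phi> \<rho> V U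
    by (rule covariant_stinespring.intro) fact+
  let ?extreme = "\<phi> extreme_point_of UCP G \<tau>"
  let ?pure = "\<forall>t::real. 0 < t \<and> t < 1 \<longrightarrow>
    (\<forall>\<phi>\<^sub>0 \<in> cp_interval \<phi> \<inter> (\<lambda>\<psi>. t *\<^sub>R \<psi>) ` UCP G \<tau>. \<phi>\<^sub>0 = t *\<^sub>R \<phi>)"
  let ?faithful = "faithful_subspace (bop_commutant (range \<rho> \<union> U ` carrier G)) (closure (cspan (range V)))"
  let ?separating = "\<forall>T \<in> mcommutant (dual_module X ip') (range \<sigma>' \<union> W' ` carrier G).
    ip' (T (hat X e)) (hat X e) = 0 \<longrightarrow>
    (\<forall>\<eta> \<in> carrier (dual_module X ip'). T \<eta> = mzero (dual_module X ip'))"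
  have 1: "?faithful" if "?extreme"
    unfolding stinespring.faithful_iff using stinespring.extreme_imp_faithful[OF that] by blast
  have 2: "?pure" if "?faithful"
    using that stinespring.faithful_imp_pure unfolding stinespring.faithful_iff by blast
  have 3: "?extreme" if "?pure"
    by (rule stinespring.pure_imp_extreme) (use that in blast)
  have 4: "?faithful \<longleftrightarrow> ?separating"
  proof (cases "\<exists>h0 :: 'h. norm h0 = 1")
    case True
    then obtain h0 :: 'h where h0: "norm h0 = 1" by blast
    interpret paschke: covariant_paschke G \<tau> \<phi> \<rho> V U X \<sigma> e W ip' \<sigma>' W' h0
      by (rule covariant_paschke.intro[OF stinespring.covariant_stinespring_axioms
            covariant_paschke_axioms.intro]) (fact assms h0)+
    show ?thesis
      unfolding stinespring.faithful_iff paschke.dual_sel(1)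
    proof (intro iffI ballI impI)
      fix T \<eta>
      assume faithful: "\<forall>T\<in>stinespring.M. (\<forall>h k. cinner (bop_apply T (V h)) (V k) = 0) \<longrightarrow> T = 0"
        and T: "T \<in> mcommutant (dual_module X ip') (range \<sigma>' \<union> W' ` carrier G)"
          "ip' (T (hat X e)) (hat X e) = 0"
        and \<eta>: "\<eta> \<in> bounded_module_maps X"
      show "T \<eta> = mzero (dual_module X ip')"
        by (rule paschke.faithful_imp_dual_separating[OF _ T \<eta>]) (use faithful in blast)
    next
      fix T
      assume separating: "\<forall>T\<in>mcommutant (dual_module X ip') (range \<sigma>' \<union> W' ` carrier G).
          ip' (T (hat X e)) (hat X e) = 0 \<longrightarrow> (\<forall>\<eta>\<in>bounded_module_maps X. T \<eta> = mzero (dual_module X ip'))"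
        and T: "T \<in> stinespring.M" and zero: "\<forall>h k. cinner (bop_apply T (V h)) (V k) = 0"
      show "T = 0"
        by (rule paschke.dual_separating_imp_faithful[OF _ T])
          (use separating in blast, use zero in blast)
    qed
  next
    case False
    \<comment> \<open>Normalising a nonzero vector would give a unit vector, so \<open>H\<close> is
      zero. Then the bounded operators on \<open>H\<close> form a single point, which makes all
      functionals on the module equal, and the dense span of the dilation is zero, which makes all
      operators on \<open>K\<close> equal.\<close>
    have H: "h = 0" for h :: 'h
    proof (rule ccontr)
      assume "h \<noteq> 0"
      then have "norm (inverse (norm h) *\<^sub>R h) = 1" by simp
      with False show False by blast
    qed
    have B: "S = T" for S T :: "'h bop"
      by (rule bop_eqI) (rule trans[OF H H[symmetric]])
    have "?faithful"
      unfolding stinespring.faithful_iff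
    proof (intro ballI impI)
      fix T :: "'k bop"
      show "T = 0"
      proof (rule dense_bop_eqI[OF stinespring.dense], clarify)
        fix a h b k
        have "V h = 0" unfolding H[of h] by (rule stinespring.V_zero)
        then show "cinner (bop_apply T (bop_apply (\<rho> a) (V h))) (bop_apply (\<rho> b) (V k))
            = cinner (bop_apply 0 (bop_apply (\<rho> a) (V h))) (bop_apply (\<rho> b) (V k))" by simp
      qed
    qed
    moreover have "?separating"
    proof (intro ballI impI)
      fix T \<eta>
      assume T: "T \<in> mcommutant (dual_module X ip') (range \<sigma>' \<union> W' ` carrier G)"
        and \<eta>: "\<eta> \<in> carrier (dual_module X ip')"
      have "T \<eta> \<in> carrier (dual_module X ip')"
        using T \<eta> by (auto simp: mcommutant_def adjointable_def)
      then have "T \<eta> \<in> extensional (carrier X)"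
        by (simp add: dual_module_def bounded_module_maps_def)
      then show "T \<eta> = mzero (dual_module X ip')"
        by (rule extensionalityI) (simp add: dual_module_def, rule B)
    qed
    ultimately show ?thesis by blast
  qed
  show ?thesis using 1 2 3 4 by blast
qed

end
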